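(* Assume hypothesis $(H_{1/6})$. Then there is no polynomial time algorithm which, given an $n\times n$ matrix $\Phi$, outputs "yes" whenever $\delta_{n^{0.6}}(\Phi) \leq n^{-0.19}$ and outputs "no" whenever $\delta_{n^{0.6}}(\Phi) \geq n^{-1/6}/4$ (for all sufficiently large $n$).
   Context: A vector is $k$-sparse if it has at most $k$ nonzero coordinates. A matrix $\Phi$ satisfies the restricted isometry property (RIP) of order $k$ with parameter $\delta$ if $(1-\delta)\|x\|^2\leq\|\Phi x\|^2\leq(1+\delta)\|x\|^2$ for all $k$-sparse $x$; the RIP parameter of order $k$, $\delta_k(\Phi)$, is the smallest such $\delta \geq 0$. $G(n,1/2)$ denotes the uniform distribution on graphs with $n$ vertices. Hypothesis $(H_\epsilon)$: there is no polynomial time algorithm which, given as input a graph $G$ on $n$ vertices, (i) always outputs "yes" if $G$ contains a clique of size $n^{1/2-\epsilon}$, and (ii) outputs "no clique" with probability tending to $1$ as $n\to\infty$ when $G$ is drawn from $G(n,1/2)$. Floor and ceiling signs are omitted. *)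

theory Defs
  imports
    "HOL-Probability.Probability_Mass_Function"
    "HOL-Library.Log_Nat"
    "Jordan_Normal_Form.Matrix"
begin

no_notation Finite_Cartesian_Product.vec_nth (infixl "$" 90)


section \<open>The restricted isometry property\<close>

text \<open>Vectors and matrices are those of \<open>Jordan_Normal_Form\<close>, whose dimensions are natural
  numbers rather than types.\<close>

definition l2_norm :: "real Matrix.vec \<Rightarrow> real" where
  "l2_norm x = L2_set (\<lambda>i. x $ i) {..<dim_vec x}"

definition sparse :: "nat \<Rightarrow> real Matrix.vec \<Rightarrow> bool" where
  "sparse k x \<longleftrightarrow> card {i. i < dim_vec x \<and> x $ i \<noteq> 0} \<le> k"

definition rip :: "nat \<Rightarrow> real \<Rightarrow> real Matrix.mat \<Rightarrow> bool" where
  "rip k \<delta> \<Phi> \<longleftrightarrow>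
     (\<forall>x \<in> carrier_vec (dim_col \<Phi>). sparse k x \<longrightarrow>
        (1 - \<delta>) * (l2_norm x)\<^sup>2 \<le> (l2_norm (\<Phi> *\<^sub>v x))\<^sup>2 \<and>
        (l2_norm (\<Phi> *\<^sub>v x))\<^sup>2 \<le> (1 + \<delta>) * (l2_norm x)\<^sup>2)"

text \<open>The minimum always exists, see \<open>rip_param_is_least\<close> below.\<close>

definition rip_param :: "nat \<Rightarrow> real Matrix.mat \<Rightarrow> real" where
  "rip_param k \<Phi> = (LEAST \<delta>. 0 \<le> \<delta> \<and> rip k \<delta> \<Phi>)"

lemma l2_norm_mult_bound:
  "\<exists>B. \<forall>x \<in> carrier_vec (dim_col \<Phi>). (l2_norm (\<Phi> *\<^sub>v x))\<^sup>2 \<le> B * (l2_norm x)\<^sup>2"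
proof (intro exI ballI)
  fix x :: "real Matrix.vec"
  assume x: "x \<in> carrier_vec (dim_col \<Phi>)"
  let ?r = "\<lambda>i. L2_set (\<lambda>j. \<Phi> $$ (i, j)) {..<dim_col \<Phi>}"
  have row: "((\<Phi> *\<^sub>v x) $ i)\<^sup>2 \<le> (?r i)\<^sup>2 * (l2_norm x)\<^sup>2" if i: "i < dim_row \<Phi>" for i
  proof -
    have "(\<Phi> *\<^sub>v x) $ i = (\<Sum>j<dim_col \<Phi>. \<Phi> $$ (i, j) * x $ j)"
      using i x by (auto simp: scalar_prod_def lessThan_atLeast0 intro!: sum.cong)
    then have "\<bar>(\<Phi> *\<^sub>v x) $ i\<bar> \<le> (\<Sum>j<dim_col \<Phi>. \<bar>\<Phi> $$ (i, j)\<bar> * \<bar>x $ j\<bar>)"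
      by (metis (no_types, lifting) abs_mult sum.cong sum_abs)
    also have "\<dots> \<le> ?r i * L2_set (\<lambda>j. x $ j) {..<dim_col \<Phi>}"
      by (rule L2_set_mult_ineq)
    also have "\<dots> = ?r i * l2_norm x"
      using x by (simp add: l2_norm_def)
    finally have "\<bar>(\<Phi> *\<^sub>v x) $ i\<bar> \<le> ?r i * l2_norm x" .
    then have "\<bar>(\<Phi> *\<^sub>v x) $ i\<bar>\<^sup>2 \<le> (?r i * l2_norm x)\<^sup>2"
      by (rule power_mono) simp
    then show ?thesis by (simp add: power_mult_distrib)
  qed
  have "(l2_norm (\<Phi> *\<^sub>v x))\<^sup>2 = (\<Sum>i<dim_row \<Phi>. ((\<Phi> *\<^sub>v x) $ i)\<^sup>2)"
    by (simp add: l2_norm_def L2_set_def sum_nonneg)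
  also have "\<dots> \<le> (\<Sum>i<dim_row \<Phi>. (?r i)\<^sup>2 * (l2_norm x)\<^sup>2)"
    using row by (intro sum_mono) auto
  also have "\<dots> = (\<Sum>i<dim_row \<Phi>. (?r i)\<^sup>2) * (l2_norm x)\<^sup>2"
    by (simp add: sum_distrib_right)
  finally show "(l2_norm (\<Phi> *\<^sub>v x))\<^sup>2 \<le> (\<Sum>i<dim_row \<Phi>. (?r i)\<^sup>2) * (l2_norm x)\<^sup>2" .
qed

lemma rip_param_is_least:
  shows "0 \<le> rip_param k \<Phi>" and "rip k (rip_param k \<Phi>) \<Phi>"
    and "\<And>\<delta>. 0 \<le> \<delta> \<Longrightarrow> rip k \<delta> \<Phi> \<Longrightarrow> rip_param k \<Phi> \<le> \<delta>"
proof -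
  let ?S = "{\<delta>. 0 \<le> \<delta> \<and> rip k \<delta> \<Phi>}"
  obtain B where B: "\<forall>x \<in> carrier_vec (dim_col \<Phi>). (l2_norm (\<Phi> *\<^sub>v x))\<^sup>2 \<le> B * (l2_norm x)\<^sup>2"
    using l2_norm_mult_bound by blast
  have "rip k (max 1 B) \<Phi>"
    unfolding rip_def
  proof (intro ballI impI conjI)
    fix x :: "real Matrix.vec"
    assume x: "x \<in> carrier_vec (dim_col \<Phi>)"
    have "(1 - max 1 B) * (l2_norm x)\<^sup>2 \<le> 0"
      by (rule mult_nonpos_nonneg) auto
    then show "(1 - max 1 B) * (l2_norm x)\<^sup>2 \<le> (l2_norm (\<Phi> *\<^sub>v x))\<^sup>2"
      by (rule order_trans) simp
    have "B * (l2_norm x)\<^sup>2 \<le> (1 + max 1 B) * (l2_norm x)\<^sup>2"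
      by (rule mult_right_mono) auto
    then show "(l2_norm (\<Phi> *\<^sub>v x))\<^sup>2 \<le> (1 + max 1 B) * (l2_norm x)\<^sup>2"
      using B x by (meson order_trans)
  qed
  then have ne: "?S \<noteq> {}" by (auto intro!: exI[of _ "max 1 B"])
  have bdd: "bdd_below ?S" by (auto intro!: bdd_belowI[of _ 0])
  let ?T = "{\<delta>. 0 \<le> \<delta>} \<inter> (\<Inter>x \<in> {x \<in> carrier_vec (dim_col \<Phi>). sparse k x}.
       {\<delta>. (1 - \<delta>) * (l2_norm x)\<^sup>2 \<le> (l2_norm (\<Phi> *\<^sub>v x))\<^sup>2} \<inter>
       {\<delta>. (l2_norm (\<Phi> *\<^sub>v x))\<^sup>2 \<le> (1 + \<delta>) * (l2_norm x)\<^sup>2})"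
  have "?S = ?T" by (auto simp: rip_def)
  moreover have "closed ?T"
    by (intro closed_Int closed_INT ballI closed_Collect_le continuous_intros)
  ultimately have "closed ?S" by simp
  then have Inf: "Inf ?S \<in> ?S"
    using closed_contains_Inf[OF ne bdd] by blast
  have low: "Inf ?S \<le> \<delta>" if "0 \<le> \<delta>" "rip k \<delta> \<Phi>" for \<delta>
    using that bdd by (intro cInf_lower) auto
  have "rip_param k \<Phi> = Inf ?S"
    unfolding rip_param_def using Inf low by (intro Least_equality) auto
  then show "0 \<le> rip_param k \<Phi>" "rip k (rip_param k \<Phi>) \<Phi>"
    "\<And>\<delta>. 0 \<le> \<delta> \<Longrightarrow> rip k \<delta> \<Phi> \<Longrightarrow> rip_param k \<Phi> \<le> \<delta>"
    using Inf low by auto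
qed


section \<open>Polynomial time algorithms\<close>

text \<open>
  Algorithms are programs for a random access machine with the logarithmic cost criterion, in the
  form of while programs. The memory consists of integer registers addressed by an array name and
  an integer index. A program mentions only finitely many array names. Every integer that occurs in
  the evaluation of an expression (constants, addresses, contents of registers, results of
  operations) is charged with its bit length. Hence polynomial time on this machine is the same as
  polynomial time on Turing machines.
\<close>

type_synonym store = "string \<Rightarrow> int \<Rightarrow> int"

datatype arith_op = Add | Sub | Mul | Div

datatype expr = Const int | Load string expr | Op arith_op expr expr

datatype prog =
    Skip
  | Assign string expr expr  \<comment> \<open>array name, index, value\<close>
  | Seq prog prog
  | Cond expr prog prog
  | While expr prog

text \<open>One plus the number of binary digits of the absolute value.\<close>

definition bit_size :: "int \<Rightarrow> nat" where
  "bit_size i = Suc (floorlog 2 (nat \<bar>i\<bar>))"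

fun apply_op :: "arith_op \<Rightarrow> int \<Rightarrow> int \<Rightarrow> int" where
  "apply_op Add i j = i + j"
| "apply_op Sub i j = i - j"
| "apply_op Mul i j = i * j"
| "apply_op Div i j = i div j"

fun val :: "expr \<Rightarrow> store \<Rightarrow> int" where
  "val (Const i) s = i"
| "val (Load a e) s = s a (val e s)"
| "val (Op f e1 e2) s = apply_op f (val e1 s) (val e2 s)"

fun cost :: "expr \<Rightarrow> store \<Rightarrow> nat" where
  "cost (Const i) s = bit_size i"
| "cost (Load a e) s = cost e s + bit_size (val (Load a e) s)"
| "cost (Op f e1 e2) s = cost e1 s + cost e2 s + bit_size (val (Op f e1 e2) s)"

text \<open>\<open>exec P s t s'\<close>: started in \<open>s\<close>, the program \<open>P\<close> halts in \<open>s'\<close> after time \<open>t\<close>.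
  Tests succeed on positive values.\<close>

inductive exec :: "prog \<Rightarrow> store \<Rightarrow> nat \<Rightarrow> store \<Rightarrow> bool" where
  exec_Skip: "exec Skip s 1 s"
| exec_Assign:
    "exec (Assign a e1 e2) s (cost e1 s + cost e2 s) (s(a := (s a)(val e1 s := val e2 s)))"
| exec_Seq: "exec P s t s' \<Longrightarrow> exec Q s' t' s'' \<Longrightarrow> exec (Seq P Q) s (t + t') s''"
| exec_CondTrue: "0 < val e s \<Longrightarrow> exec P s t s' \<Longrightarrow> exec (Cond e P Q) s (cost e s + t) s'"
| exec_CondFalse: "val e s \<le> 0 \<Longrightarrow> exec Q s t s' \<Longrightarrow> exec (Cond e P Q) s (cost e s + t) s'"
| exec_WhileTrue:
    "0 < val e s \<Longrightarrow> exec P s t s' \<Longrightarrow> exec (While e P) s' t' s'' \<Longrightarrow>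
      exec (While e P) s (cost e s + t + t') s''"
| exec_WhileFalse: "val e s \<le> 0 \<Longrightarrow> exec (While e P) s (cost e s) s"

inductive_cases exec_SkipE: "exec Skip s t s'"
inductive_cases exec_AssignE: "exec (Assign a e1 e2) s t s'"
inductive_cases exec_SeqE: "exec (Seq P Q) s t s'"
inductive_cases exec_CondE: "exec (Cond e P Q) s t s'"
inductive_cases exec_WhileE: "exec (While e P) s t s'"

lemma exec_deterministic:
  "exec P s t s' \<Longrightarrow> exec P s u s'' \<Longrightarrow> u = t \<and> s'' = s'"
proof (induction arbitrary: u s'' rule: exec.induct)
  case exec_Skip
  then show ?case by (auto elim: exec_SkipE)
next
  case exec_Assign
  then show ?case by (auto elim: exec_AssignE)
next
  case (exec_Seq P s t s' Q t' s2)
  from exec_Seq.prems show ?case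
    by (rule exec_SeqE) (use exec_Seq.IH in blast)
next
  case (exec_CondTrue e s P t s' Q)
  from exec_CondTrue.prems show ?case
    by (rule exec_CondE) (use exec_CondTrue.IH exec_CondTrue.hyps in \<open>blast | linarith\<close>)+
next
  case (exec_CondFalse e s Q t s' P)
  from exec_CondFalse.prems show ?case
    by (rule exec_CondE) (use exec_CondFalse.IH exec_CondFalse.hyps in \<open>blast | linarith\<close>)+
next
  case (exec_WhileTrue e s P t s' t' s2)
  from exec_WhileTrue.prems show ?case
  proof (rule exec_WhileE)
    fix v s1 w
    assume u: "u = cost e s + v + w" and "exec P s v s1" and w: "exec (While e P) s1 w s''"
    then have "v = t \<and> s1 = s'" using exec_WhileTrue.IH(1) by blast
    with u w show "u = cost e s + t + t' \<and> s'' = s2"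
      using exec_WhileTrue.IH(2) by blast
  next
    assume "val e s \<le> 0"
    with exec_WhileTrue.hyps show "u = cost e s + t + t' \<and> s'' = s2" by linarith
  qed
next
  case (exec_WhileFalse e s P)
  from exec_WhileFalse.prems show ?case
    by (rule exec_WhileE) (use exec_WhileFalse.hyps in \<open>simp_all\<close>)
qed

text \<open>Inputs are finite integer sequences, stored in the array \<open>''in''\<close> from index 0 on. All other
  registers initially contain 0. The result is found in register 0 of the array \<open>''out''\<close>.\<close>

definition init_store :: "int list \<Rightarrow> store" where
  "init_store xs = (\<lambda>a i. if a = ''in'' \<and> 0 \<le> i \<and> i < int (length xs) then xs ! nat i else 0)"

definition outputs :: "prog \<Rightarrow> int list \<Rightarrow> int \<Rightarrow> bool" where
  "outputs P xs v \<longleftrightarrow> (\<exists>t s. exec P (init_store xs) t s \<and> s ''out'' 0 = v)"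

abbreviation (input) yes :: int where "yes \<equiv> 1"
abbreviation (input) no :: int where "no \<equiv> 0"

definition input_size :: "int list \<Rightarrow> nat" where
  "input_size xs = (\<Sum>x\<leftarrow>xs. bit_size x)"

definition polynomial_time_on :: "int list set \<Rightarrow> prog \<Rightarrow> bool" where
  "polynomial_time_on D P \<longleftrightarrow>
     (\<exists>p :: nat poly. \<forall>xs \<in> D. \<exists>t s. exec P (init_store xs) t s \<and> t \<le> poly p (input_size xs))"


section \<open>The hidden clique hypothesis\<close>

text \<open>A graph on the vertex set \<open>{..<n}\<close> is given by its set of edges.\<close>

definition graphs :: "nat \<Rightarrow> nat set set set" where
  "graphs n = Pow {e. e \<subseteq> {..<n} \<and> card e = 2}"

definition has_clique :: "nat \<Rightarrow> nat set set \<Rightarrow> nat \<Rightarrow> bool" where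
  "has_clique n E m \<longleftrightarrow>
     (\<exists>K \<subseteq> {..<n}. card K = m \<and> (\<forall>u \<in> K. \<forall>v \<in> K. u \<noteq> v \<longrightarrow> {u, v} \<in> E))"

definition random_graph :: "nat \<Rightarrow> nat set set pmf" where
  "random_graph n = pmf_of_set (graphs n)"

text \<open>The number of vertices, followed by the adjacency matrix, row by row.\<close>

definition encode_graph :: "nat \<Rightarrow> nat set set \<Rightarrow> int list" where
  "encode_graph n E = int n # [if {i, j} \<in> E then 1 else 0. i \<leftarrow> [0..<n], j \<leftarrow> [0..<n]]"

text \<open>Here \<open>no\<close> is the answer ``no clique''. Non-integral clique sizes are rounded down.\<close>

definition hidden_clique_hypothesis :: "real \<Rightarrow> bool" where
  "hidden_clique_hypothesis \<epsilon> \<longleftrightarrow>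
     \<not> (\<exists>P. polynomial_time_on {encode_graph n E |n E. E \<in> graphs n} P \<and>
          (\<forall>n. \<forall>E \<in> graphs n. has_clique n E (nat \<lfloor>real n powr (1/2 - \<epsilon>)\<rfloor>) \<longrightarrow>
             outputs P (encode_graph n E) yes) \<and>
          (\<lambda>n. measure_pmf.prob (random_graph n) {E. outputs P (encode_graph n E) no})
             \<longlonglongrightarrow> 1)"


section \<open>Square matrices as inputs\<close>

text \<open>Input matrices have rational entries. The encoding consists of the dimension, followed by the
  numerator and denominator (in lowest terms, with positive denominator) of each entry, row by
  row.\<close>

definition encode_matrix :: "rat Matrix.mat \<Rightarrow> int list" where
  "encode_matrix \<Phi> = int (dim_row \<Phi>) #
     concat [[fst (quotient_of (\<Phi> $$ (i, j))), snd (quotient_of (\<Phi> $$ (i, j)))].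
       i \<leftarrow> [0..<dim_row \<Phi>], j \<leftarrow> [0..<dim_col \<Phi>]]"

abbreviation real_matrix :: "rat Matrix.mat \<Rightarrow> real Matrix.mat" where
  "real_matrix \<equiv> map_mat real_of_rat"

end

theory Submission
  imports
    Defs
    "HOL-Probability.Hoeffding"
    "HOL-Real_Asymp.Real_Asymp"
begin

text \<open>
  The reduction avoids matrix square roots. For a graph on \<open>n\<close> vertices let \<open>M\<close> contain, for every
  pair of vertices, the sign of the pair (1 for an edge, \<open>-1\<close> for a non-edge) in exactly one of the
  two possible positions, so that \<open>M + M\<^sup>T\<close> is the signed adjacency matrix, and take the
  block diagonal matrix \<open>\<Phi>\<close> of order \<open>2n\<close> with blocks \<open>I/2 + M/s\<close> and \<open>I/2 - M/s\<close>, where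
  \<open>s\<^sup>2 \<approx> 2n/3\<close>.

  If \<open>x\<close> is the normalized indicator vector of a clique of size \<open>m\<close>, then \<open>\<parallel>\<Phi>x\<parallel>\<^sup>2\<close> for the copies of
  \<open>x\<close> in the two blocks differs by \<open>(m - 1)/s\<close>, because the second order terms agree. Hence one of
  the two copies violates the isometry condition, whatever the rest of the graph looks like.

  In a random graph all entries of \<open>M\<close> are independent. Induction on the edges bounds the moment
  generating function of \<open>\<Sum>i. \<lambda>\<^sub>i (M x)\<^sub>i\<^sup>2\<close>, which yields tail bounds for both \<open>\<parallel>M x\<parallel>\<^sup>2\<close> and
  \<open>x\<^sup>T M x\<close>; a union bound over the sparse vectors of a fine grid finishes the argument.
\<close>


section \<open>Exponential moments of squares of random signed sums\<close>

text \<open>The matrix has to be rational and exactly computable. Prescribing its Gram matrix, say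
  the identity plus a multiple of the signed adjacency matrix, would call for an irrational
  factorization and an analysis of its rounding. With blocks I/2 +- M/s the Gram matrix is I/4 +- (M
  + M^T)/(2s) + M^T M/s^2. Its last term is not small: in a random graph it concentrates around
  (n/2)/s^2 times the identity, and the choice of s makes this the missing 3/4. In an arbitrary
  graph the same term is uncontrolled and could cancel what a clique adds to one block, which is why
  both signs are present. The price is the dimension 2n, at which the sparsity and both thresholds
  are taken. A yes for the matrix speaks against a clique, so the answers are exchanged at the
  end.\<close>

lemma exp_plus_exp_minus_le: "exp x + exp (- x) \<le> 2 * exp (x\<^sup>2 / 2)" for x :: real
proof -
  have *: "exp y + exp (- y) \<le> 2 * exp (y\<^sup>2 / 2)" if y: "0 \<le> y" for y :: real
  proof -
    \<comment> \<open>Hoeffding's lemma for a fair sign, that is p = 1/2 on an interval of length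
      2y, amounts to the bound cosh y <= exp(y^2/2).\<close>
    have "- (2 * y) * (1/2) + ln (1 + 1/2 * (exp (2 * y) - 1)) \<le> (2 * y)\<^sup>2 / 8"
      using Hoeffdings_lemma_aux[of "2 * y" "1/2"] y by simp
    then have "ln (1 + 1/2 * (exp (2 * y) - 1)) \<le> y + y\<^sup>2 / 2"
      by (simp add: power2_eq_square)
    moreover have "0 < 1 + 1/2 * (exp (2 * y) - 1)"
      using exp_gt_zero[of "2 * y"] by (simp add: field_simps add_pos_pos)
    ultimately have "1 + 1/2 * (exp (2 * y) - 1) \<le> exp (y + y\<^sup>2 / 2)"
      using ln_le_cancel_iff[of "1 + 1/2 * (exp (2 * y) - 1)" "exp (y + y\<^sup>2 / 2)"]
      by (metis exp_gt_zero ln_exp)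
    then have "1 + exp (2 * y) \<le> 2 * exp (y + y\<^sup>2 / 2)"
      by (simp add: field_simps)
    then have "(1 + exp (2 * y)) * exp (- y) \<le> (2 * exp (y + y\<^sup>2 / 2)) * exp (- y)"
      by (intro mult_right_mono) auto
    also have "\<dots> = 2 * exp (y\<^sup>2 / 2)"
      by (simp add: mult_exp_exp)
    also have "(1 + exp (2 * y)) * exp (- y) = exp y + exp (- y)"
      by (simp add: distrib_right mult_exp_exp)
    finally show ?thesis .
  qed
  show ?thesis
    using *[of x] *[of "- x"] by (cases "0 \<le> x") auto
qed

text \<open>The cross terms of the two squares combine to a cosh, and the bound for cosh is again
  the exponential of a multiple of c^2. So averaging over one sign keeps the exponent quadratic in
  the remaining sum c, which lets the signs be eliminated one at a time.\<close>

lemma exp_square_average_le: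
  "exp (l * (c + y)\<^sup>2) + exp (l * (c - y)\<^sup>2) \<le> 2 * exp (l * y\<^sup>2 + (l + 2 * l\<^sup>2 * y\<^sup>2) * c\<^sup>2)"
  for l c y :: real
proof -
  have "exp (l * (c + y)\<^sup>2) + exp (l * (c - y)\<^sup>2)
      = exp (l * c\<^sup>2 + l * y\<^sup>2) * (exp (2 * l * c * y) + exp (- (2 * l * c * y)))"
    by (simp add: distrib_left mult_exp_exp power2_eq_square algebra_simps)
  also have "\<dots> \<le> exp (l * c\<^sup>2 + l * y\<^sup>2) * (2 * exp ((2 * l * c * y)\<^sup>2 / 2))"
    by (intro mult_left_mono exp_plus_exp_minus_le) auto
  also have "\<dots> = 2 * exp (l * y\<^sup>2 + (l + 2 * l\<^sup>2 * y\<^sup>2) * c\<^sup>2)"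
    by (simp add: mult_exp_exp power2_eq_square algebra_simps)
  finally show ?thesis .
qed

definition sgn_in :: "'a set \<Rightarrow> 'a \<Rightarrow> real" where
  "sgn_in E e = (if e \<in> E then 1 else - 1)"

lemma sum_Pow_insert:
  assumes "finite F" "e \<notin> F"
  shows "(\<Sum>E\<in>Pow (insert e F). f E) = (\<Sum>E\<in>Pow F. f E + f (insert e E))"
proof -
  have "inj_on (insert e) (Pow F)"
    using assms by (auto simp: inj_on_def)
  then show ?thesis
    using assms unfolding Pow_insert
    by (subst sum.union_disjoint) (auto simp: sum.reindex sum.distrib)
qed

text \<open>Averaging over one sign turns the multiplier \<open>l\<close> of its row into \<open>l'\<close>; the exponent
  \<open>l * s + 2 * l\<^sup>2 * s\<^sup>2\<close> with the row variance \<open>s\<close> is stable under this step.\<close>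

lemma row_exponent_step:
  fixes l y s :: real
  assumes "\<bar>l\<bar> * (y\<^sup>2 + s) \<le> 1/8" "0 \<le> s"
  defines "l' \<equiv> l + 2 * l\<^sup>2 * y\<^sup>2"
  shows "\<bar>l'\<bar> * s \<le> 1/8"
    and "l * y\<^sup>2 + (l' * s + 2 * l'\<^sup>2 * s\<^sup>2) \<le> l * (y\<^sup>2 + s) + 2 * l\<^sup>2 * (y\<^sup>2 + s)\<^sup>2"
proof -
  \<comment> \<open>Both products have the sign of \<open>l\<close>, so \<open>u * w\<close> is
    nonnegative. In these terms the second claim reads 2uw + 2(w + 2uw)^2 <= 2(u + w)^2.\<close>
  define u where "u = l * y\<^sup>2"
  define w where "w = l * s"
  have uw: "\<bar>u\<bar> + \<bar>w\<bar> \<le> 1/8" and uw0: "0 \<le> u * w"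
    using assms by (auto simp: u_def w_def abs_mult distrib_left power2_eq_square zero_le_mult_iff
        mult_le_0_iff)
  have l's: "l' * s = w + 2 * u * w"
    by (simp add: l'_def u_def w_def power2_eq_square algebra_simps)
  have "\<bar>l'\<bar> * s = \<bar>w + 2 * u * w\<bar>"
    using assms l's by (metis abs_mult abs_of_nonneg)
  also have "\<dots> \<le> \<bar>w\<bar> + 2 * \<bar>w\<bar> * \<bar>u\<bar>"
    using abs_triangle_ineq[of w "2 * u * w"] by (simp add: abs_mult mult_ac)
  also have "\<dots> \<le> \<bar>w\<bar> + 1 * \<bar>u\<bar>"
    using uw by (intro add_left_mono mult_right_mono) auto
  finally show "\<bar>l'\<bar> * s \<le> 1/8" using uw by simp
  have "\<bar>w\<bar> * (u * w) \<le> 1/8 * (u * w)"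
    using uw uw0 by (intro mult_right_mono) auto
  then have "w * (u * w) \<le> 1/8 * (u * w)"
    using uw0 mult_right_mono[OF abs_ge_self[of w] uw0] by linarith
  have "u * (w * (u * w)) \<le> 1/8 * (1/8 * (u * w))"
  proof -
    have "u * (w * (u * w)) = (u * w) * (u * w)" by simp
    also have "\<dots> \<le> (1/8 * (1/8)) * (u * w)"
    proof (intro mult_right_mono)
      have "\<bar>u\<bar> * \<bar>w\<bar> \<le> 1/8 * (1/8)"
        using uw by (intro mult_mono) auto
      then show "u * w \<le> 1/8 * (1/8)" using uw0 by (metis abs_mult abs_of_nonneg)
    qed (use uw0 in auto)
    finally show ?thesis by simp
  qed
  moreover have square_expand:
    "(w + 2 * u * w)\<^sup>2 = w\<^sup>2 + 4 * (w * (u * w)) + 4 * (u * (w * (u * w)))"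
    "(u + w)\<^sup>2 = u\<^sup>2 + 2 * (u * w) + w\<^sup>2"
    by (simp_all add: power2_eq_square algebra_simps)
  \<comment> \<open>The expansions leave 2uw + 2u^2 on the right to pay for 8w(uw) + 8(uw)^2; as |u|
    and |w| are at most 1/8, the latter is at most (1 + 1/8)uw.\<close>
  ultimately have "2 * (u * w) + 2 * (w + 2 * u * w)\<^sup>2 \<le> 2 * (u + w)\<^sup>2"
    using \<open>w * (u * w) \<le> 1/8 * (u * w)\<close> uw0
      zero_le_power2[of u] square_expand by linarith
  moreover have "l * y\<^sup>2 + (l' * s + 2 * l'\<^sup>2 * s\<^sup>2) = u + (w + 2 * u * w) + 2 * (w + 2 * u * w)\<^sup>2"
    unfolding l's[symmetric] by (simp add: u_def power_mult_distrib)
  moreover have "l * (y\<^sup>2 + s) + 2 * l\<^sup>2 * (y\<^sup>2 + s)\<^sup>2 = u + w + 2 * (u + w)\<^sup>2"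
    by (simp add: u_def w_def power2_eq_square algebra_simps)
  ultimately show "l * y\<^sup>2 + (l' * s + 2 * l'\<^sup>2 * s\<^sup>2) \<le> l * (y\<^sup>2 + s) + 2 * l\<^sup>2 * (y\<^sup>2 + s)\<^sup>2"
    by simp
qed

text \<open>Divided by \<open>2 ^ card F\<close> this bounds an expectation over independent signs:
  \<open>r\<close> partitions \<open>F\<close> into rows, and each row contributes a weighted square
  of its signed sum. The first term of the exponent on the right is the mean of the exponent on the
  left, the second a correction of second order in \<open>l\<close>. Eliminating the sign of an edge
  alters the multiplier of its row, so the induction needs arbitrary \<open>l\<close>, of either
  sign and different in each row.\<close>

lemma sum_exp_row_squares_le:
  fixes l :: "'r \<Rightarrow> real" and y :: "'e \<Rightarrow> real" and r :: "'e \<Rightarrow> 'r"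
  assumes "finite F" "finite R" "r ` F \<subseteq> R"
    and "\<And>i. i \<in> R \<Longrightarrow> \<bar>l i\<bar> * (\<Sum>e\<in>{e\<in>F. r e = i}. (y e)\<^sup>2) \<le> 1/8"
  shows "(\<Sum>E\<in>Pow F. exp (\<Sum>i\<in>R. l i * (\<Sum>e\<in>{e\<in>F. r e = i}. sgn_in E e * y e)\<^sup>2))
    \<le> 2 ^ card F * exp (\<Sum>i\<in>R. l i * (\<Sum>e\<in>{e\<in>F. r e = i}. (y e)\<^sup>2)
                             + 2 * (l i)\<^sup>2 * (\<Sum>e\<in>{e\<in>F. r e = i}. (y e)\<^sup>2)\<^sup>2)"
  using assms(1,3,4)
proof (induction F arbitrary: l rule: finite_induct)
  case empty
  then show ?case by simp
next
  case (insert e F)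
  define p where "p = r e"
  define Y where "Y F E i = (\<Sum>e\<in>{e\<in>F. r e = i}. sgn_in E e * y e)" for F E i
  define S where "S F i = (\<Sum>e\<in>{e\<in>F. r e = i}. (y e)\<^sup>2)" for F i
  define l' where "l' = l(p := l p + 2 * (l p)\<^sup>2 * (y e)\<^sup>2)"
  have p: "p \<in> R" using insert.prems by (auto simp: p_def)
  have fin [simp]: "finite {e \<in> F. r e = i}" for i using insert.hyps by auto
  have set_p: "{e' \<in> insert e F. r e' = p} = insert e {e \<in> F. r e = p}"
    by (auto simp: p_def)
  have set_i: "{e' \<in> insert e F. r e' = i} = {e \<in> F. r e = i}" if "i \<noteq> p" for i
    using that by (auto simp: p_def)
  have S_p: "S (insert e F) p = (y e)\<^sup>2 + S F p"
    using insert.hyps unfolding S_def set_p by simp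
  have S_i: "S (insert e F) i = S F i" if "i \<noteq> p" for i
    unfolding S_def set_i[OF that] ..
  have S0: "0 \<le> S F i" for i unfolding S_def by (intro sum_nonneg) auto
  have Y_p0: "Y (insert e F) E p = Y F E p - y e" if "E \<subseteq> F" for E
    using insert.hyps that unfolding Y_def set_p by (subst sum.insert) (auto simp: sgn_in_def)
  have Y_p1: "Y (insert e F) (insert e E) p = Y F E p + y e" if "E \<subseteq> F" for E
  proof -
    have "(\<Sum>e'\<in>{e\<in>F. r e = p}. sgn_in (insert e E) e' * y e') = Y F E p"
      unfolding Y_def using insert.hyps by (intro sum.cong) (auto simp: sgn_in_def)
    then show ?thesis
      using insert.hyps unfolding Y_def set_p by (subst sum.insert) (auto simp: sgn_in_def)
  qed
  have Y_i0: "Y (insert e F) E i = Y F E i" if "i \<noteq> p" for E i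
    unfolding Y_def set_i[OF that] ..
  have Y_i1: "Y (insert e F) (insert e E) i = Y F E i" if "i \<noteq> p" for E i
    unfolding Y_def set_i[OF that] using insert.hyps by (intro sum.cong) (auto simp: sgn_in_def)
  define B where "B E = (\<Sum>i\<in>R - {p}. l i * (Y F E i)\<^sup>2)" for E
  have split: "(\<Sum>i\<in>R. h i) = h p + (\<Sum>i\<in>R - {p}. h i)" for h :: "'r \<Rightarrow> real"
    using p assms(2) by (simp add: sum.remove)
  have step: "exp (\<Sum>i\<in>R. l i * (Y (insert e F) E i)\<^sup>2)
      + exp (\<Sum>i\<in>R. l i * (Y (insert e F) (insert e E) i)\<^sup>2)
      \<le> 2 * exp (l p * (y e)\<^sup>2) * exp (\<Sum>i\<in>R. l' i * (Y F E i)\<^sup>2)" if E: "E \<subseteq> F" for E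
  proof -
    have "(\<Sum>i\<in>R. l i * (Y (insert e F) E i)\<^sup>2) = l p * (Y F E p - y e)\<^sup>2 + B E"
      unfolding split[of "\<lambda>i. l i * (Y (insert e F) E i)\<^sup>2"] B_def Y_p0[OF E]
      by (simp add: Y_i0)
    moreover have "(\<Sum>i\<in>R. l i * (Y (insert e F) (insert e E) i)\<^sup>2)
        = l p * (Y F E p + y e)\<^sup>2 + B E"
      unfolding split[of "\<lambda>i. l i * (Y (insert e F) (insert e E) i)\<^sup>2"] B_def Y_p1[OF E]
      by (simp add: Y_i1)
    moreover have "(\<Sum>i\<in>R. l' i * (Y F E i)\<^sup>2)
        = (l p + 2 * (l p)\<^sup>2 * (y e)\<^sup>2) * (Y F E p)\<^sup>2 + B E"
      unfolding split[of "\<lambda>i. l' i * (Y F E i)\<^sup>2"] B_def by (simp add: l'_def)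
    ultimately show ?thesis
      using mult_right_mono[OF exp_square_average_le[of "l p" "Y F E p" "y e"], of "exp (B E)"]
      by (simp add: exp_add algebra_simps)
  qed
  have bound: "\<bar>l p\<bar> * ((y e)\<^sup>2 + S F p) \<le> 1/8"
    using insert.prems(2)[OF p] S_p unfolding S_def by metis
  have "(\<Sum>E\<in>Pow (insert e F). exp (\<Sum>i\<in>R. l i * (Y (insert e F) E i)\<^sup>2))
      \<le> (\<Sum>E\<in>Pow F. 2 * exp (l p * (y e)\<^sup>2) * exp (\<Sum>i\<in>R. l' i * (Y F E i)\<^sup>2))"
    using insert.hyps by (subst sum_Pow_insert) (auto intro!: sum_mono step)
  also have "\<dots> = 2 * exp (l p * (y e)\<^sup>2) * (\<Sum>E\<in>Pow F. exp (\<Sum>i\<in>R. l' i * (Y F E i)\<^sup>2))"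
    by (simp add: sum_distrib_left)
  also have "\<dots> \<le> 2 * exp (l p * (y e)\<^sup>2) *
      (2 ^ card F * exp (\<Sum>i\<in>R. l' i * S F i + 2 * (l' i)\<^sup>2 * (S F i)\<^sup>2))"
  proof (intro mult_left_mono)
    show "(\<Sum>E\<in>Pow F. exp (\<Sum>i\<in>R. l' i * (Y F E i)\<^sup>2))
        \<le> 2 ^ card F * exp (\<Sum>i\<in>R. l' i * S F i + 2 * (l' i)\<^sup>2 * (S F i)\<^sup>2)"
      unfolding Y_def S_def
    proof (intro insert.IH)
      show "r ` F \<subseteq> R" using insert.prems by auto
      fix i assume "i \<in> R"
      then show "\<bar>l' i\<bar> * (\<Sum>e\<in>{e \<in> F. r e = i}. (y e)\<^sup>2) \<le> 1/8"
        using row_exponent_step(1)[OF bound S0] insert.prems(2)[of i, folded S_def]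
          S_i[of i] by (cases "i = p") (auto simp: l'_def S_def[symmetric])
    qed
  qed auto
  also have "\<dots> = 2 ^ card (insert e F) *
      exp (l p * (y e)\<^sup>2 + (\<Sum>i\<in>R. l' i * S F i + 2 * (l' i)\<^sup>2 * (S F i)\<^sup>2))"
    using insert.hyps by (simp add: exp_add)
  also have "\<dots> \<le> 2 ^ card (insert e F) *
      exp (\<Sum>i\<in>R. l i * S (insert e F) i + 2 * (l i)\<^sup>2 * (S (insert e F) i)\<^sup>2)"
  proof -
    have "l p * (y e)\<^sup>2 + (\<Sum>i\<in>R. l' i * S F i + 2 * (l' i)\<^sup>2 * (S F i)\<^sup>2)
        \<le> (\<Sum>i\<in>R. l i * S (insert e F) i + 2 * (l i)\<^sup>2 * (S (insert e F) i)\<^sup>2)"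
      unfolding split[of "\<lambda>i. l' i * S F i + 2 * (l' i)\<^sup>2 * (S F i)\<^sup>2"]
        split[of "\<lambda>i. l i * S (insert e F) i + 2 * (l i)\<^sup>2 * (S (insert e F) i)\<^sup>2"]
      using row_exponent_step(2)[OF bound S0] by (simp add: l'_def S_i S_p)
    then show ?thesis by simp
  qed
  finally show ?case unfolding Y_def S_def .
qed


section \<open>Tail bounds for the signed half adjacency matrix\<close>

text \<open>Selects exactly one of \<open>(i, j)\<close> and \<open>(j, i)\<close>. The parity makes all columns almost equally heavy,
  see \<open>col_weight_bounds\<close>.\<close>

definition sel :: "nat \<Rightarrow> nat \<Rightarrow> bool" where
  "sel i j \<longleftrightarrow> (i < j \<longleftrightarrow> even (i + j))"

lemma sel_irrefl [simp]: "\<not> sel i i"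
  by (simp add: sel_def)

lemma sel_swap: "i \<noteq> j \<Longrightarrow> sel i j \<longleftrightarrow> \<not> sel j i"
  by (auto simp: sel_def add.commute)

lemma sel_shift [simp]: "sel (n + i) (n + j) \<longleftrightarrow> sel i j"
  by (auto simp: sel_def)

text \<open>\<open>Min e + Max e\<close> is the sum of the endpoints, so the orientation that
  \<open>sel\<close> chooses for a pair can be read off from the unordered edge.\<close>

definition row_of :: "nat set \<Rightarrow> nat" where
  "row_of e = (if even (Min e + Max e) then Min e else Max e)"

definition col_of :: "nat set \<Rightarrow> nat" where
  "col_of e = (if even (Min e + Max e) then Max e else Min e)"

lemma row_col_of:
  assumes "sel i j"
  shows "row_of {i, j} = i" "col_of {i, j} = j"
proof -
  have "row_of {i, j} = i \<and> col_of {i, j} = j"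
  proof (cases "i < j")
    case True
    then show ?thesis using assms by (simp add: row_of_def col_of_def sel_def)
  next
    case False
    then have "min i j = j" "max i j = i" by auto
    then show ?thesis using assms False by (simp add: row_of_def col_of_def sel_def add.commute)
  qed
  then show "row_of {i, j} = i" "col_of {i, j} = j" by auto
qed

section \<open>Selected positions as edges\<close>

definition edges :: "nat \<Rightarrow> nat set set" where
  "edges n = {e. e \<subseteq> {..<n} \<and> card e = 2}"

lemma finite_edges [simp]: "finite (edges n)"
  unfolding edges_def by (rule finite_subset[of _ "Pow {..<n}"]) auto

lemma edgeE:
  assumes "e \<in> edges n"
  shows "e = {row_of e, col_of e}" "sel (row_of e) (col_of e)" "row_of e < n" "col_of e < n"
proof -
  obtain i j where ij: "e = {i, j}" "i \<noteq> j" "i < n" "j < n"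
    using assms by (auto simp: edges_def card_2_iff)
  have "\<exists>i j. e = {i, j} \<and> sel i j \<and> i < n \<and> j < n"
    using ij sel_swap[of i j] by (cases "sel i j") (auto simp: insert_commute)
  then show "e = {row_of e, col_of e}" "sel (row_of e) (col_of e)" "row_of e < n" "col_of e < n"
    using row_col_of by auto
qed

lemma edgeI: "sel i j \<Longrightarrow> i < n \<Longrightarrow> j < n \<Longrightarrow> {i, j} \<in> edges n"
  using sel_irrefl[of i] by (cases "i = j") (auto simp: edges_def)

definition half_adj :: "nat set set \<Rightarrow> nat \<Rightarrow> nat \<Rightarrow> real" where
  "half_adj E i j = (if sel i j then sgn_in E {i, j} else 0)"

lemma sum_sel_row:
  assumes "i < n"
  shows "(\<Sum>j<n. if sel i j then f {i, j} j else 0) = (\<Sum>e\<in>{e \<in> edges n. row_of e = i}. f e (col_of e))"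
proof -
  have "(\<Sum>j<n. if sel i j then f {i, j} j else 0) = (\<Sum>j\<in>{j\<in>{..<n}. sel i j}. f {i, j} j)"
    by (rule sum.inter_filter[symmetric]) simp
  also have "\<dots> = (\<Sum>e\<in>{e \<in> edges n. row_of e = i}. f e (col_of e))"
    using assms by (intro sum.reindex_bij_witness[of _ col_of "\<lambda>j. {i, j}"])
      (auto simp: row_col_of edgeI dest: edgeE)
  finally show ?thesis .
qed

lemma sum_sel:
  "(\<Sum>i<n. \<Sum>j<n. if sel i j then f {i, j} i j else 0) = (\<Sum>e\<in>edges n. f e (row_of e) (col_of e))"
proof -
  have "(\<Sum>i<n. \<Sum>j<n. if sel i j then f {i, j} i j else 0)
      = (\<Sum>i<n. \<Sum>e\<in>{e \<in> edges n. row_of e = i}. f e (row_of e) (col_of e))"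
    by (intro sum.cong refl, subst sum_sel_row) (auto intro!: sum.cong)
  also have "\<dots> = (\<Sum>e\<in>edges n. f e (row_of e) (col_of e))"
    by (rule sum.group) (auto dest: edgeE)
  finally show ?thesis .
qed

text \<open>The entries of column j of M are signs exactly at the selected positions, so this is its
  squared length in every graph, i.e. the diagonal entry of M^T M. The off-diagonal entries have
  mean zero in a random graph.\<close>

definition col_weight :: "nat \<Rightarrow> nat \<Rightarrow> nat" where
  "col_weight n j = card {i. i < n \<and> sel i j}"

lemma card_even_below: "card {i. i < n \<and> even (i + j)} = (if even j then (n + 1) div 2 else n div 2)"
proof (induction n)
  case (Suc n)
  have "{i. i < Suc n \<and> even (i + j)} =
      (if even (n + j) then insert n {i. i < n \<and> even (i + j)} else {i. i < n \<and> even (i + j)})"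
    by (auto simp: less_Suc_eq)
  moreover have "card (insert n {i. i < n \<and> even (i + j)}) = Suc (card {i. i < n \<and> even (i + j)})"
    by (rule card_insert_disjoint) auto
  ultimately have "card {i. i < Suc n \<and> even (i + j)} =
      (if even (n + j) then Suc (card {i. i < n \<and> even (i + j)}) else card {i. i < n \<and> even (i + j)})"
    by (cases "even (n + j)") (simp_all only: if_True if_False)
  also have "\<dots> = (if even j then (Suc n + 1) div 2 else Suc n div 2)"
    unfolding Suc by (cases "even n"; cases "even j"; simp)
  finally show ?case .
qed simp

text \<open>A selected position is either above the diagonal with even i + j or below it with odd i
  + j, and parity halves both ranges. The plain choice i < j would give column j the weight j, and
  the mean of M^T M would be far from a multiple of the identity.\<close>

lemma col_weight_bounds:
  assumes "j < n"
  shows "n \<le> 2 * col_weight n j + 2" "2 * col_weight n j \<le> n + 2"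
proof -
  have odds: "card {i. i < m \<and> odd (i + j)} = m - card {i. i < m \<and> even (i + j)}" for m
  proof -
    have "{i. i < m \<and> odd (i + j)} = {..<m} - {i. i < m \<and> even (i + j)}" by auto
    moreover have "card \<dots> = card {..<m} - card {i. i < m \<and> even (i + j)}"
      by (rule card_Diff_subset) auto
    ultimately show ?thesis by simp
  qed
  have "{i. i < n \<and> sel i j} = {i. i < j \<and> even (i + j)} \<union>
      ({i. i < n \<and> odd (i + j)} - {i. i < j \<and> odd (i + j)})" (is "_ = ?A \<union> (?B - ?C)")
    using assms by (auto simp: sel_def)
  moreover have "card (?A \<union> (?B - ?C)) = card ?A + card (?B - ?C)"
    by (rule card_Un_disjoint) auto
  moreover have "card (?B - ?C) = card ?B - card ?C"
    using assms by (intro card_Diff_subset) auto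
  ultimately have "col_weight n j = card ?A + ((n - card {i. i < n \<and> even (i + j)}) - (j - card ?A))"
    unfolding col_weight_def odds by simp
  moreover have "card {i. i < m \<and> even (i + j)} \<le> m \<and>
      (if even j then m \<le> 2 * card {i. i < m \<and> even (i + j)} \<and> 2 * card {i. i < m \<and> even (i + j)} \<le> m + 1
       else m \<le> 2 * card {i. i < m \<and> even (i + j)} + 1 \<and> 2 * card {i. i < m \<and> even (i + j)} \<le> m)" for m
    unfolding card_even_below by (cases "even j"; simp; linarith)
  note this[of n] this[of j]
  ultimately have "n \<le> 2 * col_weight n j + 2 \<and> 2 * col_weight n j \<le> n + 2"
    using assms by (cases "even j") (simp_all, linarith+)
  then show "n \<le> 2 * col_weight n j + 2" "2 * col_weight n j \<le> n + 2" by auto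
qed

section \<open>Concentration of x^T M x and of |Mx|^2\<close>

definition mul_half :: "nat \<Rightarrow> nat set set \<Rightarrow> (nat \<Rightarrow> real) \<Rightarrow> nat \<Rightarrow> real" where
  "mul_half n E x i = (\<Sum>j<n. half_adj E i j * x j)"

lemma mul_half_eq:
  assumes "i < n"
  shows "mul_half n E x i = (\<Sum>e\<in>{e \<in> edges n. row_of e = i}. sgn_in E e * x (col_of e))"
proof -
  have "mul_half n E x i = (\<Sum>j<n. if sel i j then sgn_in E {i, j} * x j else 0)"
    unfolding mul_half_def half_adj_def by (intro sum.cong) auto
  also have "\<dots> = (\<Sum>e\<in>{e \<in> edges n. row_of e = i}. sgn_in E e * x (col_of e))"
    by (rule sum_sel_row[OF assms, where f = "\<lambda>e j. sgn_in E e * x j"])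
  finally show ?thesis .
qed

text \<open>Markov's inequality for exp f under the uniform distribution on the subsets of
  \<open>F\<close>, with the probability cleared of its denominator.\<close>

lemma card_exp_bound:
  fixes f :: "'a set \<Rightarrow> real"
  assumes "finite F" and sum: "(\<Sum>E\<in>Pow F. exp (f E)) \<le> 2 ^ card F * c"
  shows "real (card {E \<in> Pow F. t \<le> f E}) \<le> 2 ^ card F * (c * exp (- t))"
proof -
  have "real (card {E \<in> Pow F. t \<le> f E}) * exp t = (\<Sum>E\<in>{E \<in> Pow F. t \<le> f E}. exp t)"
    by simp
  also have "\<dots> \<le> (\<Sum>E\<in>{E \<in> Pow F. t \<le> f E}. exp (f E))"
    by (intro sum_mono) auto
  also have "\<dots> \<le> (\<Sum>E\<in>Pow F. exp (f E))"
    using assms by (intro sum_mono2) auto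
  finally have "real (card {E \<in> Pow F. t \<le> f E}) * exp t * exp (- t) \<le> 2 ^ card F * c * exp (- t)"
    using sum by (intro mult_right_mono) auto
  then show ?thesis by (simp add: mult.assoc mult_exp_exp)
qed

definition bilinear_form :: "nat \<Rightarrow> nat set set \<Rightarrow> (nat \<Rightarrow> real) \<Rightarrow> real" where
  "bilinear_form n E x = (\<Sum>i<n. x i * mul_half n E x i)"

text \<open>The deviation of |Mx|^2 from its mean: in the expansion of each square the products of
  different signs average to zero, and the pure squares add up to the column weights.\<close>

definition square_dev :: "nat \<Rightarrow> nat set set \<Rightarrow> (nat \<Rightarrow> real) \<Rightarrow> real" where
  "square_dev n E x = (\<Sum>i<n. (mul_half n E x i)\<^sup>2) - (\<Sum>j<n. real (col_weight n j) * (x j)\<^sup>2)"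

lemma bilinear_form_eq:
  "bilinear_form n E x = (\<Sum>e\<in>edges n. sgn_in E e * (x (row_of e) * x (col_of e)))"
proof -
  have "bilinear_form n E x = (\<Sum>i<n. \<Sum>j<n. if sel i j then sgn_in E {i, j} * (x i * x j) else 0)"
    unfolding bilinear_form_def mul_half_def half_adj_def sum_distrib_left
    by (intro sum.cong) auto
  also have "\<dots> = (\<Sum>e\<in>edges n. sgn_in E e * (x (row_of e) * x (col_of e)))"
    by (rule sum_sel[where n = n and f = "\<lambda>e i j. sgn_in E e * (x i * x j)"])
  finally show ?thesis .
qed

text \<open>x^T M x is a sum of independent signs with coefficients of square sum at most 1.
  Bounding the exponential moment of its square, rather than of the sum itself, handles both tails
  at once.\<close>

lemma bilinear_form_tail:
  assumes x: "(\<Sum>i<n. (x i)\<^sup>2) = 1" and "0 \<le> t"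
  shows "real (card {E \<in> Pow (edges n). t \<le> \<bar>bilinear_form n E x\<bar>})
    \<le> 2 ^ card (edges n) * (2 * exp (- (t\<^sup>2 / 8)))"
proof -
  define w where "w e = x (row_of e) * x (col_of e)" for e
  define \<sigma> where "\<sigma> = (\<Sum>e\<in>edges n. (w e)\<^sup>2)"
  have \<sigma>0: "0 \<le> \<sigma>" unfolding \<sigma>_def by (intro sum_nonneg) auto
  have "\<sigma> = (\<Sum>i<n. \<Sum>j<n. if sel i j then (x i * x j)\<^sup>2 else 0)"
    unfolding \<sigma>_def w_def by (rule sum_sel[where n = n and f = "\<lambda>e i j. (x i * x j)\<^sup>2", symmetric])
  also have "\<dots> \<le> (\<Sum>i<n. \<Sum>j<n. (x i)\<^sup>2 * (x j)\<^sup>2)"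
    by (intro sum_mono) (auto simp: power_mult_distrib)
  also have "\<dots> = 1"
    using x by (simp flip: sum_distrib_left sum_distrib_right add: sum_product[symmetric])
  finally have \<sigma>1: "\<sigma> \<le> 1" .
  \<comment> \<open>here all edges belong to a single row\<close>
  have "(\<Sum>E\<in>Pow (edges n). exp (\<Sum>i\<in>{()}. 1/8 *
        (\<Sum>e\<in>{e\<in>edges n. (\<lambda>_. ()) e = i}. sgn_in E e * w e)\<^sup>2))
    \<le> 2 ^ card (edges n) * exp (\<Sum>i\<in>{()}. 1/8 * (\<Sum>e\<in>{e\<in>edges n. (\<lambda>_. ()) e = i}. (w e)\<^sup>2)
        + 2 * (1/8)\<^sup>2 * (\<Sum>e\<in>{e\<in>edges n. (\<lambda>_. ()) e = i}. (w e)\<^sup>2)\<^sup>2)"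
    using \<sigma>0 \<sigma>1 by (intro sum_exp_row_squares_le) (auto simp: \<sigma>_def)
  also have "\<dots> = 2 ^ card (edges n) * exp (1/8 * \<sigma> + 2 * (1/8)\<^sup>2 * \<sigma>\<^sup>2)"
    by (simp flip: \<sigma>_def)
  \<comment> \<open>1/8 is the largest multiplier that the row condition admits when \<sigma> can be
    as large as 1; the exponent is then at most 1/8 + 2/64.\<close>
  also have "1/8 * \<sigma> + 2 * (1/8)\<^sup>2 * \<sigma>\<^sup>2 \<le> 5/32"
    using \<sigma>1 power_le_one[OF \<sigma>0 \<sigma>1, of 2] by (simp add: power2_eq_square)
  also have "exp (5/32 :: real) \<le> 2"
    using exp_bound_half[of "5/32 :: real"] by simp
  finally have "(\<Sum>E\<in>Pow (edges n). exp (1/8 * (bilinear_form n E x)\<^sup>2)) \<le> 2 ^ card (edges n) * 2"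
    by (simp add: bilinear_form_eq w_def)
  from card_exp_bound[OF _ this, of "t\<^sup>2 / 8"]
  have "real (card {E \<in> Pow (edges n). t\<^sup>2 / 8 \<le> 1/8 * (bilinear_form n E x)\<^sup>2})
    \<le> 2 ^ card (edges n) * (2 * exp (- (t\<^sup>2 / 8)))" by simp
  moreover have "t\<^sup>2 / 8 \<le> 1/8 * (bilinear_form n E x)\<^sup>2 \<longleftrightarrow> t \<le> \<bar>bilinear_form n E x\<bar>" for E
    using abs_le_square_iff[of t "bilinear_form n E x"] assms by simp
  ultimately show ?thesis by simp
qed

text \<open>The part of the exponent linear in l is l times the mean of |Mx|^2 and cancels after
  centering. Each of the n rows has variance at most |x|^2 = 1, so the quadratic part is at most 2
  l^2 n.\<close>

lemma square_dev_exp: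
  assumes x: "(\<Sum>i<n. (x i)\<^sup>2) = 1" and l: "\<bar>l\<bar> \<le> 1/8"
  shows "(\<Sum>E\<in>Pow (edges n). exp (l * square_dev n E x)) \<le> 2 ^ card (edges n) * exp (2 * l\<^sup>2 * n)"
proof -
  define \<sigma> where "\<sigma> i = (\<Sum>e\<in>{e \<in> edges n. row_of e = i}. (x (col_of e))\<^sup>2)" for i
  have \<sigma>0: "0 \<le> \<sigma> i" for i unfolding \<sigma>_def by (intro sum_nonneg) auto
  have \<sigma>_eq: "\<sigma> i = (\<Sum>j<n. if sel i j then (x j)\<^sup>2 else 0)" if "i < n" for i
    unfolding \<sigma>_def by (rule sum_sel_row[OF that, where f = "\<lambda>e j. (x j)\<^sup>2", symmetric])
  have \<sigma>1: "\<sigma> i \<le> 1" if "i < n" for i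
    unfolding \<sigma>_eq[OF that] x[symmetric] by (intro sum_mono) auto
  have sum_\<sigma>: "(\<Sum>i<n. \<sigma> i) = (\<Sum>j<n. real (col_weight n j) * (x j)\<^sup>2)"
  proof -
    have "(\<Sum>i<n. \<sigma> i) = (\<Sum>i<n. \<Sum>j<n. if sel i j then (x j)\<^sup>2 else 0)"
      by (intro sum.cong) (auto simp: \<sigma>_eq)
    also have "\<dots> = (\<Sum>j<n. \<Sum>i<n. if sel i j then (x j)\<^sup>2 else 0)"
      by (rule sum.swap)
    also have "\<dots> = (\<Sum>j<n. real (col_weight n j) * (x j)\<^sup>2)"
      by (intro sum.cong refl) (simp add: col_weight_def flip: sum.inter_filter)
    finally show ?thesis .
  qed
  have "(\<Sum>E\<in>Pow (edges n). exp (\<Sum>i<n. l * (\<Sum>e\<in>{e\<in>edges n. row_of e = i}. sgn_in E e * x (col_of e))\<^sup>2))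
    \<le> 2 ^ card (edges n) * exp (\<Sum>i<n. l * \<sigma> i + 2 * l\<^sup>2 * (\<sigma> i)\<^sup>2)"
    unfolding \<sigma>_def
  proof (intro sum_exp_row_squares_le)
    show "row_of ` edges n \<subseteq> {..<n}" using edgeE by auto
    fix i assume "i \<in> {..<n}"
    then have "\<bar>l\<bar> * \<sigma> i \<le> 1/8 * 1" using l \<sigma>0 \<sigma>1 by (intro mult_mono) auto
    then show "\<bar>l\<bar> * (\<Sum>e | e \<in> edges n \<and> row_of e = i. (x (col_of e))\<^sup>2) \<le> 1 / 8"
      by (simp add: \<sigma>_def)
  qed auto
  also have "(\<Sum>i<n. l * \<sigma> i + 2 * l\<^sup>2 * (\<sigma> i)\<^sup>2) \<le> (\<Sum>i<n. l * \<sigma> i + 2 * l\<^sup>2 * 1)"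
    using \<sigma>0 \<sigma>1 by (intro sum_mono add_left_mono mult_left_mono power_le_one) auto
  also have "\<dots> = l * (\<Sum>i<n. \<sigma> i) + 2 * l\<^sup>2 * n"
    by (simp add: sum.distrib sum_distrib_left)
  finally have "(\<Sum>E\<in>Pow (edges n). exp (l * (\<Sum>i<n. (mul_half n E x i)\<^sup>2))) \<le>
      2 ^ card (edges n) * exp (l * (\<Sum>i<n. \<sigma> i) + 2 * l\<^sup>2 * n)"
    by (simp add: mul_half_eq sum_distrib_left)
  then have "(\<Sum>E\<in>Pow (edges n). exp (l * (\<Sum>i<n. (mul_half n E x i)\<^sup>2))) * exp (- (l * (\<Sum>i<n. \<sigma> i))) \<le>
      2 ^ card (edges n) * exp (l * (\<Sum>i<n. \<sigma> i) + 2 * l\<^sup>2 * n) * exp (- (l * (\<Sum>i<n. \<sigma> i)))"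
    by (intro mult_right_mono) auto
  then show ?thesis
    unfolding square_dev_def sum_\<sigma>[symmetric]
    by (simp add: sum_distrib_right mult_exp_exp right_diff_distrib mult.assoc)
qed

lemma square_dev_tail:
  assumes x: "(\<Sum>i<n. (x i)\<^sup>2) = 1" and "0 \<le> t" "2 * t \<le> n" "0 < n"
  shows "real (card {E \<in> Pow (edges n). t \<le> \<bar>square_dev n E x\<bar>})
    \<le> 2 ^ card (edges n) * (2 * exp (- (t\<^sup>2 / (8 * n))))"
proof -
  \<comment> \<open>The minimizer of 2 l^2 n - l t; the assumption \<open>2 * t \<le> n\<close>
    keeps it within the admissible 1/8.\<close>
  define l where "l = t / (4 * n)"
  have l: "0 \<le> l" "l \<le> 1/8" using assms by (auto simp: l_def field_simps)
  have eq: "2 * l\<^sup>2 * n - l * t = - (t\<^sup>2 / (8 * n))"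
    using assms by (simp add: l_def power2_eq_square field_simps)
  have one: "real (card {E \<in> Pow (edges n). l * t \<le> m * square_dev n E x})
      \<le> 2 ^ card (edges n) * exp (- (t\<^sup>2 / (8 * n)))" if "m = l \<or> m = - l" for m
  proof -
    have "\<bar>m\<bar> \<le> 1/8" "m\<^sup>2 = l\<^sup>2" using that l by auto
    then have "(\<Sum>E\<in>Pow (edges n). exp (m * square_dev n E x)) \<le> 2 ^ card (edges n) * exp (2 * l\<^sup>2 * n)"
      using square_dev_exp[OF x, of m] by simp
    from card_exp_bound[OF _ this, of "l * t"] show ?thesis
      unfolding eq[symmetric] by (simp add: mult_exp_exp)
  qed
  have "{E \<in> Pow (edges n). t \<le> \<bar>square_dev n E x\<bar>} \<subseteq>
     {E \<in> Pow (edges n). l * t \<le> l * square_dev n E x} \<union> {E \<in> Pow (edges n). l * t \<le> - l * square_dev n E x}"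
  proof
    fix E assume E: "E \<in> {E \<in> Pow (edges n). t \<le> \<bar>square_dev n E x\<bar>}"
    then have "l * t \<le> l * \<bar>square_dev n E x\<bar>" using l by (intro mult_left_mono) auto
    with E show "E \<in> {E \<in> Pow (edges n). l * t \<le> l * square_dev n E x} \<union> {E \<in> Pow (edges n). l * t \<le> - l * square_dev n E x}"
      by (auto simp: abs_if split: if_splits)
  qed
  then have "card {E \<in> Pow (edges n). t \<le> \<bar>square_dev n E x\<bar>} \<le>
    card ({E \<in> Pow (edges n). l * t \<le> l * square_dev n E x} \<union> {E \<in> Pow (edges n). l * t \<le> - l * square_dev n E x})"
    by (intro card_mono) auto
  also have "\<dots> \<le> card {E \<in> Pow (edges n). l * t \<le> l * square_dev n E x} + card {E \<in> Pow (edges n). l * t \<le> - l * square_dev n E x}"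
    by (rule card_Un_le)
  finally have "real (card {E \<in> Pow (edges n). t \<le> \<bar>square_dev n E x\<bar>}) \<le>
    real (card {E \<in> Pow (edges n). l * t \<le> l * square_dev n E x}) + real (card {E \<in> Pow (edges n). l * t \<le> - l * square_dev n E x})"
    by linarith
  with one[of l] one[of "- l"] show ?thesis by simp
qed


section \<open>Union bound over a grid\<close>

text \<open>An integer vector z represents the point z/q. The conditions tested on it are
  homogeneous, so they can be stated for z itself.\<close>

definition grid :: "nat \<Rightarrow> nat \<Rightarrow> nat \<Rightarrow> (nat \<Rightarrow> int) set" where
  "grid n k q = {z. (\<forall>i\<ge>n. z i = 0) \<and> card {i. i < n \<and> z i \<noteq> 0} \<le> k \<and> (\<forall>i. \<bar>z i\<bar> \<le> int q)}"

lemma card_grid: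
  assumes "0 < n"
  shows "finite (grid n k q)" "card (grid n k q) \<le> (n * (2 * q + 1)) ^ k"
proof -
  define D where "D = {l. set l \<subseteq> {..<n} \<times> {- int q..int q} \<and> length l = k}"
  define f where "f l i = (case map_of l i of None \<Rightarrow> 0 | Some a \<Rightarrow> a)" for l :: "(nat \<times> int) list" and i
  have fin: "finite D" unfolding D_def by (rule finite_lists_length_eq) auto
  have "card D = (n * (2 * q + 1)) ^ k"
    unfolding D_def by (subst card_lists_length_eq) (auto simp: card_cartesian_product nat_add_distrib nat_mult_distrib)
  have "z \<in> f ` D" if z: "z \<in> grid n k q" for z
  proof -
    define S where "S = {i. i < n \<and> z i \<noteq> 0}"
    have S: "finite S" "card S \<le> k" "\<And>i. i \<notin> S \<Longrightarrow> z i = 0"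
      using z unfolding S_def grid_def by (auto simp: not_less)
    \<comment> \<open>The padding repeats index 0 with its own value \<open>z 0\<close>, so
      \<open>map_of\<close> still recovers z from a list of exactly k pairs.\<close>
    define js where "js = sorted_list_of_set S @ replicate (k - card S) 0"
    define l where "l = map (\<lambda>i. (i, z i)) js"
    have "set js \<subseteq> insert 0 S" "S \<subseteq> set js"
      by (auto simp: js_def S(1) set_replicate_conv_if)
    moreover have "S \<subseteq> {..<n}" by (auto simp: S_def)
    ultimately have set_js: "S \<subseteq> set js" "set js \<subseteq> {..<n}" using assms by auto
    have length_js: "length js = k" using S(2) by (simp add: js_def)
    have z_bounds: "- int q \<le> z i" "z i \<le> int q" for i
      using z by (auto simp: grid_def abs_le_iff minus_le_iff)
    have "l \<in> D"
      using set_js(2) length_js z_bounds by (auto simp: D_def l_def)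
    moreover have "f l = z"
    proof
      fix i
      show "f l i = z i"
        using S(3)[of i] set_js unfolding f_def l_def map_of_map_restrict
        by (cases "i \<in> set js") (auto simp: restrict_map_def)
    qed
    ultimately show ?thesis by blast
  qed
  then have sub: "grid n k q \<subseteq> f ` D" by blast
  show "finite (grid n k q)" using sub fin by (meson finite_imageI finite_subset)
  have "card (grid n k q) \<le> card (f ` D)" using sub fin by (intro card_mono) auto
  also have "\<dots> \<le> card D" using fin by (rule card_image_le)
  finally show "card (grid n k q) \<le> (n * (2 * q + 1)) ^ k" using \<open>card D = _\<close> by simp
qed

definition quad_form :: "nat \<Rightarrow> (nat \<Rightarrow> nat \<Rightarrow> real) \<Rightarrow> (nat \<Rightarrow> real) \<Rightarrow> real" where
  "quad_form n B x = (\<Sum>i<n. \<Sum>j<n. B i j * (x i * x j))"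

lemma quad_form_scale: "quad_form n B (\<lambda>i. c * x i) = c\<^sup>2 * quad_form n B x"
  unfolding quad_form_def sum_distrib_left by (intro sum.cong) (auto simp: power2_eq_square)

text \<open>Coordinates are rounded towards zero, which preserves sparsity and does not increase the norm.\<close>

lemma quad_form_grid_approx:
  assumes B: "\<And>i j. i < n \<Longrightarrow> j < n \<Longrightarrow> \<bar>B i j\<bar> \<le> \<beta>" and q: "0 < q" and "0 \<le> t"
    and grid: "\<And>z. z \<in> grid n k q \<Longrightarrow>
      \<bar>quad_form n B (\<lambda>i. real_of_int (z i))\<bar> \<le> t * (\<Sum>i<n. (real_of_int (z i))\<^sup>2)"
    and sparse: "card {i. i < n \<and> x i \<noteq> 0} \<le> k"
  shows "\<bar>quad_form n B x\<bar> \<le> (t + 2 * \<beta> * n\<^sup>2 / q) * (\<Sum>i<n. (x i)\<^sup>2)"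
proof (cases "(\<Sum>i<n. (x i)\<^sup>2) = 0")
  case True
  then have "\<forall>i<n. x i = 0" by (simp add: sum_nonneg_eq_0_iff)
  then have "quad_form n B x = 0" by (simp add: quad_form_def)
  with True show ?thesis by simp
next
  case False
  define X where "X = (\<Sum>i<n. (x i)\<^sup>2)"
  have X: "0 < X" using False unfolding X_def by (simp add: sum_nonneg less_le)
  define u where "u i = x i / sqrt X" for i
  define z where "z i = (if i < n then if 0 \<le> u i then \<lfloor>q * u i\<rfloor> else \<lceil>q * u i\<rceil> else 0)" for i
  define y where "y i = z i / q" for i
  have sum_u: "(\<Sum>i<n. (u i)\<^sup>2) = 1"
    using X by (simp add: u_def power_divide flip: sum_divide_distrib X_def)
  have u1: "\<bar>u i\<bar> \<le> 1" if "i < n" for i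
  proof -
    have "(u i)\<^sup>2 \<le> (\<Sum>i<n. (u i)\<^sup>2)" using that by (intro member_le_sum) auto
    then show ?thesis unfolding sum_u by (simp add: abs_square_le_1)
  qed
  have z_le: "\<bar>real_of_int (z i)\<bar> \<le> q * \<bar>u i\<bar>" "\<bar>q * u i - z i\<bar> \<le> 1" if "i < n" for i
  proof -
    have "0 \<le> q * u i" if "0 \<le> u i" using that by simp
    moreover have "q * u i \<le> 0" if "\<not> 0 \<le> u i" using that by (simp add: mult_le_0_iff)
    ultimately have "\<bar>real_of_int (z i)\<bar> \<le> \<bar>q * u i\<bar> \<and> \<bar>q * u i - z i\<bar> \<le> 1"
      using that unfolding z_def by (cases "0 \<le> u i") (auto; linarith)+
    then show "\<bar>real_of_int (z i)\<bar> \<le> q * \<bar>u i\<bar>" "\<bar>q * u i - z i\<bar> \<le> 1" by (auto simp: abs_mult)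
  qed
  have y: "\<bar>y i\<bar> \<le> \<bar>u i\<bar>" "\<bar>u i - y i\<bar> \<le> 1 / q" if "i < n" for i
  proof -
    show "\<bar>y i\<bar> \<le> \<bar>u i\<bar>" using z_le(1)[OF that] q by (simp add: y_def field_simps)
    have "u i - y i = (q * u i - z i) / q" using q by (simp add: y_def field_simps)
    then show "\<bar>u i - y i\<bar> \<le> 1 / q" using z_le(2)[OF that] q by (simp add: divide_right_mono)
  qed
  have "z \<in> grid n k q"
  proof -
    have "{i. i < n \<and> z i \<noteq> 0} \<subseteq> {i. i < n \<and> x i \<noteq> 0}" by (auto simp: z_def u_def)
    then have "card {i. i < n \<and> z i \<noteq> 0} \<le> card {i. i < n \<and> x i \<noteq> 0}" by (intro card_mono) auto
    moreover have "\<bar>z i\<bar> \<le> int q" for i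
    proof (cases "i < n")
      case True
      have "q * \<bar>u i\<bar> \<le> real q * 1" using u1[OF True] by (intro mult_left_mono) auto
      then have "\<bar>real_of_int (z i)\<bar> \<le> real q" using z_le(1)[OF True] by simp
      then show ?thesis by linarith
    qed (simp add: z_def)
    ultimately show ?thesis using sparse by (auto simp: grid_def z_def)
  qed
  then have "\<bar>quad_form n B (\<lambda>i. q * y i)\<bar> \<le> t * (\<Sum>i<n. (q * y i)\<^sup>2)"
    using grid[of z] q by (simp add: y_def)
  then have "real q ^ 2 * \<bar>quad_form n B y\<bar> \<le> real q ^ 2 * (t * (\<Sum>i<n. (y i)\<^sup>2))"
    unfolding quad_form_scale by (simp add: abs_mult power_mult_distrib mult_ac flip: sum_distrib_left)
  then have "\<bar>quad_form n B y\<bar> \<le> t * (\<Sum>i<n. (y i)\<^sup>2)" using q by simp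
  also have "\<dots> \<le> t * (\<Sum>i<n. (u i)\<^sup>2)"
    using y(1) \<open>0 \<le> t\<close> by (intro mult_left_mono sum_mono) (auto simp: abs_le_square_iff)
  finally have Qy: "\<bar>quad_form n B y\<bar> \<le> t" using sum_u by simp
  \<comment> \<open>Rounding moves each product of two coordinates by at most 2/q, and n^2
    coefficients of size at most \<beta> add up. This crude estimate suffices because q will be a
    large power of n.\<close>
  have "\<bar>quad_form n B u - quad_form n B y\<bar> \<le> (\<Sum>i<n. \<Sum>j<n. \<beta> * (2 / q))"
    unfolding quad_form_def sum_subtractf[symmetric] right_diff_distrib[symmetric]
  proof (intro order_trans[OF sum_abs] sum_mono)
    fix i j assume ij: "i \<in> {..<n}" "j \<in> {..<n}"
    have "\<bar>u i * u j - y i * y j\<bar> = \<bar>u i * (u j - y j) + y j * (u i - y i)\<bar>"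
      by (simp add: algebra_simps)
    also have "\<dots> \<le> \<bar>u i\<bar> * \<bar>u j - y j\<bar> + \<bar>y j\<bar> * \<bar>u i - y i\<bar>"
      by (metis abs_mult abs_triangle_ineq)
    also have "\<dots> \<le> 1 * (1 / q) + 1 * (1 / q)"
    proof (intro add_mono mult_mono)
      show "\<bar>u i\<bar> \<le> 1" "\<bar>y j\<bar> \<le> 1" "\<bar>u i - y i\<bar> \<le> 1 / q" "\<bar>u j - y j\<bar> \<le> 1 / q"
        using u1 y ij by (auto intro: order_trans)
    qed auto
    finally have "\<bar>u i * u j - y i * y j\<bar> \<le> 2 / q" by simp
    then show "\<bar>B i j * (u i * u j - y i * y j)\<bar> \<le> \<beta> * (2 / q)"
      using B[of i j] ij unfolding abs_mult by (intro mult_mono) (auto intro: order_trans)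
  qed
  also have "\<dots> = 2 * \<beta> * n\<^sup>2 / q" by (simp add: power2_eq_square)
  finally have Qu: "\<bar>quad_form n B u\<bar> \<le> t + 2 * \<beta> * n\<^sup>2 / q" using Qy by linarith
  have "x = (\<lambda>i. sqrt X * u i)" using X by (auto simp: u_def)
  then have "\<bar>quad_form n B x\<bar> = X * \<bar>quad_form n B u\<bar>"
    using X by (metis quad_form_scale abs_mult abs_of_pos real_sqrt_pow2 less_imp_le)
  also have "\<dots> \<le> X * (t + 2 * \<beta> * n\<^sup>2 / q)" using Qu X by (intro mult_left_mono) auto
  finally show ?thesis by (simp add: X_def mult.commute)
qed

lemma bilinear_form_quad: "bilinear_form n E = quad_form n (half_adj E)"
  unfolding bilinear_form_def mul_half_def quad_form_def sum_distrib_left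
  by (intro ext sum.cong) auto

lemma square_dev_quad:
  "square_dev n E = quad_form n (\<lambda>j l. (\<Sum>i<n. half_adj E i j * half_adj E i l)
     - (if j = l then real (col_weight n j) else 0))"
proof
  fix x
  have "(\<Sum>i<n. (mul_half n E x i)\<^sup>2)
      = (\<Sum>i<n. \<Sum>j<n. \<Sum>l<n. half_adj E i j * half_adj E i l * (x j * x l))"
    unfolding mul_half_def power2_eq_square sum_product by (intro sum.cong) auto
  also have "\<dots> = (\<Sum>j<n. \<Sum>l<n. \<Sum>i<n. half_adj E i j * half_adj E i l * (x j * x l))"
    by (rule trans[OF sum.swap], rule sum.cong[OF refl], rule sum.swap)
  finally show "square_dev n E x = quad_form n (\<lambda>j l. (\<Sum>i<n. half_adj E i j * half_adj E i l)
     - (if j = l then real (col_weight n j) else 0)) x"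
    unfolding square_dev_def quad_form_def left_diff_distrib sum_subtractf
    by (simp add: sum_distrib_right power2_eq_square if_distrib[of "\<lambda>a. a * _"] cong: if_cong)
qed

lemma abs_half_adj_le: "\<bar>half_adj E i j\<bar> \<le> 1"
  by (simp add: half_adj_def sgn_in_def)

lemma abs_square_dev_coeff_le:
  "\<bar>(\<Sum>i<n. half_adj E i j * half_adj E i l) - (if j = l then real (col_weight n j) else 0)\<bar> \<le> 2 * n"
proof -
  have "\<bar>\<Sum>i<n. half_adj E i j * half_adj E i l\<bar> \<le> (\<Sum>i<n. 1 * 1)"
    unfolding abs_mult by (intro order_trans[OF sum_abs] sum_mono)
      (auto simp: abs_mult intro!: mult_le_one abs_half_adj_le)
  moreover have "col_weight n j \<le> card {..<n}"
    unfolding col_weight_def by (intro card_mono) auto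
  ultimately show ?thesis by (auto simp: abs_le_iff)
qed

definition grid_good :: "nat \<Rightarrow> nat \<Rightarrow> nat \<Rightarrow> real \<Rightarrow> real \<Rightarrow> nat set set \<Rightarrow> bool" where
  "grid_good n k q t1 t2 E \<longleftrightarrow> (\<forall>z \<in> grid n k q.
     \<bar>bilinear_form n E (\<lambda>i. real_of_int (z i))\<bar> \<le> t1 * (\<Sum>i<n. (real_of_int (z i))\<^sup>2) \<and>
     \<bar>square_dev n E (\<lambda>i. real_of_int (z i))\<bar> \<le> t2 * (\<Sum>i<n. (real_of_int (z i))\<^sup>2))"

text \<open>Union bound: the tail bounds for unit vectors apply to z/|z|, and there are at most
  (n(2q + 1))^k grid points.\<close>

lemma card_grid_bad:
  assumes "0 < n" "0 \<le> t1" "0 \<le> t2" "2 * t2 \<le> n"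
  shows "real (card {E \<in> Pow (edges n). \<not> grid_good n k q t1 t2 E}) \<le>
    2 ^ card (edges n) * (real (n * (2 * q + 1)) ^ k * (2 * exp (- (t1\<^sup>2 / 8)) + 2 * exp (- (t2\<^sup>2 / (8 * n)))))"
proof -
  define b where "b = 2 * exp (- (t1\<^sup>2 / 8)) + 2 * exp (- (t2\<^sup>2 / (8 * n)))"
  define Bad where "Bad z = {E \<in> Pow (edges n).
     t1 * (\<Sum>i<n. (real_of_int (z i))\<^sup>2) < \<bar>bilinear_form n E (\<lambda>i. real_of_int (z i))\<bar> \<or>
     t2 * (\<Sum>i<n. (real_of_int (z i))\<^sup>2) < \<bar>square_dev n E (\<lambda>i. real_of_int (z i))\<bar>}"
    for z :: "nat \<Rightarrow> int"
  have Bad: "real (card (Bad z)) \<le> 2 ^ card (edges n) * b" for z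
  proof (cases "(\<Sum>i<n. (real_of_int (z i))\<^sup>2) = 0")
    case True
    then have "\<forall>i<n. z i = 0" by (simp add: sum_nonneg_eq_0_iff)
    then have "Bad z = {}" 
      unfolding Bad_def bilinear_form_quad square_dev_quad by (simp add: quad_form_def)
    then show ?thesis by (simp add: b_def)
  next
    case False
    define Z where "Z = (\<Sum>i<n. (real_of_int (z i))\<^sup>2)"
    have Z: "0 < Z" using False unfolding Z_def by (simp add: sum_nonneg less_le)
    define v where "v i = real_of_int (z i) / sqrt Z" for i
    have v: "(\<Sum>i<n. (v i)\<^sup>2) = 1"
      using Z by (simp add: v_def power_divide flip: sum_divide_distrib Z_def)
    have zv: "(\<lambda>i. real_of_int (z i)) = (\<lambda>i. sqrt Z * v i)" using Z by (auto simp: v_def)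
    have scale: "\<bar>quad_form n B (\<lambda>i. real_of_int (z i))\<bar> = Z * \<bar>quad_form n B v\<bar>" for B
      unfolding zv quad_form_scale using Z by (simp add: abs_mult)
    have "Bad z \<subseteq> {E \<in> Pow (edges n). t1 \<le> \<bar>bilinear_form n E v\<bar>}
        \<union> {E \<in> Pow (edges n). t2 \<le> \<bar>square_dev n E v\<bar>}"
      using Z unfolding Bad_def bilinear_form_quad square_dev_quad scale Z_def[symmetric]
      by (auto simp: mult.commute[of _ Z])
    then have "card (Bad z) \<le> card ({E \<in> Pow (edges n). t1 \<le> \<bar>bilinear_form n E v\<bar>}
        \<union> {E \<in> Pow (edges n). t2 \<le> \<bar>square_dev n E v\<bar>})"
      by (intro card_mono) auto
    also have "\<dots> \<le> card {E \<in> Pow (edges n). t1 \<le> \<bar>bilinear_form n E v\<bar>}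
        + card {E \<in> Pow (edges n). t2 \<le> \<bar>square_dev n E v\<bar>}"
      by (rule card_Un_le)
    finally have "real (card (Bad z)) \<le> real (card {E \<in> Pow (edges n). t1 \<le> \<bar>bilinear_form n E v\<bar>})
        + real (card {E \<in> Pow (edges n). t2 \<le> \<bar>square_dev n E v\<bar>})"
      by linarith
    also have "\<dots> \<le> 2 ^ card (edges n) * b"
      using bilinear_form_tail[OF v, of t1] square_dev_tail[OF v, of t2] assms
      unfolding b_def distrib_left by (intro add_mono) auto
    finally show ?thesis .
  qed
  have fin: "finite (grid n k q)" using card_grid(1)[OF assms(1)] .
  have "{E \<in> Pow (edges n). \<not> grid_good n k q t1 t2 E} \<subseteq> (\<Union>z\<in>grid n k q. Bad z)"
    unfolding grid_good_def Bad_def by (auto simp: not_le)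
  then have "card {E \<in> Pow (edges n). \<not> grid_good n k q t1 t2 E} \<le> card (\<Union>z\<in>grid n k q. Bad z)"
    using fin by (intro card_mono) (auto simp: Bad_def)
  also have "\<dots> \<le> (\<Sum>z\<in>grid n k q. card (Bad z))"
    by (rule card_UN_le[OF fin])
  finally have "real (card {E \<in> Pow (edges n). \<not> grid_good n k q t1 t2 E}) \<le> (\<Sum>z\<in>grid n k q. real (card (Bad z)))"
    unfolding of_nat_sum[symmetric] by (rule of_nat_mono)
  also have "\<dots> \<le> (\<Sum>z\<in>grid n k q. 2 ^ card (edges n) * b)"
    by (intro sum_mono Bad)
  also have "\<dots> = real (card (grid n k q)) * (2 ^ card (edges n) * b)" by simp
  also have "\<dots> \<le> real ((n * (2 * q + 1)) ^ k) * (2 ^ card (edges n) * b)"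
    using card_grid(2)[OF assms(1)] by (intro mult_right_mono of_nat_mono) (auto simp: b_def)
  finally show ?thesis by (simp add: b_def mult_ac)
qed


section \<open>The matrix of the reduction\<close>

text \<open>\<open>i div n\<close> is the block and \<open>i mod n\<close> the vertex.
  \<open>sel\<close> is consulted at the unreduced indices, which within a block agrees with the
  vertices by \<open>sel_shift\<close>. An integer s keeps the entries rational.\<close>

definition rip_matrix :: "nat \<Rightarrow> nat \<Rightarrow> nat set set \<Rightarrow> rat Matrix.mat" where
  "rip_matrix n s E = Matrix.mat (2 * n) (2 * n) (\<lambda>(i, j).
     if i = j then 1 / 2
     else if i div n = j div n \<and> sel i j
       then (if {i mod n, j mod n} \<in> E then 1 else - 1) * (if i < n then 1 else - 1) / of_nat s
     else 0)"

lemma rip_matrix_carrier [simp]: "rip_matrix n s E \<in> carrier_mat (2 * n) (2 * n)"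
  by (simp add: rip_matrix_def)

lemma sum_lessThan_add: "(\<Sum>i<n + m. f i) = (\<Sum>i<n. f i) + (\<Sum>i<m. f (n + i))"
  for f :: "nat \<Rightarrow> 'a :: comm_monoid_add"
  by (induction m) (simp_all add: add.assoc)

lemma l2_norm_square: "(l2_norm x)\<^sup>2 = (\<Sum>i<dim_vec x. (x $ i)\<^sup>2)"
  by (simp add: l2_norm_def L2_set_def sum_nonneg)

definition block_square :: "real \<Rightarrow> nat \<Rightarrow> nat \<Rightarrow> nat set set \<Rightarrow> (nat \<Rightarrow> real) \<Rightarrow> real" where
  "block_square \<sigma> n s E x = (\<Sum>i<n. (x i / 2 + \<sigma> * mul_half n E x i / s)\<^sup>2)"

lemma l2_norm_rip_matrix:
  assumes x: "x \<in> carrier_vec (2 * n)"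
  shows "(l2_norm (real_matrix (rip_matrix n s E) *\<^sub>v x))\<^sup>2
    = block_square 1 n s E (\<lambda>i. x $ i) + block_square (- 1) n s E (\<lambda>i. x $ (n + i))"
proof -
  let ?A = "real_matrix (rip_matrix n s E)"
  have row: "(?A *\<^sub>v x) $ i = (\<Sum>j<2 * n. ?A $$ (i, j) * x $ j)" if "i < 2 * n" for i
    using that x
    by (auto simp: scalar_prod_def lessThan_atLeast0 rip_matrix_def simp del: index_map_mat(1) intro!: sum.cong)
  have entry: "?A $$ (i, j) = (if i = j then 1 / 2 else 0) + half_adj E i j / s"
      "?A $$ (n + i, n + j) = (if i = j then 1 / 2 else 0) - half_adj E i j / s"
      "?A $$ (i, n + j) = 0" "?A $$ (n + i, j) = 0" if "i < n" "j < n" for i j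
    using that by (auto simp: rip_matrix_def half_adj_def sgn_in_def of_rat_divide of_rat_minus of_rat_mult)
  have one: "(?A *\<^sub>v x) $ i = x $ i / 2 + 1 * mul_half n E (\<lambda>i. x $ i) i / s" if i: "i < n" for i
  proof -
    have "(?A *\<^sub>v x) $ i = (\<Sum>j<n. ?A $$ (i, j) * x $ j) + (\<Sum>j<n. ?A $$ (i, n + j) * x $ (n + j))"
      using i row[of i] by (simp add: mult_2 sum_lessThan_add)
    also have "(\<Sum>j<n. ?A $$ (i, n + j) * x $ (n + j)) = 0"
      using i by (intro sum.neutral) (simp add: entry)
    also have "(\<Sum>j<n. ?A $$ (i, j) * x $ j) = (\<Sum>j<n. (if i = j then x $ j / 2 else 0) + half_adj E i j * x $ j / s)"
      using i by (intro sum.cong) (auto simp: entry distrib_right)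
    finally show ?thesis
      using i by (simp add: sum.distrib mul_half_def sum_divide_distrib)
  qed
  have two: "(?A *\<^sub>v x) $ (n + i) = x $ (n + i) / 2 + (- 1) * mul_half n E (\<lambda>i. x $ (n + i)) i / s"
    if i: "i < n" for i
  proof -
    have "(?A *\<^sub>v x) $ (n + i) = (\<Sum>j<n. ?A $$ (n + i, j) * x $ j) + (\<Sum>j<n. ?A $$ (n + i, n + j) * x $ (n + j))"
      using i row[of "n + i"] by (simp add: mult_2 sum_lessThan_add)
    also have "(\<Sum>j<n. ?A $$ (n + i, j) * x $ j) = 0"
      using i by (intro sum.neutral) (simp add: entry)
    also have "(\<Sum>j<n. ?A $$ (n + i, n + j) * x $ (n + j))
        = (\<Sum>j<n. (if i = j then x $ (n + j) / 2 else 0) - half_adj E i j * x $ (n + j) / s)"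
      using i by (intro sum.cong) (auto simp: entry left_diff_distrib)
    finally show ?thesis
      using i by (simp add: sum_subtractf mul_half_def sum_divide_distrib)
  qed
  have "(l2_norm (?A *\<^sub>v x))\<^sup>2 = (\<Sum>i<n + n. ((?A *\<^sub>v x) $ i)\<^sup>2)"
    unfolding l2_norm_square by (simp add: rip_matrix_def mult_2)
  then show ?thesis
    by (simp add: sum_lessThan_add block_square_def one two del: index_mult_mat_vec)
qed

lemma block_square_eq:
  assumes "\<sigma>\<^sup>2 = 1"
  shows "block_square \<sigma> n s E x = (\<Sum>i<n. (x i)\<^sup>2) / 4 + \<sigma> * bilinear_form n E x / s
    + (\<Sum>i<n. (mul_half n E x i)\<^sup>2) / s\<^sup>2"
proof -
  have "(x i / 2 + \<sigma> * mul_half n E x i / s)\<^sup>2 =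
     (x i)\<^sup>2 / 4 + \<sigma> * (x i * mul_half n E x i) / s + (mul_half n E x i)\<^sup>2 / s\<^sup>2" for i
  proof -
    have "(x i / 2 + \<sigma> * mul_half n E x i / s)\<^sup>2 =
     (x i)\<^sup>2 / 4 + \<sigma> * (x i * mul_half n E x i) / s + \<sigma>\<^sup>2 * (mul_half n E x i)\<^sup>2 / s\<^sup>2"
      by (simp add: power2_sum power_divide power_mult_distrib)
    then show ?thesis using assms by simp
  qed
  then show ?thesis
    by (simp add: block_square_def bilinear_form_def sum.distrib sum_divide_distrib sum_distrib_left)
qed

text \<open>The Gram matrix of a block is compared with the identity in three parts: the scalar 1/4
  + n/(2 s^2), the linear term x^T M x, and the fluctuation of |Mx|^2. The fractions with q are
  rounding errors for coefficients bounded by 1 and by 2n; the summand 1 accounts for column weights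
  that differ from n/2.\<close>

lemma block_square_near_isometry:
  assumes good: "grid_good n k q t1 t2 E" and pos: "0 < s" "0 < q" "0 \<le> t1" "0 \<le> t2"
    and \<eta>: "\<bar>1 / 4 + n / (2 * s\<^sup>2) - 1\<bar> + (t1 + 2 * n\<^sup>2 / q) / s + (t2 + 4 * n ^ 3 / q + 1) / s\<^sup>2 \<le> \<eta>"
    and \<sigma>: "\<sigma> = 1 \<or> \<sigma> = - 1" and sparse: "card {i. i < n \<and> x i \<noteq> 0} \<le> k"
  shows "\<bar>block_square \<sigma> n s E x - (\<Sum>i<n. (x i)\<^sup>2)\<bar> \<le> \<eta> * (\<Sum>i<n. (x i)\<^sup>2)"
proof -
  define X where "X = (\<Sum>i<n. (x i)\<^sup>2)"
  have X: "0 \<le> X" unfolding X_def by (intro sum_nonneg) auto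
  define W where "W = (\<Sum>j<n. (real (col_weight n j) - n / 2) * (x j)\<^sup>2)"
  have bil: "\<bar>bilinear_form n E x\<bar> \<le> (t1 + 2 * n\<^sup>2 / q) * X"
    using quad_form_grid_approx[of n "half_adj E" 1 q t1 k x] good pos sparse abs_half_adj_le
    unfolding grid_good_def bilinear_form_quad X_def by auto
  have dev: "\<bar>square_dev n E x\<bar> \<le> (t2 + 4 * n ^ 3 / q) * X"
    using quad_form_grid_approx[where n = n and \<beta> = "2 * n" and q = q and t = t2 and k = k and x = x,
        OF abs_square_dev_coeff_le] good pos sparse
    unfolding grid_good_def square_dev_quad X_def
    by (auto simp: power2_eq_square power3_eq_cube mult_ac)
  have "\<bar>W\<bar> \<le> (\<Sum>j<n. 1 * (x j)\<^sup>2)"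
    unfolding W_def
  proof (intro order_trans[OF sum_abs] sum_mono)
    fix j assume "j \<in> {..<n}"
    then have "\<bar>real (col_weight n j) - n / 2\<bar> \<le> 1" using col_weight_bounds[of j n] by auto
    then show "\<bar>(real (col_weight n j) - n / 2) * (x j)\<^sup>2\<bar> \<le> 1 * (x j)\<^sup>2"
      unfolding abs_mult by (intro mult_mono) auto
  qed
  then have W: "\<bar>W\<bar> \<le> X" by (simp add: X_def)
  have "(\<Sum>i<n. (mul_half n E x i)\<^sup>2) = square_dev n E x + W + n / 2 * X"
    unfolding square_dev_def W_def X_def
    by (simp add: left_diff_distrib sum_subtractf sum_distrib_left)
  then have "block_square \<sigma> n s E x - X = (1 / 4 + n / (2 * s\<^sup>2) - 1) * X
      + \<sigma> * bilinear_form n E x / s + (square_dev n E x + W) / s\<^sup>2"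
    using \<sigma> by (subst block_square_eq) (auto simp: X_def[symmetric] algebra_simps add_divide_distrib)
  also have "\<bar>\<dots>\<bar> \<le> \<bar>(1 / 4 + n / (2 * s\<^sup>2) - 1) * X\<bar> + \<bar>\<sigma> * bilinear_form n E x / s\<bar>
      + \<bar>(square_dev n E x + W) / s\<^sup>2\<bar>"
    by (rule order_trans[OF abs_triangle_ineq add_right_mono[OF abs_triangle_ineq]])
  also have "\<dots> \<le> \<bar>1 / 4 + n / (2 * s\<^sup>2) - 1\<bar> * X + (t1 + 2 * n\<^sup>2 / q) * X / s
      + (t2 + 4 * n ^ 3 / q + 1) * X / s\<^sup>2"
  proof (intro add_mono)
    show "\<bar>\<sigma> * bilinear_form n E x / s\<bar> \<le> (t1 + 2 * n\<^sup>2 / q) * X / s"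
      using bil \<sigma> by (auto simp: abs_mult intro!: divide_right_mono)
    have "\<bar>square_dev n E x + W\<bar> \<le> (t2 + 4 * n ^ 3 / q + 1) * X"
      using dev W by (simp add: distrib_right)
    then show "\<bar>(square_dev n E x + W) / s\<^sup>2\<bar> \<le> (t2 + 4 * n ^ 3 / q + 1) * X / s\<^sup>2"
      by (auto simp: intro!: divide_right_mono)
  qed (simp add: abs_mult X)
  also have "\<dots> = (\<bar>1 / 4 + n / (2 * s\<^sup>2) - 1\<bar> + (t1 + 2 * n\<^sup>2 / q) / s + (t2 + 4 * n ^ 3 / q + 1) / s\<^sup>2) * X"
    by (simp add: distrib_right)
  also have "\<dots> \<le> \<eta> * X" using \<eta> X by (intro mult_right_mono)
  finally show ?thesis by (simp add: X_def)
qed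

lemma rip_rip_matrix:
  assumes good: "grid_good n k q t1 t2 E" and pos: "0 < s" "0 < q" "0 \<le> t1" "0 \<le> t2"
    and \<eta>: "\<bar>1 / 4 + n / (2 * s\<^sup>2) - 1\<bar> + (t1 + 2 * n\<^sup>2 / q) / s + (t2 + 4 * n ^ 3 / q + 1) / s\<^sup>2 \<le> \<eta>"
  shows "rip k \<eta> (real_matrix (rip_matrix n s E))"
  unfolding rip_def
proof (intro ballI impI)
  fix x :: "real Matrix.vec"
  assume "x \<in> carrier_vec (dim_col (real_matrix (rip_matrix n s E)))" and sp: "sparse k x"
  then have x: "x \<in> carrier_vec (2 * n)" by (simp add: rip_matrix_def)
  define y where "y i = x $ i" for i
  define z where "z i = x $ (n + i)" for i
  let ?S = "{i. i < dim_vec x \<and> x $ i \<noteq> 0}"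
  have "card {i. i < n \<and> y i \<noteq> 0} \<le> card ?S"
    using x by (intro card_mono) (auto simp: y_def)
  moreover have "card {i. i < n \<and> z i \<noteq> 0} \<le> card ?S"
    using x by (intro card_inj_on_le[of "(+) n"]) (auto simp: z_def)
  ultimately have "card {i. i < n \<and> y i \<noteq> 0} \<le> k" "card {i. i < n \<and> z i \<noteq> 0} \<le> k"
    using sp by (auto simp: sparse_def)
  note this[THEN block_square_near_isometry[OF good pos \<eta>, rotated]]
  from this(1)[of 1] this(2)[of "- 1"]
  have "\<bar>block_square 1 n s E y - (\<Sum>i<n. (y i)\<^sup>2)\<bar> \<le> \<eta> * (\<Sum>i<n. (y i)\<^sup>2)"
    "\<bar>block_square (- 1) n s E z - (\<Sum>i<n. (z i)\<^sup>2)\<bar> \<le> \<eta> * (\<Sum>i<n. (z i)\<^sup>2)"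
    by auto
  moreover have "(l2_norm x)\<^sup>2 = (\<Sum>i<n. (y i)\<^sup>2) + (\<Sum>i<n. (z i)\<^sup>2)"
    using x by (simp add: l2_norm_square y_def z_def mult_2 sum_lessThan_add)
  moreover have "(l2_norm (real_matrix (rip_matrix n s E) *\<^sub>v x))\<^sup>2
      = block_square 1 n s E y + block_square (- 1) n s E z"
    unfolding l2_norm_rip_matrix[OF x] y_def z_def ..
  ultimately show "(1 - \<eta>) * (l2_norm x)\<^sup>2 \<le> (l2_norm (real_matrix (rip_matrix n s E) *\<^sub>v x))\<^sup>2 \<and>
      (l2_norm (real_matrix (rip_matrix n s E) *\<^sub>v x))\<^sup>2 \<le> (1 + \<eta>) * (l2_norm x)\<^sup>2"
    by (simp add: algebra_simps abs_le_iff)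
qed

text \<open>Inside a clique every sign is 1 and every unordered pair is selected in exactly one
  orientation, so the form counts the m(m - 1)/2 pairs. The proof adds the transposed sum and uses
  \<open>sel_swap\<close>.\<close>

lemma bilinear_form_clique:
  assumes K: "K \<subseteq> {..<n}" "card K = m" and clique: "\<And>u v. u \<in> K \<Longrightarrow> v \<in> K \<Longrightarrow> u \<noteq> v \<Longrightarrow> {u, v} \<in> E"
  shows "2 * bilinear_form n E (\<lambda>i. of_bool (i \<in> K)) = m * (real m - 1)"
proof -
  have fin: "finite K" using K finite_subset by blast
  have "bilinear_form n E (\<lambda>i. of_bool (i \<in> K))
      = (\<Sum>i<n. \<Sum>j<n. if i \<in> K then if j \<in> K then of_bool (sel i j) else 0 else 0)"
    unfolding bilinear_form_def mul_half_def sum_distrib_left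
  proof (intro sum.cong refl)
    fix i j
    show "of_bool (i \<in> K) * (half_adj E i j * of_bool (j \<in> K))
       = (if i \<in> K then if j \<in> K then of_bool (sel i j) else 0 else (0 :: real))"
      using clique[of i j] by (cases "i = j") (auto simp: half_adj_def sgn_in_def)
  qed
  also have "\<dots> = (\<Sum>i\<in>K. \<Sum>j\<in>K. of_bool (sel i j))"
  proof -
    have *: "(\<Sum>i<n. if i \<in> K then h i else 0) = (\<Sum>i\<in>K. h i)" for h :: "nat \<Rightarrow> real"
      using K by (simp add: Int_absorb1 flip: sum.inter_restrict)
    have "(\<Sum>i<n. \<Sum>j<n. if i \<in> K then if j \<in> K then of_bool (sel i j) else 0 else (0 :: real))
      = (\<Sum>i<n. if i \<in> K then \<Sum>j<n. if j \<in> K then of_bool (sel i j) else 0 else 0)"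
      by (intro sum.cong) auto
    then show ?thesis unfolding * by simp
  qed
  finally have eq: "bilinear_form n E (\<lambda>i. of_bool (i \<in> K)) = (\<Sum>i\<in>K. \<Sum>j\<in>K. of_bool (sel i j))" .
  have "(\<Sum>i\<in>K. \<Sum>j\<in>K. of_bool (sel i j)) + (\<Sum>i\<in>K. \<Sum>j\<in>K. of_bool (sel j i))
      = (\<Sum>i\<in>K. \<Sum>j\<in>K. 1 - of_bool (i = j) :: real)"
    unfolding sum.distrib[symmetric]
  proof (intro sum.cong refl)
    fix i j
    show "of_bool (sel i j) + of_bool (sel j i) = (1 - of_bool (i = j) :: real)"
      using sel_swap[of i j] by (cases "i = j"; cases "sel i j") auto
  qed
  also have "(\<Sum>i\<in>K. \<Sum>j\<in>K. of_bool (sel j i)) = (\<Sum>i\<in>K. \<Sum>j\<in>K. of_bool (sel i j) :: real)"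
    by (rule sum.swap)
  also have "(\<Sum>i\<in>K. \<Sum>j\<in>K. 1 - of_bool (i = j) :: real) = m * (real m - 1)"
    using fin K by (simp add: sum_subtractf of_bool_def)
  finally show ?thesis unfolding eq by simp
qed

text \<open>For the unnormalized indicator the squared norms in the two blocks differ by m(m - 1)/s,
  while both lie within \<delta>m of m, \<delta> being the RIP parameter; so the difference is at
  most 2\<delta>m.\<close>

lemma rip_param_clique:
  assumes "has_clique n E m" "0 < m" "m \<le> k" "0 < s"
  shows "(real m - 1) / (2 * s) \<le> rip_param k (real_matrix (rip_matrix n s E))"
proof -
  obtain K where K: "K \<subseteq> {..<n}" "card K = m" and clique: "\<And>u v. u \<in> K \<Longrightarrow> v \<in> K \<Longrightarrow> u \<noteq> v \<Longrightarrow> {u, v} \<in> E"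
    using assms unfolding has_clique_def by blast
  define f where "f i = (of_bool (i \<in> K) :: real)" for i
  define \<delta> where "\<delta> = rip_param k (real_matrix (rip_matrix n s E))"
  have rip: "rip k \<delta> (real_matrix (rip_matrix n s E))" unfolding \<delta>_def by (rule rip_param_is_least)
  have block0: "block_square \<sigma> n s E (\<lambda>_. 0) = 0" for \<sigma>
    by (simp add: block_square_def mul_half_def)
  have sum_f: "(\<Sum>i<n. (f i)\<^sup>2) = m"
    using K by (simp add: f_def Int_absorb1 of_bool_def if_distrib[of "\<lambda>a. a\<^sup>2"] cong: if_cong
      flip: sum.inter_restrict)
  have main: "\<bar>block_square \<sigma> n s E f - m\<bar> \<le> \<delta> * m" if \<sigma>: "\<sigma> = 1 \<or> \<sigma> = - 1" for \<sigma>
  proof -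
    \<comment> \<open>\<open>g\<close> places the indicator in the first block for \<sigma> = 1 and
      in the second for \<sigma> = -1, with zeros in the other.\<close>
    define g where "g i = (if \<sigma> = 1 then if i < n then f i else 0 else if i < n then 0 else f (i - n))" for i
    define x where "x = Matrix.vec (2 * n) g"
    have x: "x \<in> carrier_vec (2 * n)" by (simp add: x_def)
    have x_nth: "x $ i = (if \<sigma> = 1 then f i else 0)" "x $ (n + i) = (if \<sigma> = 1 then 0 else f i)" if "i < n" for i
      using that by (auto simp: x_def g_def)
    have cong: "block_square \<tau> n s E a = block_square \<tau> n s E b" if "\<And>i. i < n \<Longrightarrow> a i = b i" for \<tau> a b
      using that by (simp add: block_square_def mul_half_def)
    have "card {i. i < dim_vec x \<and> x $ i \<noteq> 0} \<le> card ((if \<sigma> = 1 then id else (+) n) ` K)"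
    proof (intro card_mono)
      show "{i. i < dim_vec x \<and> x $ i \<noteq> 0} \<subseteq> (if \<sigma> = 1 then id else (+) n) ` K"
      proof
        fix i assume "i \<in> {i. i < dim_vec x \<and> x $ i \<noteq> 0}"
        then have "g i \<noteq> 0" by (auto simp: x_def)
        then show "i \<in> (if \<sigma> = 1 then id else (+) n) ` K"
          by (auto simp: g_def f_def image_iff split: if_splits intro!: bexI[of _ "i - n"])
      qed
    qed (use K finite_subset in auto)
    also have "\<dots> \<le> card K" using K finite_subset by (intro card_image_le) blast
    finally have sp: "sparse k x" using K assms by (simp add: sparse_def)
    have nx: "(l2_norm x)\<^sup>2 = m"
    proof -
      have "(l2_norm x)\<^sup>2 = (\<Sum>i<n. (x $ i)\<^sup>2) + (\<Sum>i<n. (x $ (n + i))\<^sup>2)"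
        using x by (simp add: l2_norm_square mult_2 sum_lessThan_add)
      also have "\<dots> = m" using \<sigma> sum_f by (auto simp: x_nth)
      finally show ?thesis .
    qed
    have "(l2_norm (real_matrix (rip_matrix n s E) *\<^sub>v x))\<^sup>2 = block_square \<sigma> n s E f"
    proof (cases "\<sigma> = 1")
      case True
      then have "block_square 1 n s E (\<lambda>i. x $ i) = block_square \<sigma> n s E f"
        "block_square (- 1) n s E (\<lambda>i. x $ (n + i)) = block_square (- 1) n s E (\<lambda>_. 0)"
        by (auto intro!: cong simp: x_nth)
      then show ?thesis unfolding l2_norm_rip_matrix[OF x] by (simp add: block0)
    next
      case False
      then have "block_square 1 n s E (\<lambda>i. x $ i) = block_square 1 n s E (\<lambda>_. 0)"
        "block_square (- 1) n s E (\<lambda>i. x $ (n + i)) = block_square \<sigma> n s E f"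
        using \<sigma> by (auto intro!: cong simp: x_nth)
      then show ?thesis unfolding l2_norm_rip_matrix[OF x] by (simp add: block0)
    qed
    moreover have "x \<in> carrier_vec (dim_col (real_matrix (rip_matrix n s E)))"
      using x by (simp add: rip_matrix_def)
    ultimately show ?thesis
      using rip sp nx unfolding rip_def by (auto simp: abs_le_iff algebra_simps)
  qed
  have "block_square 1 n s E f - block_square (- 1) n s E f = 2 * bilinear_form n E f / s"
    by (simp add: block_square_eq)
  also have "2 * bilinear_form n E f = m * (real m - 1)"
    unfolding f_def using bilinear_form_clique[OF K clique] by simp
  finally have "m * (real m - 1) / s \<le> 2 * (\<delta> * m)"
    using main[of 1] main[of "- 1"] by linarith
  then have "m * ((real m - 1) / s) \<le> m * (2 * \<delta>)" by (simp add: mult_ac)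
  then have "(real m - 1) / s \<le> 2 * \<delta>"
    by (rule mult_left_le_imp_le) (use assms in simp)
  then show ?thesis unfolding \<delta>_def[symmetric] by simp
qed


section \<open>Asymptotics\<close>

lemma graphs_eq: "graphs n = Pow (edges n)"
  by (simp add: graphs_def edges_def)

definition scale :: "nat \<Rightarrow> nat" where
  "scale n = nat \<lfloor>sqrt (2 * n / 3)\<rfloor>"

lemma scale_le: "real (scale n) \<le> sqrt (2 * n / 3)"
  by (simp add: scale_def)

lemma scale_gt: "sqrt (2 * n / 3) < real (scale n) + 1"
 unfolding scale_def using real_of_int_floor_add_one_gt[of "sqrt (2 * real n / 3)"] by simp

text \<open>A comparison in integers, so that a program can find the rounded square root by counting
  upward.\<close>

lemma less_scale_iff: "k < scale n \<longleftrightarrow> 3 * (k + 1)\<^sup>2 \<le> 2 * n"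
proof -
  have "k < scale n \<longleftrightarrow> real (k + 1) \<le> sqrt (2 * real n / 3)"
    using scale_le[of n] scale_gt[of n] by linarith
  also have "\<dots> \<longleftrightarrow> (real (k + 1))\<^sup>2 \<le> 2 * real n / 3"
    using real_sqrt_le_iff[of "(real (k + 1))\<^sup>2" "2 * real n / 3"] by simp
  also have "\<dots> \<longleftrightarrow> real (3 * (k + 1)\<^sup>2) \<le> real (2 * n)"
    by (simp add: field_simps)
  finally show ?thesis by (simp only: of_nat_le_iff)
qed

definition sparsity :: "nat \<Rightarrow> nat" where
  "sparsity n = nat \<lfloor>real (2 * n) powr 0.6\<rfloor>"

text \<open>The grid has exp(O(n^0.6 log n)) points. The deviations t1 = n^0.305 and t2 = n^0.805
  make both tail exponents, t1^2/8 and t2^2/(8n), equal to n^0.61/8, which wins against this number,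
  while t1/s and t2/s^2 are of order n^-0.195 and stay below n^-0.19. The mesh n^-4 makes the
  rounding terms 2 n^2/q and 4 n^3/q negligible.\<close>

definition good_graph :: "nat \<Rightarrow> nat set set \<Rightarrow> bool" where
  "good_graph n = grid_good n (sparsity n) (n ^ 4) (real n powr 0.305) (real n powr 0.805)"

lemma bad_bound_tendsto:
  "((\<lambda>x::real. (x * (2 * x ^ 4 + 1)) powr ((2 * x) powr 0.6) *
      (2 * exp (- ((x powr 0.305)\<^sup>2 / 8)) + 2 * exp (- ((x powr 0.805)\<^sup>2 / (8 * x))))) \<longlongrightarrow> 0) at_top"
proof -
  have "((\<lambda>x::real. 4 * exp ((2 * x) powr 0.6 * ln (x * (2 * x ^ 4 + 1)) - x powr 0.61 / 8)) \<longlongrightarrow> 0) at_top"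
    by real_asymp
  moreover have "\<forall>\<^sub>F x::real in at_top. 4 * exp ((2 * x) powr 0.6 * ln (x * (2 * x ^ 4 + 1)) - x powr 0.61 / 8)
      = (x * (2 * x ^ 4 + 1)) powr ((2 * x) powr 0.6) *
      (2 * exp (- ((x powr 0.305)\<^sup>2 / 8)) + 2 * exp (- ((x powr 0.805)\<^sup>2 / (8 * x))))"
    using eventually_gt_at_top[of 0]
  proof eventually_elim
    case (elim x)
    have 1: "(x powr 0.305)\<^sup>2 = x powr 0.61"
      by (simp add: power2_eq_square flip: powr_add)
    have 2: "(x powr 0.805)\<^sup>2 / (8 * x) = x powr 0.61 / 8"
      using elim powr_add[of x "0.61" 1] by (simp add: power2_eq_square flip: powr_add)
    have "0 < x * (2 * x ^ 4 + 1)" using elim by (intro mult_pos_pos add_nonneg_pos) auto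
    then have 3: "(x * (2 * x ^ 4 + 1)) powr c = exp (c * ln (x * (2 * x ^ 4 + 1)))" for c
      unfolding powr_def by (simp only: if_not_P less_imp_neq[THEN not_sym] not_False_eq_True)
    show ?case unfolding 1 2 3 by (simp only: diff_conv_add_uminus exp_add) simp
  qed
  ultimately show ?thesis by (rule Lim_transform_eventually)
qed

lemma prob_good_graph_tendsto:
  "(\<lambda>n. measure_pmf.prob (random_graph n) {E. good_graph n E}) \<longlonglongrightarrow> 1"
proof -
  define f where "f x = (x * (2 * x ^ 4 + 1)) powr ((2 * x) powr 0.6) *
      (2 * exp (- ((x powr 0.305)\<^sup>2 / 8)) + 2 * exp (- ((x powr 0.805)\<^sup>2 / (8 * x))))" for x :: real
  have "((\<lambda>n::nat. f (real n)) \<longlongrightarrow> 0) at_top"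
    unfolding f_def by (rule filterlim_compose[OF bad_bound_tendsto filterlim_real_sequentially])
  then have lim: "(\<lambda>n::nat. 1 - f (real n)) \<longlonglongrightarrow> 1"
    using tendsto_diff[OF tendsto_const, of "\<lambda>n. f (real n)" 0 sequentially 1] by simp
  have "\<forall>\<^sub>F x::real in at_top. 2 * x powr 0.805 \<le> x" by real_asymp
  then have "\<forall>\<^sub>F n in sequentially. 2 * real n powr 0.805 \<le> real n"
    by (rule eventually_compose_filterlim[OF _ filterlim_real_sequentially])
  then have ge: "\<forall>\<^sub>F n in sequentially. 1 - f (real n) \<le> measure_pmf.prob (random_graph n) {E. good_graph n E}"
    using eventually_gt_at_top[of 0]
  proof eventually_elim
    case (elim n)
    have "real (n * (2 * n ^ 4 + 1)) ^ sparsity n = real (n * (2 * n ^ 4 + 1)) powr sparsity n"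
      using elim by (subst powr_realpow) (auto intro!: add_pos_nonneg)
    also have "\<dots> \<le> real (n * (2 * n ^ 4 + 1)) powr (real (2 * n) powr 0.6)"
    proof (rule powr_mono)
      show "real (sparsity n) \<le> real (2 * n) powr 0.6" by (simp add: sparsity_def)
      have "1 * 1 \<le> n * (2 * n ^ 4 + 1)" using elim by (intro mult_mono) auto
      then show "1 \<le> real (n * (2 * n ^ 4 + 1))" by (metis of_nat_1 of_nat_mono mult_1)
    qed
    finally have pow: "real (n * (2 * n ^ 4 + 1)) ^ sparsity n \<le> (real n * (2 * real n ^ 4 + 1)) powr ((2 * real n) powr 0.6)"
      by (simp only: of_nat_mult of_nat_add of_nat_power of_nat_1 of_nat_numeral)
    have "real (card {E \<in> Pow (edges n). \<not> good_graph n E}) \<le> 2 ^ card (edges n) *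
       (real (n * (2 * n ^ 4 + 1)) ^ sparsity n *
        (2 * exp (- ((real n powr 0.305)\<^sup>2 / 8)) + 2 * exp (- ((real n powr 0.805)\<^sup>2 / (8 * real n)))))"
      unfolding good_graph_def using elim by (intro card_grid_bad) auto
    also have "\<dots> \<le> 2 ^ card (edges n) * f (real n)"
      unfolding f_def using pow by (intro mult_left_mono mult_right_mono add_nonneg_nonneg) auto
    finally have bad: "real (card {E \<in> Pow (edges n). \<not> good_graph n E}) \<le> 2 ^ card (edges n) * f (real n)" .
    have "Pow (edges n) \<inter> {E. good_graph n E} = Pow (edges n) - {E \<in> Pow (edges n). \<not> good_graph n E}"
      by auto
    then have "card (Pow (edges n) \<inter> {E. good_graph n E})
        = 2 ^ card (edges n) - card {E \<in> Pow (edges n). \<not> good_graph n E}"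
      using card_Diff_subset[OF finite_subset[OF Collect_restrict] Collect_restrict, of "Pow (edges n)" "\<lambda>E. \<not> good_graph n E"]
      by (simp add: card_Pow)
    moreover have "card {E \<in> Pow (edges n). \<not> good_graph n E} \<le> card (Pow (edges n))"
      by (intro card_mono) auto
    ultimately have "real (card (Pow (edges n) \<inter> {E. good_graph n E}))
        \<ge> 2 ^ card (edges n) - 2 ^ card (edges n) * f (real n)"
      using bad by (simp add: card_Pow of_nat_diff)
    then have "real (card (Pow (edges n) \<inter> {E. good_graph n E})) / 2 ^ card (edges n)
        \<ge> (2 ^ card (edges n) - 2 ^ card (edges n) * f (real n)) / 2 ^ card (edges n)"
      by (rule divide_right_mono) simp
    also have "(2 ^ card (edges n) - 2 ^ card (edges n) * f (real n)) / 2 ^ card (edges n) = 1 - f (real n)"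
      by (simp add: diff_divide_distrib)
    finally show ?case
      unfolding random_graph_def graphs_eq by (subst measure_pmf_of_set) (auto simp: card_Pow)
  qed
  show ?thesis
    by (rule tendsto_sandwich[OF ge _ lim tendsto_const]) (simp add: measure_pmf.prob_le_1)
qed

text \<open>With r = sqrt(2n/3) the floor s satisfies r - 1 <= s <= r. Replacing s by r - 1 in the
  denominators only increases the terms, once the first is rewritten as 3/4 (r^2/s^2 - 1), and
  leaves an inequality free of floors that compares growth rates.\<close>

lemma isometry_constant_bound:
  "\<forall>\<^sub>F n in sequentially.
     \<bar>1 / 4 + n / (2 * (scale n)\<^sup>2) - 1\<bar> + (real n powr 0.305 + 2 * n\<^sup>2 / (n ^ 4)) / scale n
       + (real n powr 0.805 + 4 * n ^ 3 / (n ^ 4) + 1) / (scale n)\<^sup>2 \<le> real (2 * n) powr (- 0.19)"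
proof -
  have "\<forall>\<^sub>F x::real in at_top. 3 / 4 * ((sqrt (2 * x / 3))\<^sup>2 / (sqrt (2 * x / 3) - 1)\<^sup>2 - 1)
      + (x powr 0.305 + 2 * x\<^sup>2 / x ^ 4) / (sqrt (2 * x / 3) - 1)
      + (x powr 0.805 + 4 * x ^ 3 / x ^ 4 + 1) / (sqrt (2 * x / 3) - 1)\<^sup>2 \<le> (2 * x) powr (- 0.19)"
    by real_asymp
  then have "\<forall>\<^sub>F n in sequentially. 3 / 4 * ((sqrt (2 * real n / 3))\<^sup>2 / (sqrt (2 * real n / 3) - 1)\<^sup>2 - 1)
      + (real n powr 0.305 + 2 * (real n)\<^sup>2 / real n ^ 4) / (sqrt (2 * real n / 3) - 1)
      + (real n powr 0.805 + 4 * real n ^ 3 / real n ^ 4 + 1) / (sqrt (2 * real n / 3) - 1)\<^sup>2 \<le> (2 * real n) powr (- 0.19)"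
    by (rule eventually_compose_filterlim[OF _ filterlim_real_sequentially])
  then show ?thesis
    using eventually_ge_at_top[of 6]
  proof eventually_elim
    case (elim n)
    define r where "r = sqrt (2 * real n / 3)"
    define s where "s = real (scale n)"
    have "2 \<le> r" using elim(2) unfolding r_def by (intro real_le_rsqrt) simp
    have "s \<le> r" "r < s + 1"
      using scale_le[of n] scale_gt[of n] by (simp_all add: r_def s_def)
    then have s: "r - 1 \<le> s" "s \<le> r" "0 < r - 1" "0 < s"
      using \<open>2 \<le> r\<close> by linarith+
    have n: "real n = 3 / 2 * r\<^sup>2" by (simp add: r_def)
    have "s\<^sup>2 \<le> r\<^sup>2" "(r - 1)\<^sup>2 \<le> s\<^sup>2" using s by (auto intro!: power_mono)
    have eq: "1 / 4 + real n / (2 * s\<^sup>2) - 1 = 3 / 4 * (r\<^sup>2 / s\<^sup>2 - 1)"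
      unfolding n by simp
    have "1 \<le> r\<^sup>2 / s\<^sup>2" using \<open>s\<^sup>2 \<le> r\<^sup>2\<close> s by simp
    moreover have "r\<^sup>2 / s\<^sup>2 \<le> r\<^sup>2 / (r - 1)\<^sup>2"
      using \<open>(r - 1)\<^sup>2 \<le> s\<^sup>2\<close> s by (intro divide_left_mono mult_pos_pos) auto
    ultimately have 1: "\<bar>1 / 4 + real n / (2 * s\<^sup>2) - 1\<bar> \<le> 3 / 4 * (r\<^sup>2 / (r - 1)\<^sup>2 - 1)"
      unfolding eq by (simp add: abs_mult)
    have 2: "(real n powr 0.305 + 2 * (real n)\<^sup>2 / real n ^ 4) / s
        \<le> (real n powr 0.305 + 2 * (real n)\<^sup>2 / real n ^ 4) / (r - 1)"
      using s by (intro divide_left_mono mult_pos_pos add_nonneg_nonneg) auto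
    have 3: "(real n powr 0.805 + 4 * real n ^ 3 / real n ^ 4 + 1) / s\<^sup>2
        \<le> (real n powr 0.805 + 4 * real n ^ 3 / real n ^ 4 + 1) / (r - 1)\<^sup>2"
      using s \<open>(r - 1)\<^sup>2 \<le> s\<^sup>2\<close> by (intro divide_left_mono mult_pos_pos add_nonneg_nonneg) auto
    have "\<bar>1 / 4 + real n / (2 * s\<^sup>2) - 1\<bar> + (real n powr 0.305 + 2 * (real n)\<^sup>2 / real n ^ 4) / s
       + (real n powr 0.805 + 4 * real n ^ 3 / real n ^ 4 + 1) / s\<^sup>2 \<le> (2 * real n) powr (- 0.19)"
      using 1 2 3 elim(1)[folded r_def] by linarith
    then show ?case by (simp add: s_def)
  qed
qed

text \<open>A clique of size m about n^(1/3) and s <= sqrt n make (m - 1)/(2s) at least about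
  n^(-1/6)/2, twice the threshold n^(-1/6)/4. This slack absorbs the floor in m and the subtracted
  1; the threshold taken at 2n is smaller still.\<close>

lemma clique_size_bounds:
  "\<forall>\<^sub>F n in sequentially. 0 < nat \<lfloor>real n powr (1 / 2 - 1 / 6)\<rfloor> \<and>
     nat \<lfloor>real n powr (1 / 2 - 1 / 6)\<rfloor> \<le> sparsity n \<and> 0 < scale n \<and>
     real (2 * n) powr (- 1 / 6) / 4 \<le> (real (nat \<lfloor>real n powr (1 / 2 - 1 / 6)\<rfloor>) - 1) / (2 * scale n)"
proof -
  have "\<forall>\<^sub>F x::real in at_top. x powr (- 1 / 6) / 4 \<le> (x powr (1 / 3) - 2) / (2 * sqrt x)"
    by real_asymp
  moreover have "\<forall>\<^sub>F x::real in at_top. x powr (1 / 3) \<le> (2 * x) powr 0.6"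
    by real_asymp
  moreover have "\<forall>\<^sub>F x::real in at_top. 2 \<le> x powr (1 / 3)"
    by real_asymp
  ultimately have "\<forall>\<^sub>F x::real in at_top. x powr (- 1 / 6) / 4 \<le> (x powr (1 / 3) - 2) / (2 * sqrt x) \<and>
      x powr (1 / 3) \<le> (2 * x) powr 0.6 \<and> 2 \<le> x powr (1 / 3)"
    by eventually_elim auto
  then have "\<forall>\<^sub>F n in sequentially. real n powr (- 1 / 6) / 4 \<le> (real n powr (1 / 3) - 2) / (2 * sqrt (real n)) \<and>
      real n powr (1 / 3) \<le> (2 * real n) powr 0.6 \<and> 2 \<le> real n powr (1 / 3)"
    by (rule eventually_compose_filterlim[OF _ filterlim_real_sequentially])
  then show ?thesis
    using eventually_ge_at_top[of 6]
  proof eventually_elim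
    case (elim n)
    define m where "m = nat \<lfloor>real n powr (1 / 3)\<rfloor>"
    have "2 \<le> \<lfloor>real n powr (1 / 3)\<rfloor>" using elim(1) by (simp add: le_floor_iff)
    then have m: "real n powr (1 / 3) - 1 \<le> m" "0 < m" unfolding m_def by linarith+
    have "m \<le> sparsity n" using elim(1) by (auto simp: m_def sparsity_def intro!: nat_mono floor_mono)
    moreover have "0 < scale n" using elim(2) by (simp add: less_scale_iff)
    moreover have "(real n powr (1 / 3) - 2) / (2 * sqrt (real n)) \<le> (real m - 1) / (2 * scale n)"
    proof (rule frac_le)
      have "sqrt (2 * real n / 3) \<le> sqrt (real n)" by simp
      with scale_le[of n] have "real (scale n) \<le> sqrt (real n)" by (rule order_trans)
      then show "real (2 * scale n) \<le> 2 * sqrt (real n)" by simp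
    qed (use m elim(1) \<open>0 < scale n\<close> in auto)
    moreover have "real (2 * n) powr (- 1 / 6) \<le> real n powr (- 1 / 6)"
      using elim(2) by (intro powr_mono2') auto
    ultimately have "m \<le> sparsity n" "0 < scale n"
      "real (2 * n) powr (- 1 / 6) / 4 \<le> (real m - 1) / (2 * scale n)"
      using elim(1) by linarith+
    moreover have "1 / 2 - 1 / 6 = (1 / 3 :: real)" by simp
    ultimately show ?case using m(2) unfolding m_def by metis
  qed
qed


section \<open>Reasoning about programs\<close>

text \<open>Values replace bit lengths in the cost analysis of the reduction. This wastes an
  exponential, but all its registers hold numbers polynomial in n.\<close>

lemma bit_size_le: "bit_size i \<le> nat \<bar>i\<bar> + 1"
proof -
  have "nat \<bar>i\<bar> < 2 ^ nat \<bar>i\<bar>" by (rule less_exp)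
  then have "floorlog 2 (nat \<bar>i\<bar>) \<le> nat \<bar>i\<bar>"
    by (intro floorlog_leI) auto
  then show ?thesis by (simp add: bit_size_def)
qed

lemma bit_size_ge_1: "1 \<le> bit_size i"
  by (simp add: bit_size_def)

text \<open>The product of the two bounds, each increased by 1, dominates sum, difference, product
  and quotient alike, so one clause serves all operations.\<close>

fun val_bound :: "expr \<Rightarrow> nat \<Rightarrow> nat" where
  "val_bound (Const c) b = nat \<bar>c\<bar>"
| "val_bound (Load a e) b = b"
| "val_bound (Op f e1 e2) b = (val_bound e1 b + 1) * (val_bound e2 b + 1)"

fun cost_bound :: "expr \<Rightarrow> nat \<Rightarrow> nat" where
  "cost_bound (Const c) b = bit_size c"
| "cost_bound (Load a e) b = cost_bound e b + (b + 1)"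
| "cost_bound (Op f e1 e2) b = cost_bound e1 b + cost_bound e2 b + (val_bound (Op f e1 e2) b + 1)"

definition store_bound :: "nat \<Rightarrow> store \<Rightarrow> bool" where
  "store_bound b s \<longleftrightarrow> (\<forall>a i. \<bar>s a i\<bar> \<le> int b)"

lemma abs_div_le: "\<bar>x div y\<bar> \<le> \<bar>x\<bar>" for x y :: int
proof -
  have pos: "\<bar>x div y\<bar> \<le> \<bar>x\<bar>" if "0 < y" for x y :: int
  proof (cases "0 \<le> x")
    case True
    then show ?thesis
      using that zdiv_mono2[of x 1 y] by (simp add: pos_imp_zdiv_nonneg_iff)
  next
    case False
    then show ?thesis
      using that zdiv_mono2_neg[of x 1 y] pos_imp_zdiv_neg_iff[of y x] by simp
  qed
  consider "y = 0" | "0 < y" | "0 < - y" by linarith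
  then show ?thesis
    using pos[of y x] pos[of "- y" "- x"] by cases (auto simp: div_minus_right)
qed

lemma abs_val_le:
  assumes "store_bound b s"
  shows "\<bar>val e s\<bar> \<le> int (val_bound e b)"
proof (induction e)
  case (Op f e1 e2)
  have prod: "\<bar>x\<bar> + \<bar>y\<bar> \<le> int ((m + 1) * (n + 1))" "\<bar>x\<bar> * \<bar>y\<bar> \<le> int ((m + 1) * (n + 1))"
    if "\<bar>x\<bar> \<le> int m" "\<bar>y\<bar> \<le> int n" for x y :: int and m n
  proof -
    have "\<bar>x\<bar> * \<bar>y\<bar> \<le> int m * int n" using that by (intro mult_mono) auto
    then show "\<bar>x\<bar> * \<bar>y\<bar> \<le> int ((m + 1) * (n + 1))" by (simp add: algebra_simps)
    have "int ((m + 1) * (n + 1)) = 1 + int m + int n + int m * int n" by (simp add: algebra_simps)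
    moreover have "0 \<le> int m * int n" by simp
    ultimately show "\<bar>x\<bar> + \<bar>y\<bar> \<le> int ((m + 1) * (n + 1))" using that by linarith
  qed
  show ?case
    using prod[OF Op.IH] abs_div_le[of "val e1 s" "val e2 s"]
    by (cases f) (auto simp: abs_mult)
qed (use assms in \<open>auto simp: store_bound_def\<close>)

lemma cost_le:
  assumes "store_bound b s"
  shows "cost e s \<le> cost_bound e b"
proof (induction e)
  case (Load a e)
  have "bit_size (val (Load a e) s) \<le> b + 1"
    using abs_val_le[OF assms, of "Load a e"] by (intro order_trans[OF bit_size_le]) simp
  with Load show ?case by simp
next
  case (Op f e1 e2)
  have "bit_size (val (Op f e1 e2) s) \<le> val_bound (Op f e1 e2) b + 1"
  proof -
    have "nat \<bar>val (Op f e1 e2) s\<bar> \<le> val_bound (Op f e1 e2) b"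
      using abs_val_le[OF assms, of "Op f e1 e2"] by (simp only: nat_le_iff)
    then show ?thesis using bit_size_le[of "val (Op f e1 e2) s"] by linarith
  qed
  with Op show ?case by (simp only: cost.simps cost_bound.simps)
qed simp

definition runs :: "prog \<Rightarrow> store \<Rightarrow> nat \<Rightarrow> (store \<Rightarrow> bool) \<Rightarrow> bool" where
  "runs P s T Q \<longleftrightarrow> (\<exists>t s'. exec P s t s' \<and> t \<le> T \<and> Q s')"

lemma runs_mono:
  assumes "runs P s T Q" "T \<le> T'" "\<And>s'. Q s' \<Longrightarrow> Q' s'"
  shows "runs P s T' Q'"
  using assms unfolding runs_def by (meson order_trans)

lemma runs_Seq:
  assumes "runs P s T Q" "\<And>s'. Q s' \<Longrightarrow> runs P' s' T' Q'"
  shows "runs (Seq P P') s (T + T') Q'"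
  using assms unfolding runs_def by (meson add_mono exec_Seq)

lemma runs_Assign:
  assumes "store_bound b s" "Q (s(a := (s a)(val e1 s := val e2 s)))"
  shows "runs (Assign a e1 e2) s (cost_bound e1 b + cost_bound e2 b) Q"
  unfolding runs_def using assms exec_Assign cost_le[OF assms(1)] by (meson add_mono)

text \<open>For loops with a known number K of iterations: indexing the invariant by the iteration
  takes the place of a termination measure. The guard is evaluated K + 1 times, and the budget
  charges a body for each evaluation.\<close>

lemma runs_While:
  assumes body: "\<And>k s. k < K \<Longrightarrow> I k s \<Longrightarrow> 0 < val e s \<and> runs P s T (I (Suc k))"
    and exit: "\<And>s. I K s \<Longrightarrow> val e s \<le> 0"
    and bound: "\<And>k s. I k s \<Longrightarrow> store_bound b s"
    and init: "I 0 s"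
  shows "runs (While e P) s (Suc K * (cost_bound e b + T)) (I K)"
proof -
  let ?C = "cost_bound e b"
  have "runs (While e P) s (Suc d * (?C + T)) (I K)" if "I k s" "k + d = K" for k d s
    using that
  proof (induction d arbitrary: k s)
    case 0
    then have "exec (While e P) s (cost e s) s" "cost e s \<le> Suc 0 * (?C + T)" "I K s"
      using exit[of s] cost_le[OF bound[OF 0(1)], of e] by (auto intro: exec_WhileFalse)
    then show ?case unfolding runs_def by blast
  next
    case (Suc d)
    then have "k < K" by simp
    from body[OF this Suc.prems(1)] obtain t s' where
      s': "0 < val e s" "exec P s t s'" "t \<le> T" "I (Suc k) s'"
      unfolding runs_def by blast
    from Suc.IH[OF s'(4)] Suc.prems obtain t' s'' where
      s'': "exec (While e P) s' t' s''" "t' \<le> Suc d * (?C + T)" "I K s''"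
      unfolding runs_def by auto
    have "exec (While e P) s (cost e s + t + t') s''"
      using s' s'' by (intro exec_WhileTrue)
    moreover have "cost e s + t + t' \<le> Suc (Suc d) * (?C + T)"
      using cost_le[OF bound[OF Suc.prems(1)], of e] s'(3) s''(2) by simp
    ultimately show ?case using s''(3) unfolding runs_def by blast
  qed
  from this[OF init] show ?thesis by simp
qed

section \<open>Dependence of programs on the arrays they mention\<close>

fun expr_names :: "expr \<Rightarrow> string set" where
  "expr_names (Const c) = {}"
| "expr_names (Load a e) = insert a (expr_names e)"
| "expr_names (Op f e1 e2) = expr_names e1 \<union> expr_names e2"

fun prog_names :: "prog \<Rightarrow> string set" where
  "prog_names Skip = {}"
| "prog_names (Assign a e1 e2) = insert a (expr_names e1 \<union> expr_names e2)"
| "prog_names (Seq P Q) = prog_names P \<union> prog_names Q"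
| "prog_names (Cond e P Q) = expr_names e \<union> prog_names P \<union> prog_names Q"
| "prog_names (While e P) = expr_names e \<union> prog_names P"

lemma finite_expr_names: "finite (expr_names e)"
  by (induction e) auto

lemma finite_prog_names: "finite (prog_names P)"
  by (induction P) (auto simp: finite_expr_names)

lemma val_cost_agree:
  assumes "\<And>a. a \<in> A \<Longrightarrow> s a = u a" "expr_names e \<subseteq> A"
  shows "val e u = val e s \<and> cost e u = cost e s"
  using assms(2) by (induction e) (auto simp: assms(1))

text \<open>A program cannot see arrays that it does not mention. The assumed algorithm therefore
  runs in the store left by the reduction, with its auxiliary arrays still filled, as it would in a
  fresh one.\<close>

lemma exec_agree:
  assumes "exec P s t s'" "prog_names P \<subseteq> A" "\<And>a. a \<in> A \<Longrightarrow> s a = u a"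
  shows "\<exists>u'. exec P u t u' \<and> (\<forall>a\<in>A. s' a = u' a)"
  using assms
proof (induction arbitrary: u rule: exec.induct)
  case (exec_Skip s)
  then show ?case using exec.exec_Skip by blast
next
  case (exec_Assign a e1 e2 s)
  then have "val e1 u = val e1 s \<and> cost e1 u = cost e1 s" "val e2 u = val e2 s \<and> cost e2 u = cost e2 s"
    by (auto intro!: val_cost_agree[of A])
  then have "exec (Assign a e1 e2) u (cost e1 s + cost e2 s) (u(a := (u a)(val e1 s := val e2 s)))"
    using exec.exec_Assign[of a e1 e2 u] by simp
  then show ?case using exec_Assign by (intro exI conjI) auto
next
  case (exec_Seq P s t s' Q t' s'')
  from exec_Seq.IH(1)[of u] exec_Seq.prems obtain u' where
    u': "exec P u t u'" "\<forall>a\<in>A. s' a = u' a" by auto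
  from exec_Seq.IH(2)[of u'] exec_Seq.prems u' obtain u'' where
    "exec Q u' t' u''" "\<forall>a\<in>A. s'' a = u'' a" by auto
  with u' show ?case using exec.exec_Seq by blast
next
  case (exec_CondTrue e s P t s' Q)
  then have "val e u = val e s \<and> cost e u = cost e s" by (auto intro!: val_cost_agree[of A])
  moreover from exec_CondTrue.IH[of u] exec_CondTrue.prems obtain u' where
    "exec P u t u'" "\<forall>a\<in>A. s' a = u' a" by auto
  ultimately show ?case using exec.exec_CondTrue[of e u P t u' Q] exec_CondTrue.hyps by auto
next
  case (exec_CondFalse e s Q t s' P)
  then have "val e u = val e s \<and> cost e u = cost e s" by (auto intro!: val_cost_agree[of A])
  moreover from exec_CondFalse.IH[of u] exec_CondFalse.prems obtain u' where
    "exec Q u t u'" "\<forall>a\<in>A. s' a = u' a" by auto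
  ultimately show ?case using exec.exec_CondFalse[of e u Q t u' P] exec_CondFalse.hyps by auto
next
  case (exec_WhileTrue e s P t s' t' s'')
  then have e: "val e u = val e s \<and> cost e u = cost e s" by (auto intro!: val_cost_agree[of A])
  from exec_WhileTrue.IH(1)[of u] exec_WhileTrue.prems obtain u' where
    u': "exec P u t u'" "\<forall>a\<in>A. s' a = u' a" by auto
  from exec_WhileTrue.IH(2)[of u'] exec_WhileTrue.prems u' obtain u'' where
    "exec (While e P) u' t' u''" "\<forall>a\<in>A. s'' a = u'' a" by auto
  with u' e show ?case
    using exec.exec_WhileTrue[of e u P t u' t' u''] exec_WhileTrue.hyps by auto
next
  case (exec_WhileFalse e s P)
  then have "val e u = val e s \<and> cost e u = cost e s" by (auto intro!: val_cost_agree[of A])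
  then show ?case using exec.exec_WhileFalse[of e u P] exec_WhileFalse by auto
qed

lemma cost_ge_bit_size: "bit_size (val e s) \<le> cost e s"
  by (cases e) auto

text \<open>Writing a number takes at least its bit length in time. This bounds the cost of reading
  the answer of an arbitrary program.\<close>

lemma exec_bit_size_le:
  assumes "exec P s t s'"
  shows "bit_size (s' a i) \<le> bit_size (s a i) + t"
  using assms
proof (induction rule: exec.induct)
  case (exec_Assign a' e1 e2 s)
  then show ?case using cost_ge_bit_size[of e2 s] by (auto simp: trans_le_add2 trans_le_add1)
qed auto

section \<open>Polynomially bounded functions\<close>

definition poly_bounded :: "(nat \<Rightarrow> nat) \<Rightarrow> bool" where
  "poly_bounded f \<longleftrightarrow> (\<exists>p :: nat poly. \<forall>n. f n \<le> poly p n)"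

lemma poly_boundedI: "(\<And>n. f n \<le> poly p n) \<Longrightarrow> poly_bounded f" for p :: "nat poly"
  unfolding poly_bounded_def by blast

lemma poly_nat_mono: "m \<le> n \<Longrightarrow> poly p m \<le> poly p n" for p :: "nat poly"
  by (induction p) (auto intro!: mult_mono)

lemma poly_bounded_const [intro]: "poly_bounded (\<lambda>n. c)"
  by (rule poly_boundedI[of _ "[:c:]"]) simp

lemma poly_bounded_id [intro]: "poly_bounded (\<lambda>n. n)"
  by (rule poly_boundedI[of _ "[:0, 1:]"]) simp

lemma poly_bounded_add [intro]:
  assumes "poly_bounded f" "poly_bounded g"
  shows "poly_bounded (\<lambda>n. f n + g n)"
proof -
  from assms obtain p q :: "nat poly" where "\<And>n. f n \<le> poly p n" "\<And>n. g n \<le> poly q n"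
    unfolding poly_bounded_def by blast
  then show ?thesis by (intro poly_boundedI[of _ "p + q"]) (simp add: add_mono)
qed

lemma poly_bounded_Suc [intro]: "poly_bounded f \<Longrightarrow> poly_bounded (\<lambda>n. Suc (f n))"
  using poly_bounded_add[of f "\<lambda>n. 1"] by auto

lemma poly_bounded_mult [intro]:
  assumes "poly_bounded f" "poly_bounded g"
  shows "poly_bounded (\<lambda>n. f n * g n)"
proof -
  from assms obtain p q :: "nat poly" where "\<And>n. f n \<le> poly p n" "\<And>n. g n \<le> poly q n"
    unfolding poly_bounded_def by blast
  then show ?thesis by (intro poly_boundedI[of _ "p * q"]) (simp add: mult_mono)
qed

lemma poly_bounded_poly [intro]:
  assumes "poly_bounded f"
  shows "poly_bounded (\<lambda>n. poly p (f n))"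
proof -
  from assms obtain q :: "nat poly" where "\<And>n. f n \<le> poly q n"
    unfolding poly_bounded_def by blast
  then show ?thesis by (intro poly_boundedI[of _ "pcompose p q"]) (simp add: poly_pcompose poly_nat_mono)
qed

lemma poly_bounded_val_bound [intro]:
  assumes "poly_bounded f"
  shows "poly_bounded (\<lambda>n. val_bound e (f n))"
proof (induction e)
  case (Op g e1 e2)
  then show ?case unfolding val_bound.simps by (intro poly_bounded_mult poly_bounded_add poly_bounded_const)
qed (use assms in auto)

lemma poly_bounded_cost_bound [intro]:
  assumes "poly_bounded f"
  shows "poly_bounded (\<lambda>n. cost_bound e (f n))"
proof (induction e)
  case (Load a e)
  then show ?case unfolding cost_bound.simps by (intro poly_bounded_add poly_bounded_const assms)
next
  case (Op g e1 e2)
  then show ?case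
    unfolding cost_bound.simps by (intro poly_bounded_add poly_bounded_const poly_bounded_val_bound assms)
qed auto


section \<open>The program of the reduction\<close>

text \<open>Row-major order through a single counter: the program fills the matrix in one loop,
  where the encoding has two nested comprehensions.\<close>

lemma concat_map_upt:
  "concat (map (\<lambda>i. map (\<lambda>j. h i j) [0..<c]) [0..<r]) = map (\<lambda>k. h (k div c) (k mod c)) [0..<r * c]"
proof (induction r)
  case (Suc r)
  have "[0..<Suc r * c] = [0..<r * c] @ map (\<lambda>j. j + r * c) [0..<c]"
    using upt_add_eq_append[of 0 "r * c" c] by (simp add: map_add_upt add.commute)
  moreover have "map ((\<lambda>k. h (k div c) (k mod c)) \<circ> (\<lambda>j. j + r * c)) [0..<c] = map (\<lambda>j. h r j) [0..<c]"
    by (intro map_cong) auto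
  ultimately show ?case using Suc by simp
qed simp

lemma concat_map_pairs:
  "length (concat (map (\<lambda>k. [a k, b k]) [0..<m])) = 2 * m"
  "k < m \<Longrightarrow> concat (map (\<lambda>k. [a k, b k]) [0..<m]) ! (2 * k) = a k"
  "k < m \<Longrightarrow> concat (map (\<lambda>k. [a k, b k]) [0..<m]) ! (2 * k + 1) = b k"
proof (induction m)
  case (Suc m)
  have len: "length (concat (map (\<lambda>k. [a k, b k]) [0..<m])) = 2 * m" by (rule Suc.IH(1))
  { case 1 then show ?case using len by simp }
  { case 2 then show ?case using len Suc.IH(2) by (cases "k = m") (auto simp: nth_append) }
  { case 3 then show ?case using len Suc.IH(3) by (cases "k = m") (auto simp: nth_append) }
qed auto

lemma encode_graph_eq:
  "encode_graph n E = int n # map (\<lambda>k. if {k div n, k mod n} \<in> E then 1 else 0) [0..<n * n]"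
  unfolding encode_graph_def concat_map_upt ..

lemma encode_matrix_nth:
  assumes "\<Phi> \<in> carrier_mat N N"
  shows "length (encode_matrix \<Phi>) = 2 * (N * N) + 1" "encode_matrix \<Phi> ! 0 = int N"
    "k < N * N \<Longrightarrow> encode_matrix \<Phi> ! (2 * k + 1) = fst (quotient_of (\<Phi> $$ (k div N, k mod N)))"
    "k < N * N \<Longrightarrow> encode_matrix \<Phi> ! (2 * k + 2) = snd (quotient_of (\<Phi> $$ (k div N, k mod N)))"
proof -
  have dim: "dim_row \<Phi> = N" "dim_col \<Phi> = N" using assms by auto
  have eq: "encode_matrix \<Phi> = int N # concat (map (\<lambda>k. [fst (quotient_of (\<Phi> $$ (k div N, k mod N))),
      snd (quotient_of (\<Phi> $$ (k div N, k mod N)))]) [0..<N * N])"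
    unfolding encode_matrix_def dim concat_map_upt ..
  show "length (encode_matrix \<Phi>) = 2 * (N * N) + 1" "encode_matrix \<Phi> ! 0 = int N"
    unfolding eq by (simp_all add: concat_map_pairs(1) del: length_concat)
  show "encode_matrix \<Phi> ! (2 * k + 1) = fst (quotient_of (\<Phi> $$ (k div N, k mod N)))" if "k < N * N"
    unfolding eq using concat_map_pairs(2)[OF that] by (simp del: upt_Suc)
  show "encode_matrix \<Phi> ! (2 * k + 2) = snd (quotient_of (\<Phi> $$ (k div N, k mod N)))" if "k < N * N"
    unfolding eq using concat_map_pairs(3)[OF that] by (simp del: upt_Suc)
qed

lemma quotient_of_div_coprime:
  "0 < q \<Longrightarrow> coprime p q \<Longrightarrow> quotient_of (of_int p / of_int q) = (p, q)"
  by (simp add: Fract_of_int_quotient[symmetric] quotient_of_Fract normalize_stable)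

text \<open>With numerators 0, 1 and -1 the fractions are already in lowest terms, so the program
  can write them without computing a gcd.\<close>

lemma quotient_of_rip_matrix:
  assumes "i < 2 * n" "j < 2 * n" "0 < s"
  shows "quotient_of (rip_matrix n s E $$ (i, j)) =
    (if i = j then (1, 2)
     else if i div n = j div n \<and> sel i j
       then ((if {i mod n, j mod n} \<in> E then 1 else - 1) * (if i < n then 1 else - 1), int s)
     else (0, 1))"
proof -
  have "quotient_of (1 / 2) = (1, 2)" using quotient_of_div_coprime[of 2 1] by simp
  moreover have "quotient_of (1 / of_nat s) = (1, int s)" "quotient_of (- (1 / of_nat s)) = (- 1, int s)"
    using quotient_of_div_coprime[of "int s" 1] quotient_of_div_coprime[of "int s" "- 1"] assms by auto
  ultimately show ?thesis
    using assms by (auto simp: rip_matrix_def)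
qed

section \<open>Remainders and comparisons as arithmetic expressions\<close>

definition mod_expr :: "expr \<Rightarrow> expr \<Rightarrow> expr" where
  "mod_expr a b = Op Sub a (Op Mul b (Op Div a b))"

text \<open>Dividing 1 by one plus the squared difference gives 1 if the difference is 0, and 0
  otherwise. Such indicator values allow each matrix entry to be computed by a single expression,
  without branching.\<close>

definition eq_expr :: "expr \<Rightarrow> expr \<Rightarrow> expr" where
  "eq_expr a b = Op Div (Const 1) (Op Add (Const 1) (Op Mul (Op Sub a b) (Op Sub a b)))"

text \<open>The quotient is \<open>-1\<close> if the difference is negative and 0 otherwise.\<close>

definition less_expr :: "expr \<Rightarrow> expr \<Rightarrow> expr" where
  "less_expr a b = Op Sub (Const 0)
     (Op Div (Op Sub a b) (Op Add (Const 1) (Op Mul (Op Sub a b) (Op Sub a b))))"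

lemma val_mod_expr [simp]: "val (mod_expr a b) s = val a s mod val b s"
  by (simp add: mod_expr_def minus_mult_div_eq_mod)

lemma val_eq_expr [simp]: "val (eq_expr a b) s = of_bool (val a s = val b s)"
proof -
  have "1 div (1 + x * x) = of_bool (x = 0)" for x :: int
  proof (cases "x = 0")
    case False
    then have "0 < x * x" by (auto simp: zero_less_mult_iff neq_iff)
    with False show ?thesis by (simp add: div_pos_pos_trivial)
  qed simp
  then show ?thesis by (simp add: eq_expr_def)
qed

lemma val_less_expr [simp]: "val (less_expr a b) s = of_bool (val a s < val b s)"
proof -
  have "x div (1 + x * x) = - of_bool (x < 0)" for x :: int
  proof -
    have "\<bar>x\<bar> * 1 \<le> \<bar>x\<bar> * \<bar>x\<bar>" 
      by (cases "x = 0") (use mult_left_mono[of 1 "\<bar>x\<bar>" "\<bar>x\<bar>"] in auto)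
    then have "\<bar>x\<bar> < 1 + x * x" by simp
    then show ?thesis
      using int_div_pos_eq[of x "1 + x * x" "- 1" "x + 1 + x * x"]
      by (cases "x < 0") (auto simp: div_pos_pos_trivial)
  qed
  then show ?thesis by (simp add: less_expr_def)
qed


text \<open>The arithmetic of \<open>num_expr\<close> and \<open>den_expr\<close>, separated from
  their syntax. For bits a and b, a + b - 2ab is their exclusive or, which turns \<open>flag\<close>
  into the indicator of a selected position inside a block. On the diagonal \<open>flag\<close> is
  0, and \<open>of_bool (i = j)\<close> alone produces 1/2.\<close>

lemma val_fill:
  fixes n s k :: nat
  assumes k: "k < (2 * n) * (2 * n)" and s: "0 < s"
    and G: "\<And>i. i < n * n \<Longrightarrow> G (int i) = (if {i div n, i mod n} \<in> E then 1 else 0 :: int)"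
  defines "i \<equiv> int k div (2 * int n)" and "j \<equiv> int k mod (2 * int n)"
  defines "flag \<equiv> (of_bool (i < j) + (i + j) mod 2 - 2 * (of_bool (i < j) * ((i + j) mod 2)))
      * of_bool (i div int n = j div int n) :: int"
  defines "q \<equiv> quotient_of (rip_matrix n s E $$ (k div (2 * n), k mod (2 * n)))"
  shows "flag * (2 * G (i mod int n * int n + j mod int n) - 1) * (1 - 2 * (i div int n)) + of_bool (i = j) = fst q"
    and "1 + flag * (int s - 1) + of_bool (i = j) = snd q"
proof -
  define a where "a = k div (2 * n)"
  define b where "b = k mod (2 * n)"
  have n: "0 < n" using k by (cases n) auto
  have ab: "i = int a" "j = int b"
    by (auto simp: i_def j_def a_def b_def zdiv_int zmod_int)
  have lt: "a < 2 * n" "b < 2 * n"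
    using k n by (auto simp: a_def b_def less_mult_imp_div_less)
  have idx: "a mod n * n + b mod n < n * n"
  proof -
    have "a mod n * n + b mod n < a mod n * n + n" using n by simp
    also have "\<dots> = (a mod n + 1) * n" by simp
    also have "\<dots> \<le> n * n" using mod_less_divisor[OF n, of a] by (intro mult_right_mono) auto
    finally show ?thesis .
  qed
  have edge: "G (i mod int n * int n + j mod int n) = (if {a mod n, b mod n} \<in> E then 1 else 0)"
    using G[OF idx] n by (simp add: ab flip: zmod_int of_nat_mult of_nat_add)
  have flag: "flag = of_bool (a div n = b div n \<and> sel a b)"
  proof -
    have "(i + j) mod 2 = of_bool (odd (a + b))"
      unfolding ab by (simp add: mod_2_eq_odd flip: of_nat_add)
    moreover have "i div int n = j div int n \<longleftrightarrow> a div n = b div n"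
      unfolding ab by (simp flip: zdiv_int)
    moreover have "i < j \<longleftrightarrow> a < b" by (simp add: ab)
    ultimately show ?thesis
      by (cases "a < b"; cases "even (a + b)") (simp_all add: flag_def sel_def)
  qed
  have sign: "1 - 2 * (i div int n) = (if a < n then 1 else - 1)"
  proof -
    have "a div n = (if a < n then 0 else 1)"
      using lt n by (auto simp: div_nat_eqI)
    then have "i div int n = (if a < n then 0 else 1)"
      unfolding ab by (simp flip: zdiv_int)
    then show ?thesis by simp
  qed
  have q: "q = (if a = b then (1, 2)
     else if a div n = b div n \<and> sel a b
       then ((if {a mod n, b mod n} \<in> E then 1 else - 1) * (if a < n then 1 else - 1), int s)
     else (0, 1))"
    unfolding q_def a_def[symmetric] b_def[symmetric] using lt s by (rule quotient_of_rip_matrix)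
  show "flag * (2 * G (i mod int n * int n + j mod int n) - 1) * (1 - 2 * (i div int n)) + of_bool (i = j) = fst q"
    unfolding q edge flag sign unfolding ab by auto
  show "1 + flag * (int s - 1) + of_bool (i = j) = snd q"
    unfolding q flag unfolding ab by auto
qed

definition var :: "string \<Rightarrow> int \<Rightarrow> expr" where
  "var v i = Load v (Const i)"

lemma val_var [simp]: "val (var v i) s = s v i"
  by (simp add: var_def)

text \<open>Register 0 of the array \<open>v\<close> contains \<open>n\<close>, register 1 counts the copied entries of the adjacency
  matrix, register 2 contains the scaling factor, and register 3 counts the matrix entries that have
  been written. The array \<open>g\<close> contains the adjacency matrix.\<close>

definition row_expr :: "string \<Rightarrow> expr" where
  "row_expr v = Op Div (var v 3) (Op Mul (Const 2) (var v 0))"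

definition col_expr :: "string \<Rightarrow> expr" where
  "col_expr v = mod_expr (var v 3) (Op Mul (Const 2) (var v 0))"

text \<open>The first factor is the exclusive or of \<open>i < j\<close> and \<open>odd (i + j)\<close>.\<close>

definition flag_expr :: "string \<Rightarrow> expr" where
  "flag_expr v = Op Mul
     (Op Sub
       (Op Add (less_expr (row_expr v) (col_expr v)) (mod_expr (Op Add (row_expr v) (col_expr v)) (Const 2)))
       (Op Mul (Const 2) (Op Mul (less_expr (row_expr v) (col_expr v))
          (mod_expr (Op Add (row_expr v) (col_expr v)) (Const 2)))))
     (eq_expr (Op Div (row_expr v) (var v 0)) (Op Div (col_expr v) (var v 0)))"

definition num_expr :: "string \<Rightarrow> string \<Rightarrow> expr" where
  "num_expr v g = Op Add
     (Op Mul
       (Op Mul (flag_expr v)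
         (Op Sub (Op Mul (Const 2) (Load g (Op Add (Op Mul (mod_expr (row_expr v) (var v 0)) (var v 0))
            (mod_expr (col_expr v) (var v 0))))) (Const 1)))
       (Op Sub (Const 1) (Op Mul (Const 2) (Op Div (row_expr v) (var v 0)))))
     (eq_expr (row_expr v) (col_expr v))"

definition den_expr :: "string \<Rightarrow> expr" where
  "den_expr v = Op Add
     (Op Add (Const 1) (Op Mul (flag_expr v) (Op Sub (var v 2) (Const 1))))
     (eq_expr (row_expr v) (col_expr v))"

lemma val_num_den_expr:
  fixes n s k :: nat
  assumes "k < (2 * n) * (2 * n)" "0 < s"
    and "u v 0 = int n" "u v 2 = int s" "u v 3 = int k"
    and "\<And>i. i < n * n \<Longrightarrow> u g (int i) = (if {i div n, i mod n} \<in> E then 1 else 0)"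
  shows "val (num_expr v g) u = fst (quotient_of (rip_matrix n s E $$ (k div (2 * n), k mod (2 * n))))"
    and "val (den_expr v) u = snd (quotient_of (rip_matrix n s E $$ (k div (2 * n), k mod (2 * n))))"
  using val_fill[of k n s "u g" E, OF assms(1,2,6)]
  by (simp_all add: num_expr_def den_expr_def flag_expr_def row_expr_def col_expr_def assms(3-5))

definition copy_test :: "string \<Rightarrow> expr" where
  "copy_test v = Op Sub (Op Mul (var v 0) (var v 0)) (var v 1)"

text \<open>Positive exactly if 3(k + 1)^2 <= 2n for the candidate k in register 2; the added 1
  turns the weak inequality into the strict test of a loop.\<close>

definition root_test :: "string \<Rightarrow> expr" where
  "root_test v = Op Add (Op Sub (Op Mul (Const 2) (var v 0))
     (Op Mul (Const 3) (Op Mul (Op Add (var v 2) (Const 1)) (Op Add (var v 2) (Const 1))))) (Const 1)"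

definition fill_test :: "string \<Rightarrow> expr" where
  "fill_test v = Op Sub (Op Mul (Op Mul (Const 2) (var v 0)) (Op Mul (Const 2) (var v 0))) (var v 3)"

definition incr :: "string \<Rightarrow> int \<Rightarrow> prog" where
  "incr v i = Assign v (Const i) (Op Add (var v i) (Const 1))"

definition copy_body :: "string \<Rightarrow> string \<Rightarrow> prog" where
  "copy_body v g = Seq (Assign g (var v 1) (Load ''in'' (Op Add (var v 1) (Const 1)))) (incr v 1)"

definition fill_body :: "string \<Rightarrow> string \<Rightarrow> prog" where
  "fill_body v g = Seq (Assign ''in'' (Op Add (Op Mul (Const 2) (var v 3)) (Const 1)) (num_expr v g))
     (Seq (Assign ''in'' (Op Add (Op Mul (Const 2) (var v 3)) (Const 2)) (den_expr v)) (incr v 3))"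

text \<open>The matrix is written over the array that holds the graph, because the assumed algorithm
  expects its input there; the adjacency matrix is therefore saved in \<open>g\<close>
  beforehand.\<close>

definition reduction_prog :: "string \<Rightarrow> string \<Rightarrow> prog" where
  "reduction_prog v g =
     Seq (Assign v (Const 0) (var ''in'' 0))
    (Seq (While (copy_test v) (copy_body v g))
    (Seq (While (root_test v) (incr v 2))
    (Seq (Assign ''in'' (Const 0) (Op Mul (Const 2) (var v 0)))
         (While (fill_test v) (fill_body v g)))))"

definition value_bound :: "nat \<Rightarrow> nat" where
  "value_bound n = 4 * (n * n) + 2"

text \<open>Mirrors the nesting of \<open>runs_Seq\<close> and \<open>runs_While\<close> along
  \<open>reduction_prog\<close>, so that the rules apply without rearranging sums. The root search
  is charged n + 1 rounds instead of \<open>scale n + 1\<close>.\<close>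

definition reduction_time :: "string \<Rightarrow> string \<Rightarrow> nat \<Rightarrow> nat" where
  "reduction_time v g n = (let c = (\<lambda>e. cost_bound e (value_bound n)) in
     (c (Const 0) + c (var ''in'' 0))
   + (Suc (n * n) * (c (copy_test v) + ((c (var v 1) + c (Load ''in'' (Op Add (var v 1) (Const 1))))
        + (c (Const 1) + c (Op Add (var v 1) (Const 1)))))
   + (Suc n * (c (root_test v) + (c (Const 2) + c (Op Add (var v 2) (Const 1))))
   + ((c (Const 0) + c (Op Mul (Const 2) (var v 0)))
   + (Suc (2 * n * (2 * n)) * (c (fill_test v) +
        ((c (Op Add (Op Mul (Const 2) (var v 3)) (Const 1)) + c (num_expr v g))
        + ((c (Op Add (Op Mul (Const 2) (var v 3)) (Const 2)) + c (den_expr v))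
        + (c (Const 3) + c (Op Add (var v 3) (Const 1)))))))))))"

lemma poly_bounded_reduction_time: "poly_bounded (reduction_time v g)"
proof -
  have "poly_bounded value_bound"
    unfolding value_bound_def by (intro poly_bounded_add poly_bounded_mult poly_bounded_const poly_bounded_id)
  then show ?thesis
    unfolding reduction_time_def Let_def
    by (intro poly_bounded_add poly_bounded_mult poly_bounded_Suc poly_bounded_const poly_bounded_id
        poly_bounded_cost_bound)
qed

lemma store_bound_upd:
  "store_bound b s \<Longrightarrow> (\<And>i. \<bar>h i\<bar> \<le> int b) \<Longrightarrow> store_bound b (s(a := h))"
  by (auto simp: store_bound_def)

lemma scale_le_self: "scale n \<le> n"
proof (cases "n = 0")
  case False
  have "\<not> n < scale n"
    using False by (simp add: less_scale_iff power2_eq_square)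
  then show ?thesis by simp
qed (simp add: scale_def)

lemma encode_rip_matrix_nth:
  fixes n s :: nat and E
  defines "ys \<equiv> encode_matrix (rip_matrix n s E)"
  shows "length ys = 2 * (2 * n * (2 * n)) + 1" "ys ! 0 = 2 * int n"
    "k < 2 * n * (2 * n) \<Longrightarrow> ys ! (2 * k + 1) = fst (quotient_of (rip_matrix n s E $$ (k div (2 * n), k mod (2 * n))))"
    "k < 2 * n * (2 * n) \<Longrightarrow> ys ! (2 * k + 2) = snd (quotient_of (rip_matrix n s E $$ (k div (2 * n), k mod (2 * n))))"
proof -
  note enc = encode_matrix_nth[OF rip_matrix_carrier[of n s E], folded ys_def]
  show "length ys = 2 * (2 * n * (2 * n)) + 1" by (rule enc(1))
  show "ys ! 0 = 2 * int n" using enc(2) by simp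
  show "ys ! (2 * k + 1) = fst (quotient_of (rip_matrix n s E $$ (k div (2 * n), k mod (2 * n))))"
    if "k < 2 * n * (2 * n)" using that by (rule enc(3))
  show "ys ! (2 * k + 2) = snd (quotient_of (rip_matrix n s E $$ (k div (2 * n), k mod (2 * n))))"
    if "k < 2 * n * (2 * n)" using that by (rule enc(4))
qed

lemma value_bound_ge:
  "n \<le> value_bound n" "n * n \<le> value_bound n" "2 * n \<le> value_bound n"
  "2 * n * (2 * n) \<le> value_bound n" "n + 2 \<le> value_bound n"
proof -
  have "2 * n * (2 * n) = 4 * (n * n)" "n \<le> n * n" by simp_all
  then show "n \<le> value_bound n" "n * n \<le> value_bound n" "2 * n \<le> value_bound n"
    "2 * n * (2 * n) \<le> value_bound n" "n + 2 \<le> value_bound n"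
    unfolding value_bound_def by linarith+
qed

lemma store_bound_init_store:
  assumes "\<And>x. x \<in> set xs \<Longrightarrow> \<bar>x\<bar> \<le> int b"
  shows "store_bound b (init_store xs)"
  unfolding store_bound_def init_store_def using assms by auto

lemma store_bound_encode_graph: "store_bound (value_bound n) (init_store (encode_graph n E))"
  using value_bound_ge(1,5)[of n]
  by (intro store_bound_init_store) (auto simp: encode_graph_eq split: if_splits)

lemma abs_encode_rip_matrix_le:
  fixes n s :: nat and E
  defines "ys \<equiv> encode_matrix (rip_matrix n s E)"
  assumes s: "0 < s" "s \<le> n" and i: "i < length ys"
  shows "\<bar>ys ! i\<bar> \<le> int (value_bound n)"
proof -
  note ys_nth = encode_rip_matrix_nth[where n = n and s = s and E = E, folded ys_def]
  define b where "b = value_bound n"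
  have b: "n \<le> b" "2 * n \<le> b" "n + 2 \<le> b" using value_bound_ge[of n] by (simp_all add: b_def)
  have n: "0 < n" using s by simp
  have q: "\<bar>fst (quotient_of (rip_matrix n s E $$ (k div (2 * n), k mod (2 * n))))\<bar> \<le> int b"
    "\<bar>snd (quotient_of (rip_matrix n s E $$ (k div (2 * n), k mod (2 * n))))\<bar> \<le> int b"
    if "k < 2 * n * (2 * n)" for k
  proof -
    have lt: "k div (2 * n) < 2 * n" "k mod (2 * n) < 2 * n"
      using that n by (auto simp: less_mult_imp_div_less)
    show "\<bar>fst (quotient_of (rip_matrix n s E $$ (k div (2 * n), k mod (2 * n))))\<bar> \<le> int b"
      "\<bar>snd (quotient_of (rip_matrix n s E $$ (k div (2 * n), k mod (2 * n))))\<bar> \<le> int b"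
      unfolding quotient_of_rip_matrix[OF lt s(1)] using b s n by auto
  qed
  consider "i = 0" | k where "i = 2 * k + 1" "k < 2 * n * (2 * n)" | k where "i = 2 * k + 2" "k < 2 * n * (2 * n)"
  proof (cases "even i")
    case True
    then obtain k where "i = 2 * k" by (elim evenE)
    then show ?thesis using that(1) that(3)[of "k - 1"] i ys_nth(1) by (cases k) auto
  next
    case False
    then obtain k where "i = 2 * k + 1" by (elim oddE)
    then show ?thesis using that(2)[of k] i ys_nth(1) by auto
  qed
  then show ?thesis unfolding b_def[symmetric] using q b by cases (auto simp: ys_nth simp del: One_nat_def add_2_eq_Suc' )
qed

lemma runs_reduction:
  assumes names: "v \<noteq> g" "v \<noteq> ''in''" "g \<noteq> ''in''" and n: "2 \<le> n"
  shows "runs (reduction_prog v g) (init_store (encode_graph n E)) (reduction_time v g n)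
    (\<lambda>u. \<forall>a. a \<noteq> v \<longrightarrow> a \<noteq> g \<longrightarrow> u a = init_store (encode_matrix (rip_matrix n (scale n) E)) a)"
proof -
  define s where "s = scale n"
  define b where "b = value_bound n"
  define f where "f i = (if {i div n, i mod n} \<in> E then 1 else 0 :: int)" for i
  define xs where "xs = encode_graph n E"
  define ys where "ys = encode_matrix (rip_matrix n s E)"
  define old where "old = init_store xs ''in''"
  \<comment> \<open>The loop invariants are explicit stores. \<open>V\<close> lists the four
    registers, \<open>G k\<close> holds the first k copied entries, and \<open>X k\<close> is the
    array \<open>''in''\<close> with its first 2k + 1 cells already overwritten.\<close>
  define V where "V k l m = ((\<lambda>_. 0)(0 := int n, 1 := int k, 2 := int l, 3 := int m) :: int \<Rightarrow> int)" for k l m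
  define G where "G k i = (if 0 \<le> i \<and> i < int k then f (nat i) else 0)" for k i
  define X where "X k i = (if 0 \<le> i \<and> i \<le> 2 * int k then ys ! nat i else old i)" for k i
  define S1 where "S1 k = (init_store xs)(v := V k 0 0, g := G k)" for k
  define S2 where "S2 l = (init_store xs)(v := V (n * n) l 0, g := G (n * n))" for l
  define S3 where "S3 m = (init_store xs)(v := V (n * n) s m, g := G (n * n), ''in'' := X m)" for m
  have s: "0 < s" "s \<le> n" using n scale_le_self by (auto simp: s_def less_scale_iff)
  have b: "n \<le> b" "n * n \<le> b" "2 * n \<le> b" "2 * n * (2 * n) \<le> b" "n + 2 \<le> b"
    unfolding b_def by (rule value_bound_ge)+
  have xs_nth: "xs ! 0 = int n" "length xs = n * n + 1" "i < n * n \<Longrightarrow> xs ! Suc i = f i" for i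
    unfolding xs_def encode_graph_eq f_def by simp_all
  have old: "old 0 = int n" "i < n * n \<Longrightarrow> old (int i + 1) = f i" "int (n * n) < j \<Longrightarrow> old j = 0" "j < 0 \<Longrightarrow> old j = 0" for i j
  proof -
    have eq: "old j = (if 0 \<le> j \<and> j < int (n * n) + 1 then xs ! nat j else 0)" for j
      by (simp add: old_def init_store_def xs_nth(2) add.commute)
    show "old 0 = int n" using xs_nth(1) by (simp add: eq del: of_nat_mult)
    show "old (int i + 1) = f i" if "i < n * n"
    proof -
      have "int i + 1 < int (n * n) + 1" "nat (int i + 1) = Suc i" using that by linarith+
      then show ?thesis using xs_nth(3)[OF that] by (simp add: eq del: of_nat_mult)
    qed
    show "old j = 0" if "int (n * n) < j" using that by (simp add: eq del: of_nat_mult)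
    show "old j = 0" if "j < 0" using that by (simp add: eq)
  qed
  note ys_nth = encode_rip_matrix_nth[where n = n and s = s and E = E, folded ys_def]
  have ys_bound: "\<bar>ys ! i\<bar> \<le> int b" if "i < length ys" for i
    using abs_encode_rip_matrix_le[OF s] that unfolding ys_def b_def by simp
  have init_bound: "store_bound b (init_store xs)"
    unfolding b_def xs_def by (rule store_bound_encode_graph)
  have V_bound: "\<bar>V k l m i\<bar> \<le> int b" if "k \<le> n * n" "l \<le> n" "m \<le> 2 * n * (2 * n)" for k l m i
    using that b by (auto simp: V_def)
  have G_bound: "\<bar>G k i\<bar> \<le> int b" for k i using b n by (auto simp: G_def f_def)
  have X_bound: "\<bar>X k i\<bar> \<le> int b" if "k \<le> 2 * n * (2 * n)" for k i
    using that ys_bound[of "nat i"] init_bound ys_nth(1) by (auto simp: X_def old_def store_bound_def)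
  have S1_bound: "store_bound b (S1 k)" if "k \<le> n * n" for k
    unfolding S1_def using that by (intro store_bound_upd V_bound G_bound) (auto simp: init_bound)
  have S2_bound: "store_bound b (S2 l)" if "l \<le> n" for l
    unfolding S2_def using that by (intro store_bound_upd V_bound G_bound) (auto simp: init_bound)
  have S3_bound: "store_bound b (S3 m)" if "m \<le> 2 * n * (2 * n)" for m
    unfolding S3_def using that s
    by (intro store_bound_upd V_bound G_bound X_bound) (auto simp: init_bound)
  have step1: "runs (copy_body v g) (S1 k) ((cost_bound (var v 1) b + cost_bound (Load ''in'' (Op Add (var v 1) (Const 1))) b)
      + (cost_bound (Const 1) b + cost_bound (Op Add (var v 1) (Const 1)) b)) (\<lambda>u. u = S1 (Suc k))"
    if k: "k < n * n" for k
    unfolding copy_body_def incr_def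
  proof (rule runs_Seq[where Q = "\<lambda>u. u = (S1 k)(g := G (Suc k))"])
    have "(G k)(int k := f k) = G (Suc k)" by (auto simp: G_def)
    then show "runs (Assign g (var v 1) (Load ''in'' (Op Add (var v 1) (Const 1)))) (S1 k)
       (cost_bound (var v 1) b + cost_bound (Load ''in'' (Op Add (var v 1) (Const 1))) b) (\<lambda>u. u = (S1 k)(g := G (Suc k)))"
      using k names old(2)[OF k]
      by (intro runs_Assign S1_bound) (auto simp: S1_def V_def old_def[symmetric])
  next
    fix u assume u: "u = (S1 k)(g := G (Suc k))"
    have "store_bound b u"
      unfolding u using k by (intro store_bound_upd S1_bound G_bound) auto
    moreover have "(V k 0 0)(1 := int k + 1) = V (Suc k) 0 0" by (auto simp: V_def)
    ultimately show "runs (Assign v (Const 1) (Op Add (var v 1) (Const 1))) u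
       (cost_bound (Const 1) b + cost_bound (Op Add (var v 1) (Const 1)) b) (\<lambda>u. u = S1 (Suc k))"
      using names by (intro runs_Assign) (auto simp: u S1_def V_def fun_upd_twist)
  qed
  have step2: "runs (incr v 2) (S2 l) (cost_bound (Const 2) b + cost_bound (Op Add (var v 2) (Const 1)) b) (\<lambda>u. u = S2 (Suc l))"
    if l: "l < s" for l
  proof -
    have "(V (n * n) l 0)(2 := int l + 1) = V (n * n) (Suc l) 0" by (auto simp: V_def)
    then show ?thesis
      unfolding incr_def using names l s by (intro runs_Assign S2_bound) (auto simp: S2_def V_def fun_upd_twist)
  qed
  have step3: "runs (fill_body v g) (S3 m)
      ((cost_bound (Op Add (Op Mul (Const 2) (var v 3)) (Const 1)) b + cost_bound (num_expr v g) b)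
        + ((cost_bound (Op Add (Op Mul (Const 2) (var v 3)) (Const 2)) b + cost_bound (den_expr v) b)
        + (cost_bound (Const 3) b + cost_bound (Op Add (var v 3) (Const 1)) b))) (\<lambda>u. u = S3 (Suc m))"
    if m: "m < 2 * n * (2 * n)" for m
  proof -
    define U where "U = (S3 m)(''in'' := (X m)(2 * int m + 1 := ys ! (2 * m + 1)))"
    define W where "W = (S3 m)(''in'' := X (Suc m))"
    have vals: "val (num_expr v g) u = ys ! (2 * m + 1)" "val (den_expr v) u = ys ! (2 * m + 2)"
      if "u v = V (n * n) s m" "u g = G (n * n)" for u
    proof -
      have "u g (int i) = (if {i div n, i mod n} \<in> E then 1 else 0)" if "i < n * n" for i
        using that \<open>u g = G (n * n)\<close> by (simp add: G_def f_def del: of_nat_mult)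
      moreover have "u v 0 = int n" "u v 2 = int s" "u v 3 = int m"
        using \<open>u v = V (n * n) s m\<close> by (simp_all add: V_def)
      ultimately show "val (num_expr v g) u = ys ! (2 * m + 1)" "val (den_expr v) u = ys ! (2 * m + 2)"
        unfolding ys_nth(3,4)[OF m] using val_num_den_expr[OF m s(1)] by blast+
    qed
    have in_upd: "(X m)(2 * int m + 1 := ys ! (2 * m + 1), 2 * int m + 2 := ys ! (2 * m + 2)) = X (Suc m)"
    proof
      fix i
      have "nat (2 * int m + 1) = 2 * m + 1" "nat (2 * int m + 2) = 2 * m + 2" by auto
      then show "((X m)(2 * int m + 1 := ys ! (2 * m + 1), 2 * int m + 2 := ys ! (2 * m + 2))) i = X (Suc m) i"
        by (auto simp: X_def simp del: One_nat_def add_2_eq_Suc')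
    qed
    have "runs (Assign ''in'' (Op Add (Op Mul (Const 2) (var v 3)) (Const 1)) (num_expr v g)) (S3 m)
      (cost_bound (Op Add (Op Mul (Const 2) (var v 3)) (Const 1)) b + cost_bound (num_expr v g) b) (\<lambda>u. u = U)"
      using names m vals[of "S3 m"]
      by (intro runs_Assign S3_bound) (auto simp: U_def S3_def V_def)
    moreover have "runs (Assign ''in'' (Op Add (Op Mul (Const 2) (var v 3)) (Const 2)) (den_expr v)) U
      (cost_bound (Op Add (Op Mul (Const 2) (var v 3)) (Const 2)) b + cost_bound (den_expr v) b) (\<lambda>u. u = W)"
    proof (intro runs_Assign)
      show "store_bound b U"
        unfolding U_def using m ys_bound[of "2 * m + 1"] ys_nth(1)
        by (intro store_bound_upd S3_bound) (auto intro: X_bound)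
      show "U(''in'' := (U ''in'')(val (Op Add (Op Mul (Const 2) (var v 3)) (Const 2)) U := val (den_expr v) U)) = W"
        using names vals[of U] in_upd by (auto simp: U_def W_def S3_def V_def)
    qed
    moreover have "runs (incr v 3) W (cost_bound (Const 3) b + cost_bound (Op Add (var v 3) (Const 1)) b) (\<lambda>u. u = S3 (Suc m))"
      unfolding incr_def
    proof (intro runs_Assign)
      show "store_bound b W"
        unfolding W_def using m by (intro store_bound_upd S3_bound X_bound) auto
      have "(V (n * n) s m)(3 := int m + 1) = V (n * n) s (Suc m)" by (auto simp: V_def)
      then show "W(v := (W v)(val (Const 3) W := val (Op Add (var v 3) (Const 1)) W)) = S3 (Suc m)"
        using names by (auto simp: W_def S3_def V_def fun_upd_twist)
    qed
    ultimately show ?thesis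
      unfolding fill_body_def by (intro runs_Seq[where Q = "\<lambda>u. u = U"] runs_Seq[where Q = "\<lambda>u. u = W"]) auto
  qed
  define c where "c e = cost_bound e b" for e
  have init: "runs (Assign v (Const 0) (var ''in'' 0)) (init_store xs) (c (Const 0) + c (var ''in'' 0)) (\<lambda>u. u = S1 0)"
    unfolding c_def
  proof (intro runs_Assign)
    show "store_bound b (init_store xs)" by (rule init_bound)
    have "init_store xs v = (\<lambda>_. 0)" "init_store xs g = (\<lambda>_. 0)" "init_store xs ''in'' 0 = int n"
      using names old(1) by (auto simp: init_store_def old_def)
    moreover have "V 0 0 0 = (\<lambda>_. 0)(0 := int n)" "G 0 = (\<lambda>_. 0)" by (auto simp: V_def G_def)
    ultimately show "(init_store xs)(v := (init_store xs v)(val (Const 0) (init_store xs) := val (var ''in'' 0) (init_store xs))) = S1 0"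
      using names by (auto simp: S1_def)
  qed
  have loop1: "runs (While (copy_test v) (copy_body v g)) (S1 0)
      (Suc (n * n) * (c (copy_test v) + ((c (var v 1) + c (Load ''in'' (Op Add (var v 1) (Const 1))))
        + (c (Const 1) + c (Op Add (var v 1) (Const 1)))))) (\<lambda>u. n * n \<le> n * n \<and> u = S1 (n * n))"
    unfolding c_def
  proof (rule runs_While[where I = "\<lambda>k u. k \<le> n * n \<and> u = S1 k"])
    have test: "val (copy_test v) (S1 k) = int (n * n) - int k" for k
      using names by (simp add: copy_test_def S1_def V_def)
    show "0 < val (copy_test v) u \<and> runs (copy_body v g) u
        ((cost_bound (var v 1) b + cost_bound (Load ''in'' (Op Add (var v 1) (Const 1))) b)
        + (cost_bound (Const 1) b + cost_bound (Op Add (var v 1) (Const 1)) b)) (\<lambda>u. Suc k \<le> n * n \<and> u = S1 (Suc k))"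
      if "k < n * n" "k \<le> n * n \<and> u = S1 k" for k u
      using that runs_mono[OF step1[OF that(1)] order_refl] by (auto simp: test simp del: of_nat_mult)
    show "val (copy_test v) u \<le> 0" if "n * n \<le> n * n \<and> u = S1 (n * n)" for u
      using that test by simp
    show "store_bound b u" if "k \<le> n * n \<and> u = S1 k" for k u
      using that S1_bound by simp
  qed simp
  have "runs (While (root_test v) (incr v 2)) (S2 0)
      (Suc s * (c (root_test v) + (c (Const 2) + c (Op Add (var v 2) (Const 1))))) (\<lambda>u. s \<le> s \<and> u = S2 s)"
    unfolding c_def
  proof (rule runs_While[where I = "\<lambda>k u. k \<le> s \<and> u = S2 k"])
    have test: "val (root_test v) (S2 k) = int (2 * n) - int (3 * (k + 1)\<^sup>2) + 1" for k
      using names by (simp add: root_test_def S2_def V_def power2_eq_square algebra_simps)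
    have pos: "0 < val (root_test v) (S2 k) \<longleftrightarrow> k < s" for k
      unfolding test s_def less_scale_iff by linarith
    show "0 < val (root_test v) u \<and> runs (incr v 2) u
        (cost_bound (Const 2) b + cost_bound (Op Add (var v 2) (Const 1)) b) (\<lambda>u. Suc k \<le> s \<and> u = S2 (Suc k))"
      if "k < s" "k \<le> s \<and> u = S2 k" for k u
      using that runs_mono[OF step2[OF that(1)] order_refl] by (auto simp: pos)
    show "val (root_test v) u \<le> 0" if "s \<le> s \<and> u = S2 s" for u
      using that pos[of s] by auto
    show "store_bound b u" if "k \<le> s \<and> u = S2 k" for k u
      using that S2_bound s by simp
  qed simp
  then have loop2: "runs (While (root_test v) (incr v 2)) (S2 0)
      (Suc n * (c (root_test v) + (c (Const 2) + c (Op Add (var v 2) (Const 1))))) (\<lambda>u. u = S2 s)"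
    using s by (elim runs_mono) (auto intro!: mult_right_mono)
  have store: "runs (Assign ''in'' (Const 0) (Op Mul (Const 2) (var v 0))) (S2 s)
      (c (Const 0) + c (Op Mul (Const 2) (var v 0))) (\<lambda>u. u = S3 0)"
    unfolding c_def
  proof (intro runs_Assign S2_bound s)
    have "X 0 = old(0 := 2 * int n)" using ys_nth(2) by (auto simp: X_def)
    then show "(S2 s)(''in'' := (S2 s ''in'')(val (Const 0) (S2 s) := val (Op Mul (Const 2) (var v 0)) (S2 s))) = S3 0"
      using names by (auto simp: S2_def S3_def V_def old_def fun_upd_twist)
  qed
  have loop3: "runs (While (fill_test v) (fill_body v g)) (S3 0)
      (Suc (2 * n * (2 * n)) * (c (fill_test v) +
        ((c (Op Add (Op Mul (Const 2) (var v 3)) (Const 1)) + c (num_expr v g))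
        + ((c (Op Add (Op Mul (Const 2) (var v 3)) (Const 2)) + c (den_expr v))
        + (c (Const 3) + c (Op Add (var v 3) (Const 1)))))))
      (\<lambda>u. 2 * n * (2 * n) \<le> 2 * n * (2 * n) \<and> u = S3 (2 * n * (2 * n)))"
    unfolding c_def
  proof (rule runs_While[where I = "\<lambda>k u. k \<le> 2 * n * (2 * n) \<and> u = S3 k"])
    have test: "val (fill_test v) (S3 k) = int (2 * n * (2 * n)) - int k" for k
      using names by (simp add: fill_test_def S3_def V_def)
    show "0 < val (fill_test v) u \<and> runs (fill_body v g) u
      ((cost_bound (Op Add (Op Mul (Const 2) (var v 3)) (Const 1)) b + cost_bound (num_expr v g) b)
        + ((cost_bound (Op Add (Op Mul (Const 2) (var v 3)) (Const 2)) b + cost_bound (den_expr v) b)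
        + (cost_bound (Const 3) b + cost_bound (Op Add (var v 3) (Const 1)) b)))
        (\<lambda>u. Suc k \<le> 2 * n * (2 * n) \<and> u = S3 (Suc k))"
      if "k < 2 * n * (2 * n)" "k \<le> 2 * n * (2 * n) \<and> u = S3 k" for k u
    proof
      show "0 < val (fill_test v) u" unfolding conjunct2[OF that(2)] test using that(1) by linarith
      show "runs (fill_body v g) u
      ((cost_bound (Op Add (Op Mul (Const 2) (var v 3)) (Const 1)) b + cost_bound (num_expr v g) b)
        + ((cost_bound (Op Add (Op Mul (Const 2) (var v 3)) (Const 2)) b + cost_bound (den_expr v) b)
        + (cost_bound (Const 3) b + cost_bound (Op Add (var v 3) (Const 1)) b)))
        (\<lambda>u. Suc k \<le> 2 * n * (2 * n) \<and> u = S3 (Suc k))"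
        using that step3[OF that(1)] by (elim conjE, hypsubst) (erule runs_mono; simp)
    qed
    show "val (fill_test v) u \<le> 0" if "2 * n * (2 * n) \<le> 2 * n * (2 * n) \<and> u = S3 (2 * n * (2 * n))" for u
      using that test by simp
    show "store_bound b u" if "k \<le> 2 * n * (2 * n) \<and> u = S3 k" for k u
      using that S3_bound by simp
  qed simp
  have "S1 (n * n) = S2 0" by (simp add: S1_def S2_def)
  then have "runs (reduction_prog v g) (init_store xs) (reduction_time v g n) (\<lambda>u. u = S3 (2 * n * (2 * n)))"
    unfolding reduction_prog_def reduction_time_def Let_def b_def[symmetric] c_def[symmetric]
    by (intro runs_Seq[OF init] runs_Seq[OF loop1] runs_Seq[OF loop2] runs_Seq[OF store] runs_mono[OF loop3 order_refl]
         | simp only: simp_thms)+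
  moreover have "S3 (2 * n * (2 * n)) a = init_store ys a" if "a \<noteq> v" "a \<noteq> g" for a
  proof (cases "a = ''in''")
    case True
    \<comment> \<open>The graph occupied n^2 + 1 cells and the matrix takes 8 n^2 + 1, so nothing of
      the graph survives beyond the new input.\<close>
    have "old i = 0" if "2 * int (2 * n * (2 * n)) < i \<or> i < 0" for i
    proof -
      have "int (n * n) \<le> 2 * int (2 * n * (2 * n))" by simp
      with that have "int (n * n) < i \<or> i < 0" by linarith
      then show ?thesis using old(3,4) by blast
    qed
    then show ?thesis
      using True names ys_nth(1) by (auto simp: S3_def X_def init_store_def fun_eq_iff)
  next
    case False
    then show ?thesis using that by (auto simp: S3_def init_store_def)
  qed
  ultimately show ?thesis
    unfolding xs_def[symmetric] s_def[symmetric] ys_def[symmetric] by (auto elim: runs_mono)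
qed


section \<open>From RIP certification to hidden cliques\<close>

lemma length_le_input_size: "length xs \<le> input_size xs"
  unfolding input_size_def
proof (induction xs)
  case (Cons x xs)
  then show ?case using bit_size_ge_1[of x] by simp
qed simp

lemma input_size_le:
  assumes "\<And>x. x \<in> set xs \<Longrightarrow> \<bar>x\<bar> \<le> int b"
  shows "input_size xs \<le> length xs * (b + 1)"
proof -
  have "bit_size x \<le> b + 1" if "x \<in> set xs" for x
    using bit_size_le[of x] assms[OF that] by linarith
  then have "(\<Sum>x\<leftarrow>xs. bit_size x) \<le> (\<Sum>x\<leftarrow>xs. b + 1)" by (rule sum_list_mono)
  then show ?thesis by (simp add: input_size_def sum_list_triv)
qed

lemma le_input_size_encode_graph: "n \<le> input_size (encode_graph n E)"
proof -
  have "n \<le> n * n" by simp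
  also have "\<dots> \<le> length (encode_graph n E)" by (simp add: encode_graph_eq)
  finally show ?thesis using length_le_input_size order_trans by blast
qed

lemma input_size_encode_rip_matrix:
  assumes "0 < s" "s \<le> n"
  shows "input_size (encode_matrix (rip_matrix n s E)) \<le> (2 * (2 * n * (2 * n)) + 1) * (value_bound n + 1)"
proof -
  have "input_size (encode_matrix (rip_matrix n s E))
      \<le> length (encode_matrix (rip_matrix n s E)) * (value_bound n + 1)"
  proof (rule input_size_le)
    fix x assume "x \<in> set (encode_matrix (rip_matrix n s E))"
    then show "\<bar>x\<bar> \<le> int (value_bound n)"
      using abs_encode_rip_matrix_le[OF assms] by (auto simp: in_set_conv_nth)
  qed
  then show ?thesis by (simp only: encode_rip_matrix_nth(1))
qed

definition invert_output :: prog where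
  "invert_output = Cond (var ''out'' 0) (Assign ''out'' (Const 0) (Const 0)) (Assign ''out'' (Const 0) (Const 1))"

lemma exec_invert_output:
  "\<exists>t u. exec invert_output s t u \<and> t \<le> bit_size (s ''out'' 0) + 2 * bit_size 0 + (bit_size 0 + bit_size 1)
     \<and> u ''out'' 0 = (if 0 < s ''out'' 0 then 0 else 1)"
proof (cases "0 < s ''out'' 0")
  case True
  define t where "t = cost (var ''out'' 0) s + (cost (Const 0) s + cost (Const 0) s)"
  define u where "u = s(''out'' := (s ''out'')(val (Const 0) s := val (Const 0) s))"
  have "exec invert_output s t u"
    unfolding invert_output_def t_def u_def using True by (intro exec_CondTrue exec_Assign) simp
  then show ?thesis
    using True by (intro exI[of _ t] exI[of _ u]) (auto simp: t_def u_def var_def)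
next
  case False
  define t where "t = cost (var ''out'' 0) s + (cost (Const 0) s + cost (Const 1) s)"
  define u where "u = s(''out'' := (s ''out'')(val (Const 0) s := val (Const 1) s))"
  have "exec invert_output s t u"
    unfolding invert_output_def t_def u_def using False by (intro exec_CondFalse exec_Assign) simp
  then show ?thesis
    using False by (intro exI[of _ t] exI[of _ u]) (auto simp: t_def u_def var_def)
qed

lemma init_store_encode_graph_0: "init_store (encode_graph n E) ''in'' 0 = int n"
  by (simp add: init_store_def encode_graph_eq del: of_nat_mult)

text \<open>Below n0 nothing is known about P, and the answer is yes for every graph. This is safe:
  the clique condition asks for yes at every n, whereas the answer no is required only
  asymptotically. The guard n - (n0 - 1) is positive iff n0 <= n.\<close>

definition solver :: "string \<Rightarrow> string \<Rightarrow> nat \<Rightarrow> prog \<Rightarrow> prog" where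
  "solver v g n0 P = Cond (Op Sub (var ''in'' 0) (Const (int n0 - 1)))
     (Seq (reduction_prog v g) (Seq P invert_output))
     (Assign ''out'' (Const 0) (Const 1))"

lemma exec_solver_small:
  assumes "n < n0"
  shows "\<exists>t u. exec (solver v g n0 P) (init_store (encode_graph n E)) t u \<and>
    t \<le> cost_bound (Op Sub (var ''in'' 0) (Const (int n0 - 1))) (value_bound n) + (bit_size 0 + bit_size 1)
    \<and> u ''out'' 0 = 1"
proof -
  let ?e = "Op Sub (var ''in'' 0) (Const (int n0 - 1))" and ?s = "init_store (encode_graph n E)"
  define t where "t = cost ?e ?s + (cost (Const 0) ?s + cost (Const 1) ?s)"
  define u where "u = ?s(''out'' := (?s ''out'')(val (Const 0) ?s := val (Const 1) ?s))"
  have "val ?e ?s \<le> 0" using assms by (simp add: init_store_encode_graph_0)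
  then have "exec (solver v g n0 P) ?s t u"
    unfolding solver_def t_def u_def by (intro exec_CondFalse exec_Assign)
  moreover have "t \<le> cost_bound ?e (value_bound n) + (bit_size 0 + bit_size 1)"
    unfolding t_def cost.simps(1) by (intro add_right_mono cost_le store_bound_encode_graph)
  ultimately show ?thesis by (intro exI[of _ t] exI[of _ u]) (simp add: u_def)
qed

lemma exec_solver_large:
  assumes names: "v \<noteq> g" "v \<notin> insert ''in'' (insert ''out'' (prog_names P))" "g \<notin> insert ''in'' (insert ''out'' (prog_names P))"
    and n: "2 \<le> n0" "n0 \<le> n"
    and P: "exec P (init_store (encode_matrix (rip_matrix n (scale n) E))) t s"
  shows "\<exists>t' u. exec (solver v g n0 P) (init_store (encode_graph n E)) t' u \<and>
    t' \<le> cost_bound (Op Sub (var ''in'' 0) (Const (int n0 - 1))) (value_bound n)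
         + (reduction_time v g n + (2 * t + (4 * bit_size 0 + bit_size 1)))
    \<and> u ''out'' 0 = (if 0 < s ''out'' 0 then 0 else 1)"
proof -
  let ?e = "Op Sub (var ''in'' 0) (Const (int n0 - 1))" and ?s = "init_store (encode_graph n E)"
  have "runs (reduction_prog v g) ?s (reduction_time v g n)
    (\<lambda>u. \<forall>a. a \<noteq> v \<longrightarrow> a \<noteq> g \<longrightarrow> u a = init_store (encode_matrix (rip_matrix n (scale n) E)) a)"
    using names n by (intro runs_reduction) auto
  then obtain t1 s1 where s1: "exec (reduction_prog v g) ?s t1 s1" "t1 \<le> reduction_time v g n"
    "\<And>a. a \<noteq> v \<Longrightarrow> a \<noteq> g \<Longrightarrow> s1 a = init_store (encode_matrix (rip_matrix n (scale n) E)) a"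
    unfolding runs_def by blast
  \<comment> \<open>The run of P is moved from a fresh store to the one left by the reduction; the
    two agree except on \<open>v\<close> and \<open>g\<close>.\<close>
  have "\<exists>s2. exec P s1 t s2 \<and> (\<forall>a\<in>- {v, g}. s a = s2 a)"
    using names s1(3) by (intro exec_agree[OF P]) auto
  then obtain s2 where s2: "exec P s1 t s2" "s2 ''out'' 0 = s ''out'' 0"
    using names by auto
  obtain t3 u where u: "exec invert_output s2 t3 u"
    "t3 \<le> bit_size (s2 ''out'' 0) + 2 * bit_size 0 + (bit_size 0 + bit_size 1)"
    "u ''out'' 0 = (if 0 < s2 ''out'' 0 then 0 else 1)"
    using exec_invert_output by blast
  \<comment> \<open>The output register starts at 0 and gains at most t bits, so inverting it costs
    another t up to a constant; hence the term \<open>2 * t\<close> in the bound.\<close>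
  have "bit_size (s ''out'' 0) \<le> bit_size 0 + t"
    using exec_bit_size_le[OF P, of "''out''" 0] by (simp add: init_store_def)
  with u(2) s2(2) have t3: "t3 \<le> t + (4 * bit_size 0 + bit_size 1)" by simp
  have "0 < val ?e ?s" using n by (simp add: init_store_encode_graph_0)
  then have "exec (solver v g n0 P) ?s (cost ?e ?s + (t1 + (t + t3))) u"
    unfolding solver_def using s1 s2 u by (intro exec_CondTrue exec_Seq)
  moreover have "cost ?e ?s + (t1 + (t + t3)) \<le> cost_bound ?e (value_bound n)
         + (reduction_time v g n + (2 * t + (4 * bit_size 0 + bit_size 1)))"
    using cost_le[OF store_bound_encode_graph, of ?e n E] s1(2) t3 by linarith
  moreover have "u ''out'' 0 = (if 0 < s ''out'' 0 then 0 else 1)" using u(3) s2(2) by simp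
  ultimately show ?thesis by blast
qed

text \<open>The input size of the matrix is polynomial in n, and n is at most the input size of the
  graph; so composing polynomials yields a polynomial bound for Q. The answers are transferred for
  every output w of P, independently of what P is meant to decide.\<close>

lemma rip_algorithm_to_clique_algorithm:
  assumes P: "polynomial_time_on {encode_matrix \<Phi> |n \<Phi>. \<Phi> \<in> carrier_mat n n} P" and n0: "2 \<le> n0"
  obtains Q where "polynomial_time_on {encode_graph n E |n E. E \<in> graphs n} Q"
    and "\<And>n E. n < n0 \<Longrightarrow> outputs Q (encode_graph n E) 1"
    and "\<And>n E w. n0 \<le> n \<Longrightarrow> outputs P (encode_matrix (rip_matrix n (scale n) E)) w \<Longrightarrow>
      outputs Q (encode_graph n E) (if 0 < w then 0 else 1)"
proof -
  \<comment> \<open>A program mentions finitely many arrays, so fresh names for the two auxiliary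
    arrays exist.\<close>
  define A where "A = insert ''in'' (insert ''out'' (prog_names P))"
  have A: "finite A" by (simp add: A_def finite_prog_names)
  obtain v where v: "v \<notin> A" using ex_new_if_finite[OF infinite_UNIV_listI A] by blast
  obtain g where "g \<notin> insert v A"
    using ex_new_if_finite[OF infinite_UNIV_listI finite.insertI[OF A]] by blast
  with v have names: "v \<noteq> g" "v \<notin> insert ''in'' (insert ''out'' (prog_names P))"
    "g \<notin> insert ''in'' (insert ''out'' (prog_names P))"
    by (auto simp: A_def)
  define Q where "Q = solver v g n0 P"
  obtain p where p: "\<And>n \<Phi>. \<Phi> \<in> carrier_mat n n \<Longrightarrow>
      \<exists>t s. exec P (init_store (encode_matrix \<Phi>)) t s \<and> t \<le> poly p (input_size (encode_matrix \<Phi>))"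
    using P unfolding polynomial_time_on_def by blast
  define T where "T n = cost_bound (Op Sub (var ''in'' 0) (Const (int n0 - 1))) (value_bound n)
      + (reduction_time v g n + (2 * poly p ((2 * (2 * n * (2 * n)) + 1) * (value_bound n + 1))
      + (4 * bit_size 0 + bit_size 1)))" for n
  have "poly_bounded value_bound"
    unfolding value_bound_def by (intro poly_bounded_add poly_bounded_mult poly_bounded_const poly_bounded_id)
  then have "poly_bounded T"
    unfolding T_def by (intro poly_bounded_add poly_bounded_mult poly_bounded_const poly_bounded_id
        poly_bounded_cost_bound poly_bounded_poly poly_bounded_reduction_time)
  then obtain r where r: "\<And>n. T n \<le> poly r n" unfolding poly_bounded_def by blast
  have time: "\<exists>t u. exec Q (init_store (encode_graph n E)) t u \<and> t \<le> T n" for n E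
  proof (cases "n < n0")
    case True
    then show ?thesis using exec_solver_small[of n n0 v g P E] unfolding Q_def T_def by fastforce
  next
    case False
    then have n: "n0 \<le> n" by simp
    then have s: "0 < scale n" "scale n \<le> n" using n0 scale_le_self by (auto simp: less_scale_iff)
    obtain t s where t: "exec P (init_store (encode_matrix (rip_matrix n (scale n) E))) t s"
      "t \<le> poly p (input_size (encode_matrix (rip_matrix n (scale n) E)))"
      using p[OF rip_matrix_carrier] by blast
    have "t \<le> poly p ((2 * (2 * n * (2 * n)) + 1) * (value_bound n + 1))"
      using t(2) poly_nat_mono[OF input_size_encode_rip_matrix[OF s]] by (rule order_trans)
    then show ?thesis
      using exec_solver_large[OF names n0 n t(1)] unfolding Q_def T_def by fastforce
  qed
  show thesis
  proof (rule that)
    show "polynomial_time_on {encode_graph n E |n E. E \<in> graphs n} Q"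
      unfolding polynomial_time_on_def
    proof (intro exI[of _ r] ballI)
      fix xs assume "xs \<in> {encode_graph n E |n E. E \<in> graphs n}"
      then obtain n E where xs: "xs = encode_graph n E" by blast
      from time obtain t u where "exec Q (init_store xs) t u" "t \<le> T n" unfolding xs by blast
      moreover have "T n \<le> poly r (input_size xs)"
        using r[of n] poly_nat_mono[OF le_input_size_encode_graph] unfolding xs by (rule order_trans)
      ultimately show "\<exists>t u. exec Q (init_store xs) t u \<and> t \<le> poly r (input_size xs)"
        by (meson order_trans)
    qed
    show "outputs Q (encode_graph n E) 1" if "n < n0" for n E
      using exec_solver_small[OF that] unfolding outputs_def Q_def by blast
    show "outputs Q (encode_graph n E) (if 0 < w then 0 else 1)"
      if "n0 \<le> n" and w: "outputs P (encode_matrix (rip_matrix n (scale n) E)) w" for n E w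
    proof -
      obtain t s where "exec P (init_store (encode_matrix (rip_matrix n (scale n) E))) t s"
        and w_eq: "s ''out'' 0 = w"
        using w unfolding outputs_def by blast
      from exec_solver_large[OF names n0 that(1) this(1)] show ?thesis
        unfolding outputs_def Q_def w_eq by blast
    qed
  qed
qed

theorem theorem4:
  assumes "hidden_clique_hypothesis (1/6)"
  shows "\<not> (\<exists>P. polynomial_time_on {encode_matrix \<Phi> |n \<Phi>. \<Phi> \<in> carrier_mat n n} P \<and>
            (\<exists>N. \<forall>n \<ge> N. \<forall>\<Phi> \<in> carrier_mat n n.
               (rip_param (nat \<lfloor>real n powr 0.6\<rfloor>) (real_matrix \<Phi>) \<le> real n powr (-0.19) \<longrightarrow>
                  outputs P (encode_matrix \<Phi>) yes) \<and>
               (rip_param (nat \<lfloor>real n powr 0.6\<rfloor>) (real_matrix \<Phi>) \<ge> real n powr (-1/6) / 4 \<longrightarrow>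
                  outputs P (encode_matrix \<Phi>) no)))"
proof (rule notI, elim exE conjE)
  fix P N
  assume poly: "polynomial_time_on {encode_matrix \<Phi> |n \<Phi>. \<Phi> \<in> carrier_mat n n} P"
    and P: "\<forall>n \<ge> N. \<forall>\<Phi> \<in> carrier_mat n n.
               (rip_param (nat \<lfloor>real n powr 0.6\<rfloor>) (real_matrix \<Phi>) \<le> real n powr (-0.19) \<longrightarrow>
                  outputs P (encode_matrix \<Phi>) yes) \<and>
               (rip_param (nat \<lfloor>real n powr 0.6\<rfloor>) (real_matrix \<Phi>) \<ge> real n powr (-1/6) / 4 \<longrightarrow>
                  outputs P (encode_matrix \<Phi>) no)"
  obtain n1 where n1: "\<forall>n\<ge>n1. 0 < nat \<lfloor>real n powr (1 / 2 - 1 / 6)\<rfloor> \<and>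
     nat \<lfloor>real n powr (1 / 2 - 1 / 6)\<rfloor> \<le> sparsity n \<and> 0 < scale n \<and>
     real (2 * n) powr (- 1 / 6) / 4 \<le> (real (nat \<lfloor>real n powr (1 / 2 - 1 / 6)\<rfloor>) - 1) / (2 * scale n)"
    by (rule exE[OF clique_size_bounds[unfolded eventually_sequentially]]) (rule that)
  obtain n2 where n2: "\<forall>n\<ge>n2.
     \<bar>1 / 4 + n / (2 * (scale n)\<^sup>2) - 1\<bar> + (real n powr 0.305 + real (2 * n\<^sup>2) / real (n ^ 4)) / scale n
       + (real n powr 0.805 + real (4 * n ^ 3) / real (n ^ 4) + 1) / (scale n)\<^sup>2 \<le> real (2 * n) powr (- 0.19)"
    by (rule exE[OF isometry_constant_bound[unfolded eventually_sequentially]]) (rule that)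
  define n0 where "n0 = max (max 2 N) (max n1 n2)"
  have n0: "2 \<le> n0" "N \<le> n0" "n1 \<le> n0" "n2 \<le> n0" by (simp_all add: n0_def)
  note clique = n1[rule_format, OF order_trans[OF n0(3)]]
  note isometry = n2[rule_format, OF order_trans[OF n0(4)]]
  obtain Q where Q: "polynomial_time_on {encode_graph n E |n E. E \<in> graphs n} Q"
    and small: "\<And>n E. n < n0 \<Longrightarrow> outputs Q (encode_graph n E) 1"
    and flip: "\<And>n E w. n0 \<le> n \<Longrightarrow> outputs P (encode_matrix (rip_matrix n (scale n) E)) w \<Longrightarrow>
      outputs Q (encode_graph n E) (if 0 < w then 0 else 1)"
    using rip_algorithm_to_clique_algorithm[OF poly n0(1)] by blast
  \<comment> \<open>The matrix for n vertices has dimension 2n, so the guarantee that P gives from N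
    on is already in force.\<close>
  have N: "N \<le> 2 * n" if "n0 \<le> n" for n using that n0(2) by simp
  note P_spec = P[rule_format, OF N rip_matrix_carrier, folded sparsity_def]
  have P_yes: "outputs P (encode_matrix (rip_matrix n (scale n) E)) yes"
    if "n0 \<le> n" "rip_param (sparsity n) (real_matrix (rip_matrix n (scale n) E)) \<le> real (2 * n) powr (-0.19)" for n E
    using conjunct1[OF P_spec[OF that(1)]] that(2) by (rule mp)
  have P_no: "outputs P (encode_matrix (rip_matrix n (scale n) E)) no"
    if "n0 \<le> n" "real (2 * n) powr (-1/6) / 4 \<le> rip_param (sparsity n) (real_matrix (rip_matrix n (scale n) E))" for n E
    using conjunct2[OF P_spec[OF that(1)]] that(2) by (rule mp)
  \<comment> \<open>A clique pushes the RIP parameter to the upper threshold or beyond, P answers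
    no, and inversion gives yes; below n0 the answer is yes by construction.\<close>
  have "outputs Q (encode_graph n E) yes"
    if "has_clique n E (nat \<lfloor>real n powr (1/2 - 1/6)\<rfloor>)" for n E
  proof (cases "n < n0")
    case False
    then have n: "n0 \<le> n" by simp
    have "(real (nat \<lfloor>real n powr (1 / 2 - 1 / 6)\<rfloor>) - 1) / (2 * scale n)
        \<le> rip_param (sparsity n) (real_matrix (rip_matrix n (scale n) E))"
      using clique[OF n] rip_param_clique[OF that, of "sparsity n" "scale n"] by simp
    with clique[OF n] have "outputs P (encode_matrix (rip_matrix n (scale n) E)) no"
      by (intro P_no[OF n]) linarith
    from flip[OF n this] show ?thesis by simp
  qed (rule small)
  moreover have "outputs Q (encode_graph n E) no" if n: "n0 \<le> n" and good: "good_graph n E" for n E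
  proof -
    have "rip (sparsity n) (real (2 * n) powr (- 0.19)) (real_matrix (rip_matrix n (scale n) E))"
      using good[unfolded good_graph_def] clique[OF n] n n0
      by (rule_tac rip_rip_matrix[OF _ _ _ _ _ isometry[OF n]]) auto
    then have "rip_param (sparsity n) (real_matrix (rip_matrix n (scale n) E)) \<le> real (2 * n) powr (- 0.19)"
      by (intro rip_param_is_least) auto
    from flip[OF n P_yes[OF n this]] show ?thesis by simp
  qed
  then have "\<forall>\<^sub>F n in sequentially. measure_pmf.prob (random_graph n) {E. good_graph n E}
      \<le> measure_pmf.prob (random_graph n) {E. outputs Q (encode_graph n E) no}"
    unfolding eventually_sequentially
    by (intro exI[of _ n0] allI impI measure_pmf.finite_measure_mono) auto
  from tendsto_sandwich[OF this _ prob_good_graph_tendsto tendsto_const]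
  have "(\<lambda>n. measure_pmf.prob (random_graph n) {E. outputs Q (encode_graph n E) no}) \<longlonglongrightarrow> 1"
    by (simp add: measure_pmf.prob_le_1)
  ultimately show False
    using assms Q unfolding hidden_clique_hypothesis_def by blast
qed

end
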